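(* Let $F:\mathcal X\to\mathcal Y$ be a causal operator given by functions $f_t:\mathbb R^{nt}\times\Omega\to\mathbb R^m$, $t=1,\dots,T$, satisfying Assumption 1 (see context). Let $Y\subset\mathcal Y$ be convex and closed, let $x\in\mathcal X$ satisfy $F(x)\in Y$, and let $\Phi:\mathcal X\to\mathbb R$ be the function $\Phi(z)=\operatorname{dist}(F(z),Y)$. Then the Clarke subdifferential of $\Phi$ at $x$ is $$\partial\Phi(x)=[F'(x)]^*\big(N_Y(F(x))\cap \mathbb B_{\mathcal Y^*}\big),$$ where $[F'(x)]^*:\mathcal Y^*\to\mathcal X^*$ is the adjoint of the Gâteaux derivative $F'(x)$ of $F$ at $x$, and $\mathbb B_{\mathcal Y^*}$ is the closed unit ball in $\mathcal Y^*$.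
   Context: $(\Omega,\mathcal F,P)$ is a probability space with filtration $\{\emptyset,\Omega\}=\mathcal F_1\subset\mathcal F_2\subset\dots\subset\mathcal F_T=\mathcal F$, and $p\in[1,\infty)$, $1/p+1/q=1$. Put $\mathcal X_t=L_p(\Omega,\mathcal F_t,P;\mathbb R^n)$, $\mathcal Y_t=L_p(\Omega,\mathcal F_t,P;\mathbb R^m)$, $\mathcal X=\mathcal X_1\times\dots\times\mathcal X_T$, $\mathcal Y=\mathcal Y_1\times\dots\times\mathcal Y_T$, with norms $\|x\|=\big(\int\|x(\omega)\|^p\,P(d\omega)\big)^{1/p}$ (and similarly for $\mathcal Y$), where $x(\omega)=(x_1(\omega),\dots,x_T(\omega))$. The dual spaces $\mathcal X^*,\mathcal Y^*$ are the products of the corresponding $L_q$ spaces, paired via $\langle y,x\rangle=\sum_t\int y_t(\omega)^\top x_t(\omega)\,P(d\omega)$ and equipped with the dual norm. $x_{1:t}$ denotes $(x_1,\dots,x_t)$. $\operatorname{dist}(y,Y)=\inf_{z\in Y}\|y-z\|$. An operator $F:\mathcal X\to\mathcal Y$ is causal if there are functions $f_t:\mathbb R^{nt}\times\Omega\to\mathbb R^m$, each superpositionally measurable, such that $F_t(x)(\omega)=f_t(x_{1:t}(\omega),\omega)$ for all $t=1,\dots,T$, $\omega\in\Omega$, where $F=(F_1,\dots,F_T)$. Assumption 1: for all $t=1,\dots,T$: (i) $f_t(\xi,\cdot)\in\mathcal Y_t$ for all $\xi\in\mathbb R^{nt}$; (ii) for almost all $\omega$, $f_t(\cdot,\omega)$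 is continuously differentiable with respect to its first argument, with Jacobian $f_t'(\cdot,\omega)$; (iii) there is a constant $C_f$ such that $\|f_t'(\cdot,\omega)\|\le C_f$ almost surely. Under Assumption 1 the Gâteaux derivative $F'(x)$ is given by $[F'(x)h]_t(\omega)=f_t'(x_{1:t}(\omega),\omega)\,h_{1:t}(\omega)$, $t=1,\dots,T$. For a convex set $Y$ and $y\in Y$, $N_Y(y)=\{\psi\in\mathcal Y^*:\langle\psi,z-y\rangle\le0\ \text{for all } z\in Y\}$ is the normal cone. *)

theory Defs
  imports "HOL-Probability.Probability"
begin

text \<open>
  Conventions. The time set \<open>{1,...,T}\<close> is an arbitrary finite linearly ordered type \<open>'t\<close>
  (so \<open>T = CARD('t)\<close>). A process \<open>x = (x_1,...,x_T)\<close> with values in \<open>R^n\<close> is a function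
  \<open>x :: 'a \<Rightarrow> real^'n^'t\<close> with \<open>x \<omega> $ t = x_t(\<omega>)\<close>; thus \<open>norm (x \<omega>)\<close> is the Euclidean norm
  on \<open>R^(nT)\<close>. Elements of \<open>L_r\<close> spaces are handled through representatives, i.e. \<open>L_r\<close> carries
  a seminorm instead of being divided by almost sure equality. All sets of
  processes occurring below are saturated with respect to almost sure equality, hence are the same
  thing as sets of equivalence classes.
\<close>

definition filtered_prob_space :: "'a measure \<Rightarrow> ('t::{finite,linorder} \<Rightarrow> 'a measure) \<Rightarrow> bool" where
  "filtered_prob_space M Filt \<longleftrightarrow>
     prob_space M \<and>
     (\<forall>t. subalgebra M (Filt t)) \<and>
     (\<forall>s t. s \<le> t \<longrightarrow> sets (Filt s) \<subseteq> sets (Filt t)) \<and>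
     sets (Filt (Min UNIV)) = {{}, space M} \<and>
     sets (Filt (Max UNIV)) = sets M"

definition Lspace :: "'a measure \<Rightarrow> 'a measure \<Rightarrow> ennreal \<Rightarrow> ('a \<Rightarrow> 'b::euclidean_space) set" where
  "Lspace M G r = {g \<in> borel_measurable G.
     if r = \<infinity> then (\<exists>c. AE \<omega> in M. norm (g \<omega>) \<le> c)
     else integrable M (\<lambda>\<omega>. norm (g \<omega>) powr enn2real r)}"

text \<open>The product \<open>L_r(F_1) \<times> ... \<times> L_r(F_T)\<close>: this is the space \<open>X\<close> (or \<open>Y\<close>) for \<open>r = p\<close>, and
  its dual for \<open>r = q\<close>.\<close>

definition procs :: "'a measure \<Rightarrow> ('t::{finite,linorder} \<Rightarrow> 'a measure) \<Rightarrow> ennreal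
    \<Rightarrow> ('a \<Rightarrow> (real^'n, 't) vec) set" where
  "procs M Filt r = {x. \<forall>t. (\<lambda>\<omega>. x \<omega> $ t) \<in> Lspace M (Filt t) r}"

definition lp_norm :: "'a measure \<Rightarrow> real \<Rightarrow> ('a \<Rightarrow> 'b::euclidean_space) \<Rightarrow> real" where
  "lp_norm M p x = (\<integral>\<omega>. norm (x \<omega>) powr p \<partial>M) powr (1 / p)"

definition pairing :: "'a measure \<Rightarrow> ('a \<Rightarrow> (real^'n, 't::finite) vec) \<Rightarrow> ('a \<Rightarrow> (real^'n, 't) vec) \<Rightarrow> real" where
  "pairing M y x = (\<Sum>t\<in>UNIV. \<integral>\<omega>. (y \<omega> $ t) \<bullet> (x \<omega> $ t) \<partial>M)"

text \<open>The dual norm is taken with respect to adapted processes only; it is in general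
  smaller than the \<open>L_q\<close> norm of \<open>\<psi>\<close>.\<close>

definition dual_norm :: "'a measure \<Rightarrow> ('t::{finite,linorder} \<Rightarrow> 'a measure) \<Rightarrow> real
    \<Rightarrow> ('a \<Rightarrow> (real^'n, 't) vec) \<Rightarrow> real" where
  "dual_norm M Filt p \<psi> = (SUP y\<in>{y \<in> procs M Filt (ennreal p). lp_norm M p y \<le> 1}. pairing M \<psi> y)"

definition dual_ball :: "'a measure \<Rightarrow> ('t::{finite,linorder} \<Rightarrow> 'a measure) \<Rightarrow> real \<Rightarrow> ennreal
    \<Rightarrow> ('a \<Rightarrow> (real^'n, 't) vec) set" where
  "dual_ball M Filt p q = {\<psi> \<in> procs M Filt q. dual_norm M Filt p \<psi> \<le> 1}"

definition lp_dist :: "'a measure \<Rightarrow> real \<Rightarrow> ('a \<Rightarrow> 'b::euclidean_space) \<Rightarrow> ('a \<Rightarrow> 'b) set \<Rightarrow> real" where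
  "lp_dist M p y Y = (INF z\<in>Y. lp_norm M p (\<lambda>\<omega>. y \<omega> - z \<omega>))"

definition convex_procs :: "('a \<Rightarrow> 'b::real_vector) set \<Rightarrow> bool" where
  "convex_procs Y \<longleftrightarrow> (\<forall>a\<in>Y. \<forall>b\<in>Y. \<forall>u\<in>{0..1::real}. (\<lambda>\<omega>. (1 - u) *\<^sub>R a \<omega> + u *\<^sub>R b \<omega>) \<in> Y)"

text \<open>Closedness with respect to the seminorm; in particular a closed set is saturated under
  almost sure equality.\<close>

definition closed_procs :: "'a measure \<Rightarrow> ('t::{finite,linorder} \<Rightarrow> 'a measure) \<Rightarrow> real
    \<Rightarrow> ('a \<Rightarrow> (real^'m, 't) vec) set \<Rightarrow> bool" where
  "closed_procs M Filt p Y \<longleftrightarrow>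
     (\<forall>y\<in>procs M Filt (ennreal p).
        (\<forall>e>0. \<exists>z\<in>Y. lp_norm M p (\<lambda>\<omega>. y \<omega> - z \<omega>) < e) \<longrightarrow> y \<in> Y)"

definition normal_cone :: "'a measure \<Rightarrow> ('t::{finite,linorder} \<Rightarrow> 'a measure) \<Rightarrow> ennreal
    \<Rightarrow> ('a \<Rightarrow> (real^'m, 't) vec) set \<Rightarrow> ('a \<Rightarrow> (real^'m, 't) vec) \<Rightarrow> ('a \<Rightarrow> (real^'m, 't) vec) set" where
  "normal_cone M Filt q Y y =
     {\<psi> \<in> procs M Filt q. \<forall>z\<in>Y. pairing M \<psi> (\<lambda>\<omega>. z \<omega> - y \<omega>) \<le> 0}"

subsection \<open>Causal operators\<close>

definition superpos_measurable :: "'a measure \<Rightarrow> ('b::euclidean_space \<Rightarrow> 'a \<Rightarrow> 'c::euclidean_space) \<Rightarrow> bool" where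
  "superpos_measurable G g \<longleftrightarrow>
     (\<forall>x\<in>borel_measurable G. (\<lambda>\<omega>. g (x \<omega>) \<omega>) \<in> borel_measurable G)"

text \<open>A function \<open>f_t\<close> on \<open>R^(nt) \<times> \<Omega>\<close> is represented by a function on \<open>R^(nT) \<times> \<Omega>\<close>
  that depends only on the coordinates \<open>s \<le> t\<close> of its first argument. Continuous
  differentiability and the operator norm of the Jacobian are not affected by this.\<close>

definition causal_by :: "'a measure \<Rightarrow> ('t::{finite,linorder} \<Rightarrow> 'a measure) \<Rightarrow> real
    \<Rightarrow> (('a \<Rightarrow> (real^'n, 't) vec) \<Rightarrow> 'a \<Rightarrow> (real^'m, 't) vec)
    \<Rightarrow> ('t \<Rightarrow> (real^'n, 't) vec \<Rightarrow> 'a \<Rightarrow> real^'m) \<Rightarrow> bool" where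
  "causal_by M Filt p F f \<longleftrightarrow>
     F \<in> procs M Filt (ennreal p) \<rightarrow> procs M Filt (ennreal p) \<and>
     (\<forall>t. \<forall>\<omega>\<in>space M. \<forall>\<xi> \<zeta>. (\<forall>s\<le>t. \<xi> $ s = \<zeta> $ s) \<longrightarrow> f t \<xi> \<omega> = f t \<zeta> \<omega>) \<and>
     (\<forall>t. superpos_measurable (Filt t) (f t)) \<and>
     (\<forall>x\<in>procs M Filt (ennreal p). \<forall>t. \<forall>\<omega>\<in>space M. F x \<omega> $ t = f t (x \<omega>) \<omega>)"

text \<open>\<open>f' t \<xi> \<omega>\<close> is the Jacobian, as a bounded linear map, so that its norm is the operator norm.\<close>

definition assumption1 :: "'a measure \<Rightarrow> ('t::{finite,linorder} \<Rightarrow> 'a measure) \<Rightarrow> real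
    \<Rightarrow> ('t \<Rightarrow> (real^'n, 't) vec \<Rightarrow> 'a \<Rightarrow> real^'m)
    \<Rightarrow> ('t \<Rightarrow> (real^'n, 't) vec \<Rightarrow> 'a \<Rightarrow> (real^'n, 't) vec \<Rightarrow>\<^sub>L (real^'m)) \<Rightarrow> bool" where
  "assumption1 M Filt p f f' \<longleftrightarrow>
     (\<forall>t \<xi>. f t \<xi> \<in> Lspace M (Filt t) (ennreal p)) \<and>
     (\<forall>t. AE \<omega> in M.
        (\<forall>\<xi>. ((\<lambda>\<zeta>. f t \<zeta> \<omega>) has_derivative blinfun_apply (f' t \<xi> \<omega>)) (at \<xi>)) \<and>
        continuous_on UNIV (\<lambda>\<xi>. f' t \<xi> \<omega>)) \<and>
     (\<exists>C. \<forall>t. AE \<omega> in M. \<forall>\<xi>. norm (f' t \<xi> \<omega>) \<le> C)"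

subsection \<open>Gateaux derivative and adjoint\<close>

definition has_gateaux_derivative :: "'a measure \<Rightarrow> ('t::{finite,linorder} \<Rightarrow> 'a measure) \<Rightarrow> real
    \<Rightarrow> (('a \<Rightarrow> (real^'n, 't) vec) \<Rightarrow> 'a \<Rightarrow> (real^'m, 't) vec)
    \<Rightarrow> (('a \<Rightarrow> (real^'n, 't) vec) \<Rightarrow> 'a \<Rightarrow> (real^'m, 't) vec) \<Rightarrow> ('a \<Rightarrow> (real^'n, 't) vec) \<Rightarrow> bool" where
  "has_gateaux_derivative M Filt p F A x \<longleftrightarrow>
     A \<in> procs M Filt (ennreal p) \<rightarrow> procs M Filt (ennreal p) \<and>
     (\<forall>h\<in>procs M Filt (ennreal p). \<forall>k\<in>procs M Filt (ennreal p). \<forall>a b :: real.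
        AE \<omega> in M. A (\<lambda>\<omega>. a *\<^sub>R h \<omega> + b *\<^sub>R k \<omega>) \<omega> = a *\<^sub>R A h \<omega> + b *\<^sub>R A k \<omega>) \<and>
     (\<exists>K. \<forall>h\<in>procs M Filt (ennreal p). lp_norm M p (A h) \<le> K * lp_norm M p h) \<and>
     (\<forall>h\<in>procs M Filt (ennreal p).
        ((\<lambda>\<tau>. lp_norm M p (\<lambda>\<omega>. (F (\<lambda>\<omega>. x \<omega> + \<tau> *\<^sub>R h \<omega>) \<omega> - F x \<omega>) /\<^sub>R \<tau> - A h \<omega>))
           \<longlongrightarrow> 0) (at (0::real)))"

text \<open>The derivative is unique only up to almost sure equality of its values; \<open>SOME\<close>
  picks a version.\<close>

definition gateaux_derivative :: "'a measure \<Rightarrow> ('t::{finite,linorder} \<Rightarrow> 'a measure) \<Rightarrow> real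
    \<Rightarrow> (('a \<Rightarrow> (real^'n, 't) vec) \<Rightarrow> 'a \<Rightarrow> (real^'m, 't) vec) \<Rightarrow> ('a \<Rightarrow> (real^'n, 't) vec)
    \<Rightarrow> ('a \<Rightarrow> (real^'n, 't) vec) \<Rightarrow> 'a \<Rightarrow> (real^'m, 't) vec" where
  "gateaux_derivative M Filt p F x = (SOME A. has_gateaux_derivative M Filt p F A x)"

text \<open>The graph of the adjoint \<open>A^*\<close> of an operator \<open>A\<close> from \<open>X\<close> to \<open>Y\<close>. It relates
  \<open>\<psi>\<close> to all representatives \<open>\<xi>\<close> of \<open>A^* \<psi>\<close>, so it is a relation and not a function; for bounded
  linear \<open>A\<close> it is total and single-valued up to almost sure equality. The relational image
  of a set is the saturated image under \<open>A^*\<close>.\<close>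

definition adjoint_rel :: "'a measure \<Rightarrow> ('t::{finite,linorder} \<Rightarrow> 'a measure) \<Rightarrow> real \<Rightarrow> ennreal
    \<Rightarrow> (('a \<Rightarrow> (real^'n, 't) vec) \<Rightarrow> 'a \<Rightarrow> (real^'m, 't) vec)
    \<Rightarrow> (('a \<Rightarrow> (real^'m, 't) vec) \<times> ('a \<Rightarrow> (real^'n, 't) vec)) set" where
  "adjoint_rel M Filt p q A =
     {(\<psi>, \<xi>). \<psi> \<in> procs M Filt q \<and> \<xi> \<in> procs M Filt q \<and>
        (\<forall>h\<in>procs M Filt (ennreal p). pairing M \<xi> h = pairing M \<psi> (A h))}"

subsection \<open>Clarke subdifferential\<close>

definition procs_nhds :: "'a measure \<Rightarrow> ('t::{finite,linorder} \<Rightarrow> 'a measure) \<Rightarrow> real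
    \<Rightarrow> ('a \<Rightarrow> (real^'n, 't) vec) \<Rightarrow> ('a \<Rightarrow> (real^'n, 't) vec) filter" where
  "procs_nhds M Filt p x =
     inf (filtercomap (\<lambda>z. lp_norm M p (\<lambda>\<omega>. z \<omega> - x \<omega>)) (nhds 0))
         (principal (procs M Filt (ennreal p)))"

text \<open>\<open>\<Phi>\<degree>(x;h)\<close>, the upper limit of \<open>(\<Phi>(z + \<tau>h) - \<Phi>(z)) / \<tau>\<close> as \<open>z \<rightarrow> x\<close> and \<open>\<tau> \<down> 0\<close>.\<close>

definition clarke_dderiv :: "'a measure \<Rightarrow> ('t::{finite,linorder} \<Rightarrow> 'a measure) \<Rightarrow> real
    \<Rightarrow> (('a \<Rightarrow> (real^'n, 't) vec) \<Rightarrow> real) \<Rightarrow> ('a \<Rightarrow> (real^'n, 't) vec) \<Rightarrow> ('a \<Rightarrow> (real^'n, 't) vec) \<Rightarrow> ereal" where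
  "clarke_dderiv M Filt p \<Phi> x h =
     Limsup (procs_nhds M Filt p x \<times>\<^sub>F at_right (0::real))
       (\<lambda>(z, \<tau>). ereal ((\<Phi> (\<lambda>\<omega>. z \<omega> + \<tau> *\<^sub>R h \<omega>) - \<Phi> z) / \<tau>))"

definition clarke_subdiff :: "'a measure \<Rightarrow> ('t::{finite,linorder} \<Rightarrow> 'a measure) \<Rightarrow> real \<Rightarrow> ennreal
    \<Rightarrow> (('a \<Rightarrow> (real^'n, 't) vec) \<Rightarrow> real) \<Rightarrow> ('a \<Rightarrow> (real^'n, 't) vec) \<Rightarrow> ('a \<Rightarrow> (real^'n, 't) vec) set" where
  "clarke_subdiff M Filt p q \<Phi> x =
     {\<xi> \<in> procs M Filt q. \<forall>h\<in>procs M Filt (ennreal p).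
        ereal (pairing M \<xi> h) \<le> clarke_dderiv M Filt p \<Phi> x h}"

end

theory Submission
  imports Defs "HOL-Library.Function_Algebras"
begin

text \<open>
  The operator \<open>F\<close> is strictly differentiable at \<open>x\<close> in every fixed direction, although it need not be
  Frechet differentiable: almost surely the functions \<open>f t\<close> are continuously differentiable with
  bounded derivative, so that \<open>(F (z + \<tau> h) - F z) / \<tau>\<close> tends to \<open>A h\<close> in \<open>L\<^sub>p\<close> by dominated convergence
  as \<open>z \<rightarrow> x\<close> and \<open>\<tau> \<down> 0\<close>, where \<open>A\<close> is the Gateaux derivative (\<open>strict_derivative\<close>). The distance \<open>d\<close> to \<open>Y\<close> is
  convex and Lipschitz. The formula is the chain rule for such a composition, and its proof
  compares three quantities.
  
  A multiplier \<open>\<psi>\<close> in the normal cone and in the unit ball satisfies \<open>\<langle>\<psi>, w - F x\<rangle> \<le> d w\<close>, hence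
  \<open>\<langle>\<psi>, A h\<rangle>\<close> is at most the Clarke derivative of \<open>d \<circ> F\<close> in direction \<open>h\<close>. This is one
  inclusion (\<open>pairing_le_clarke_dderiv\<close>).
  
  Conversely, convexity bounds the Clarke derivative by \<open>d (F x + A h)\<close> (\<open>clarke_dderiv_le_dist\<close>).
  For a subgradient \<open>\<xi>\<close> this means \<open>\<langle>\<xi>, h\<rangle> \<le> norm (F x + A h - z)\<close> for all \<open>h\<close> and all \<open>z\<close> in \<open>Y\<close>. This is
  the compatibility condition for finding a linear functional that lies below the norm, is nonpositive
  on \<open>Y - F x\<close> and takes the value \<open>\<langle>\<xi>, h\<rangle>\<close> at \<open>A h\<close> (\<open>ex_normal_multiplier\<close>). The functional is
  produced by the theorem of Mazur and Orlicz, a version of the Hahn--Banach theorem.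
  
  It remains to represent this functional by an adapted process with components in \<open>L\<^sub>q\<close>
  (\<open>ex_process_representation\<close>). Coordinate by coordinate this is the duality of \<open>L\<^sub>p\<close> and \<open>L\<^sub>q\<close> on the
  space restricted to the algebra \<open>Filt t\<close>, which follows from the Radon--Nikodym theorem.
\<close>

section \<open>Sublinear functionals and the Mazur--Orlicz theorem\<close>

text \<open>
  Positive homogeneity is stated as an inequality, which is easier to verify: the reverse one follows from
  scaling by \<open>1 / c\<close>.
\<close>

definition sublinear_on :: "'v::real_vector set \<Rightarrow> ('v \<Rightarrow> real) \<Rightarrow> bool" where
  "sublinear_on S u \<longleftrightarrow>
     (\<forall>a\<in>S. \<forall>b\<in>S. u (a + b) \<le> u a + u b) \<and> (\<forall>a\<in>S. \<forall>c\<ge>0. u (c *\<^sub>R a) \<le> c * u a)"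

lemma sublinear_onD:
  assumes "sublinear_on S u"
  shows "a \<in> S \<Longrightarrow> b \<in> S \<Longrightarrow> u (a + b) \<le> u a + u b"
    and "a \<in> S \<Longrightarrow> 0 \<le> c \<Longrightarrow> u (c *\<^sub>R a) \<le> c * u a"
  using assms by (auto simp: sublinear_on_def)

lemma sublinear_on_zero:
  assumes "sublinear_on S u" "subspace S"
  shows "u 0 = 0"
proof -
  have "0 \<in> S" using assms(2) by (rule subspace_0)
  then show ?thesis
    using sublinear_onD(1)[OF assms(1), of 0 0] sublinear_onD(2)[OF assms(1), of 0 0] by simp
qed

lemma sublinear_on_scaleR:
  assumes u: "sublinear_on S u" and S: "subspace S" and a: "a \<in> S" and c: "0 \<le> c"
  shows "u (c *\<^sub>R a) = c * u a"
proof (cases "c = 0")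
  case True
  then show ?thesis using sublinear_on_zero[OF u S] by simp
next
  case False
  then have "u a \<le> inverse c * u (c *\<^sub>R a)"
    using sublinear_onD(2)[OF u subspace_scale[OF S a, of c], of "inverse c"] c by simp
  then have "c * u a \<le> u (c *\<^sub>R a)"
    using False c by (simp add: field_simps)
  then show ?thesis
    using sublinear_onD(2)[OF u a c] by simp
qed

text \<open>
  The set \<open>R\<close> plays the role of an epigraph. Infima of chains, shifted functionals and
  functionals with constraints are all lower envelopes of convex cones of pairs (vector, upper bound). The value \<open>0\<close> outside
  \<open>S\<close> makes functionals comparable as total functions, so that the pointwise order is antisymmetric.
\<close>

definition lower_envelope :: "'v::real_vector set \<Rightarrow> ('v \<times> real) set \<Rightarrow> 'v \<Rightarrow> real" where
  "lower_envelope S R a = (if a \<in> S then Inf {r. (a, r) \<in> R} else 0)"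

text \<open>
  Only the bounds at the origin have to be controlled: if \<open>(- a, s)\<close> is in the cone, then adding it
  to \<open>(a, r)\<close> yields a bound at \<open>0\<close>, whence \<open>- s \<le> r\<close>, and so all the infima are finite.
\<close>

lemma lower_envelope:
  fixes R :: "('v::real_vector \<times> real) set"
  assumes S: "subspace S"
    and add: "\<And>a b r s. (a, r) \<in> R \<Longrightarrow> (b, s) \<in> R \<Longrightarrow> (a + b, r + s) \<in> R"
    and scale: "\<And>a r c. (a, r) \<in> R \<Longrightarrow> 0 \<le> c \<Longrightarrow> (c *\<^sub>R a, c * r) \<in> R"
    and total: "\<And>a. a \<in> S \<Longrightarrow> \<exists>r. (a, r) \<in> R"
    and bound: "\<And>r. (0, r) \<in> R \<Longrightarrow> 0 \<le> r"
  shows "sublinear_on S (lower_envelope S R)"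
    and "a \<in> S \<Longrightarrow> (a, r) \<in> R \<Longrightarrow> lower_envelope S R a \<le> r"
proof -
  let ?u = "lower_envelope S R"
  have bdd: "bdd_below {r. (a, r) \<in> R}" if a: "a \<in> S" for a
  proof -
    obtain s where s: "(- a, s) \<in> R" using total subspace_neg[OF S a] by blast
    have "- s \<le> r" if "(a, r) \<in> R" for r
      using bound add[OF that s] by fastforce
    then show ?thesis by (intro bdd_belowI[of _ "- s"]) auto
  qed
  have le: "?u a \<le> r" if "a \<in> S" "(a, r) \<in> R" for a r
    using that by (auto simp: lower_envelope_def intro!: cInf_lower bdd)
  have ge: "x \<le> ?u a" if "a \<in> S" "\<And>r. (a, r) \<in> R \<Longrightarrow> x \<le> r" for a x
    using that total[OF that(1)] by (auto simp: lower_envelope_def intro!: cInf_greatest)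
  have "?u (a + b) \<le> ?u a + ?u b" if a: "a \<in> S" and b: "b \<in> S" for a b
  proof -
    have "?u (a + b) - ?u a \<le> ?u b"
    proof (rule ge[OF b])
      fix s assume s: "(b, s) \<in> R"
      have "?u (a + b) - s \<le> ?u a"
      proof (rule ge[OF a])
        fix r assume "(a, r) \<in> R"
        from le[OF subspace_add[OF S a b] add[OF this s]] show "?u (a + b) - s \<le> r" by simp
      qed
      then show "?u (a + b) - ?u a \<le> s" by simp
    qed
    then show ?thesis by simp
  qed
  moreover have "?u (c *\<^sub>R a) \<le> c * ?u a" if a: "a \<in> S" and c: "0 \<le> c" for a c
  proof (cases "c = 0")
    case True
    obtain r where "(a, r) \<in> R" using total[OF a] by blast
    from le[OF _ scale[OF this, of 0]] True subspace_0[OF S] show ?thesis by simp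
  next
    case False
    have "?u (c *\<^sub>R a) / c \<le> ?u a"
    proof (rule ge[OF a])
      fix r assume "(a, r) \<in> R"
      from le[OF subspace_scale[OF S a] scale[OF this c]] False c
      show "?u (c *\<^sub>R a) / c \<le> r" by (simp add: field_simps)
    qed
    with False c show ?thesis by (simp add: field_simps)
  qed
  ultimately show "sublinear_on S ?u" by (simp add: sublinear_on_def)
  show "a \<in> S \<Longrightarrow> (a, r) \<in> R \<Longrightarrow> ?u a \<le> r" by (rule le)
qed

text \<open>
  For fixed \<open>b\<close>, the infimum over \<open>t \<ge> 0\<close> of \<open>m (k + t b) - t m b\<close> is again sublinear in \<open>k\<close> and
  lies below \<open>m\<close>. By minimality it is \<open>m\<close> itself, and the choice \<open>t = 1\<close> then gives the inequality
  \<open>m a \<le> m (a + b) - m b\<close> that sublinearity lacks.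
\<close>

lemma minimal_sublinear_additive:
  assumes S: "subspace S" and m: "sublinear_on S m" and off: "\<And>a. a \<notin> S \<Longrightarrow> m a = 0"
    and min: "\<And>u. sublinear_on S u \<Longrightarrow> (\<And>a. a \<notin> S \<Longrightarrow> u a = 0) \<Longrightarrow> (\<And>a. u a \<le> m a) \<Longrightarrow> u = m"
    and a: "a \<in> S" and b: "b \<in> S"
  shows "m (a + b) = m a + m b"
proof -
  define R where "R = {(k, r). k \<in> S \<and> (\<exists>t\<ge>0. m (k + t *\<^sub>R b) - t * m b \<le> r)}"
  define u where "u = lower_envelope S R"
  have inS: "k + t *\<^sub>R b \<in> S" if "k \<in> S" for k t
    using that S b by (intro subspace_add subspace_scale)
  have u: "sublinear_on S u" "\<And>k r. k \<in> S \<Longrightarrow> (k, r) \<in> R \<Longrightarrow> u k \<le> r"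
  proof -
    have add: "(k + k', r + r') \<in> R" if kr: "(k, r) \<in> R" "(k', r') \<in> R" for k k' r r'
    proof -
      from kr obtain t t' where *: "k \<in> S" "k' \<in> S" "0 \<le> t" "0 \<le> t'"
          "m (k + t *\<^sub>R b) - t * m b \<le> r" "m (k' + t' *\<^sub>R b) - t' * m b \<le> r'"
        by (auto simp: R_def)
      have "m ((k + k') + (t + t') *\<^sub>R b) \<le> m (k + t *\<^sub>R b) + m (k' + t' *\<^sub>R b)"
        using sublinear_onD(1)[OF m inS[OF *(1), of t] inS[OF *(2), of t']]
        by (simp add: algebra_simps)
      with * subspace_add[OF S *(1,2)] show ?thesis
        by (auto simp: R_def algebra_simps intro!: exI[of _ "t + t'"])
    qed
    have scale: "(c *\<^sub>R k, c * r) \<in> R" if kr: "(k, r) \<in> R" and c: "0 \<le> c" for k r c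
    proof -
      from kr obtain t where *: "k \<in> S" "0 \<le> t" "m (k + t *\<^sub>R b) - t * m b \<le> r"
        by (auto simp: R_def)
      have "m (c *\<^sub>R k + (c * t) *\<^sub>R b) \<le> c * m (k + t *\<^sub>R b)"
        using sublinear_onD(2)[OF m inS[OF *(1), of t] c] by (simp add: algebra_simps)
      also have "\<dots> \<le> c * (r + t * m b)"
        using * c by (intro mult_left_mono) auto
      finally have "m (c *\<^sub>R k + (c * t) *\<^sub>R b) - (c * t) * m b \<le> c * r"
        by (simp add: algebra_simps)
      then show ?thesis
        using * c subspace_scale[OF S *(1)] by (auto simp: R_def intro!: exI[of _ "c * t"])
    qed
    have total: "\<exists>r. (k, r) \<in> R" if "k \<in> S" for k
      using that by (auto simp: R_def intro: exI[of _ 0])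
    have bound: "0 \<le> r" if "(0, r) \<in> R" for r
      using that sublinear_on_scaleR[OF m S b] by (auto simp: R_def)
    show "sublinear_on S u"
      unfolding u_def by (rule lower_envelope(1)[OF S]) (fact add scale total bound)+
    show "u k \<le> r" if "k \<in> S" "(k, r) \<in> R" for k r
      unfolding u_def by (rule lower_envelope(2)[OF S]) (fact add scale total bound that)+
  qed
  have "u k \<le> m k" for k
  proof (cases "k \<in> S")
    case True
    then have "(k, m k) \<in> R" by (auto simp: R_def intro: exI[of _ 0])
    then show ?thesis by (rule u(2)[OF True])
  qed (auto simp: off u_def lower_envelope_def)
  then have "u = m"
    using u(1) by (intro min) (auto simp: u_def lower_envelope_def)
  moreover have "(a, m (a + b) - m b) \<in> R"
    using a by (auto simp: R_def intro!: exI[of _ 1])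
  ultimately have "m a \<le> m (a + b) - m b"
    using u(2)[OF a] by blast
  then show ?thesis
    using sublinear_onD(1)[OF m a b] by simp
qed

text \<open>
  The Hahn--Banach theorem without a prescribed subspace: Zorn's lemma provides a minimal sublinear
  functional below \<open>p\<close>, and a minimal one is linear.
\<close>

lemma ex_linear_le_sublinear:
  fixes p :: "'v::real_vector \<Rightarrow> real"
  assumes S: "subspace S" and p: "sublinear_on S p"
  shows "\<exists>l. (\<forall>a\<in>S. \<forall>b\<in>S. l (a + b) = l a + l b) \<and> (\<forall>a\<in>S. \<forall>c. l (c *\<^sub>R a) = c * l a) \<and>
             (\<forall>a\<in>S. l a \<le> p a)"
proof -
  define \<Q> where "\<Q> = {u. sublinear_on S u \<and> (\<forall>a. a \<notin> S \<longrightarrow> u a = 0) \<and> (\<forall>a\<in>S. u a \<le> p a)}"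
  define P where "P = (\<lambda>u v :: 'v \<Rightarrow> real. \<forall>a. v a \<le> u a)"
  \<comment> \<open>The order is reversed, so that the maximal elements of Zorn's lemma are minimal functionals.\<close>
  have "\<exists>m\<in>\<Q>. \<forall>u\<in>\<Q>. P m u \<longrightarrow> u = m"
  proof (rule predicate_Zorn)
    show "partial_order_on \<Q> (relation_of P \<Q>)"
      by (rule partial_order_on_relation_ofI) (auto simp: P_def fun_eq_iff intro: order_trans antisym)
  next
    fix C assume C: "C \<in> Chains (relation_of P \<Q>)"
    then have CQ: "C \<subseteq> \<Q>" by (auto simp: Chains_def relation_of_def)
    show "\<exists>u\<in>\<Q>. \<forall>a\<in>C. P a u"
    proof (cases "C = {}")
      case True
      have "sublinear_on S (\<lambda>a. if a \<in> S then p a else 0)"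
        using p S by (auto simp: sublinear_on_def subspace_add subspace_scale)
      then show ?thesis using True by (auto simp: \<Q>_def)
    next
      case False
      define R where "R = {(a, r). a \<in> S \<and> (\<exists>w\<in>C. w a \<le> r)}"
      define u where "u = lower_envelope S R"
      have lin: "sublinear_on S w" if "w \<in> C" for w using that CQ by (auto simp: \<Q>_def)
      have add: "(k + k', r + r') \<in> R" if kr: "(k, r) \<in> R" "(k', r') \<in> R" for k k' r r'
      proof -
        from kr obtain w w' where *: "k \<in> S" "k' \<in> S" "w \<in> C" "w' \<in> C" "w k \<le> r" "w' k' \<le> r'"
          by (auto simp: R_def)
        have "P w w' \<or> P w' w" using C *(3,4) by (auto simp: Chains_def relation_of_def)
        then obtain v where v: "v \<in> C" "v k \<le> r" "v k' \<le> r'"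
          using * unfolding P_def by (meson order_trans)
        then show ?thesis
          using sublinear_onD(1)[OF lin[OF v(1)] *(1,2)] subspace_add[OF S *(1,2)]
          by (auto simp: R_def intro!: bexI[of _ v])
      qed
      have scale: "(c *\<^sub>R k, c * r) \<in> R" if kr: "(k, r) \<in> R" and c: "0 \<le> c" for k r c
      proof -
        from kr obtain w where *: "k \<in> S" "w \<in> C" "w k \<le> r" by (auto simp: R_def)
        have "w (c *\<^sub>R k) \<le> c * r"
          using sublinear_onD(2)[OF lin[OF *(2)] *(1) c] mult_left_mono[OF *(3) c] by simp
        then show ?thesis using * subspace_scale[OF S *(1)] by (auto simp: R_def)
      qed
      have total: "\<exists>r. (k, r) \<in> R" if "k \<in> S" for k
        using that False by (auto simp: R_def)
      have bound: "0 \<le> r" if "(0, r) \<in> R" for r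
        using that sublinear_on_zero[OF lin S] by (force simp: R_def)
      have u: "sublinear_on S u"
        unfolding u_def by (rule lower_envelope(1)[OF S]) (fact add scale total bound)+
      have u_le: "u k \<le> r" if "k \<in> S" "(k, r) \<in> R" for k r
        unfolding u_def by (rule lower_envelope(2)[OF S]) (fact add scale total bound that)+
      have below: "u a \<le> w a" if "w \<in> C" for w a
        using that u_le[of a "w a"] CQ by (cases "a \<in> S") (auto simp: R_def u_def lower_envelope_def \<Q>_def)
      have "u \<in> \<Q>"
      proof -
        obtain w where w: "w \<in> C" using False by blast
        have "u a \<le> p a" if "a \<in> S" for a
          using below[OF w, of a] w CQ that by (force simp: \<Q>_def)
        then show ?thesis using u by (auto simp: \<Q>_def u_def lower_envelope_def)
      qed
      then show ?thesis using below by (auto simp: P_def)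
    qed
  qed
  then obtain m where m: "m \<in> \<Q>" and min: "\<And>u. u \<in> \<Q> \<Longrightarrow> P m u \<Longrightarrow> u = m" by blast
  have sub: "sublinear_on S m" and off: "\<And>a. a \<notin> S \<Longrightarrow> m a = 0" and le: "\<And>a. a \<in> S \<Longrightarrow> m a \<le> p a"
    using m by (auto simp: \<Q>_def)
  have add: "m (a + b) = m a + m b" if "a \<in> S" "b \<in> S" for a b
  proof (rule minimal_sublinear_additive[OF S sub off _ that])
    fix u assume "sublinear_on S u" "\<And>a. a \<notin> S \<Longrightarrow> u a = 0" "\<And>a. u a \<le> m a"
    then show "u = m" using le by (intro min) (auto simp: \<Q>_def P_def intro: order_trans)
  qed
  have "m (c *\<^sub>R a) = c * m a" if a: "a \<in> S" for a c
  proof (cases "0 \<le> c")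
    case True
    then show ?thesis by (rule sublinear_on_scaleR[OF sub S a])
  next
    case False
    have "m (c *\<^sub>R a) + m ((- c) *\<^sub>R a) = 0"
      using add[OF subspace_scale[OF S a, of c] subspace_scale[OF S a, of "- c"]]
        sublinear_on_zero[OF sub S] by simp
    then show ?thesis using sublinear_on_scaleR[OF sub S a, of "- c"] False by simp
  qed
  then show ?thesis using add le by blast
qed

text \<open>
  This form of the Hahn--Banach theorem imposes all constraints on the functional at once, as a
  convex cone \<open>K\<close> of lower bounds. It contains the extension theorem: an equality constraint is a pair
  of opposite members of \<open>K\<close>, and whether the constraints are well defined and compatible need not be
  discussed beyond \<open>s \<le> p v\<close>. The infimum of \<open>p (a + v) - s\<close> over \<open>K\<close> is a sublinear functional
  below \<open>p\<close>, and every linear functional below it satisfies the constraints: evaluate it at \<open>- v\<close>.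
\<close>

theorem Mazur_Orlicz:
  fixes K :: "('v::real_vector \<times> real) set"
  assumes S: "subspace S" and p: "sublinear_on S p"
    and KS: "\<And>v s. (v, s) \<in> K \<Longrightarrow> v \<in> S"
    and zero: "(0, 0) \<in> K"
    and add: "\<And>v w s r. (v, s) \<in> K \<Longrightarrow> (w, r) \<in> K \<Longrightarrow> (v + w, s + r) \<in> K"
    and scale: "\<And>v s c. (v, s) \<in> K \<Longrightarrow> 0 \<le> c \<Longrightarrow> (c *\<^sub>R v, c * s) \<in> K"
    and le: "\<And>v s. (v, s) \<in> K \<Longrightarrow> s \<le> p v"
  shows "\<exists>l. (\<forall>a\<in>S. \<forall>b\<in>S. l (a + b) = l a + l b) \<and> (\<forall>a\<in>S. \<forall>c. l (c *\<^sub>R a) = c * l a) \<and>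
             (\<forall>a\<in>S. l a \<le> p a) \<and> (\<forall>(v, s)\<in>K. s \<le> l v)"
proof -
  define R where "R = {(a, r). a \<in> S \<and> (\<exists>(v, s)\<in>K. p (a + v) - s \<le> r)}"
  define u where "u = lower_envelope S R"
  have addR: "(k + k', r + r') \<in> R" if kr: "(k, r) \<in> R" "(k', r') \<in> R" for k k' r r'
  proof -
    from kr obtain v s v' s' where *: "k \<in> S" "k' \<in> S" "(v, s) \<in> K" "(v', s') \<in> K"
        "p (k + v) - s \<le> r" "p (k' + v') - s' \<le> r'"
      by (auto simp: R_def)
    have "p ((k + k') + (v + v')) \<le> p (k + v) + p (k' + v')"
      using sublinear_onD(1)[OF p subspace_add[OF S *(1) KS[OF *(3)]] subspace_add[OF S *(2) KS[OF *(4)]]]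
      by (simp add: algebra_simps)
    with * subspace_add[OF S *(1,2)] add[OF *(3,4)] show ?thesis
      by (auto simp: R_def intro!: bexI[of _ "(v + v', s + s')"])
  qed
  have scaleR: "(c *\<^sub>R k, c * r) \<in> R" if kr: "(k, r) \<in> R" and c: "0 \<le> c" for k r c
  proof -
    from kr obtain v s where *: "k \<in> S" "(v, s) \<in> K" "p (k + v) - s \<le> r" by (auto simp: R_def)
    have "p (c *\<^sub>R k + c *\<^sub>R v) \<le> c * p (k + v)"
      using sublinear_onD(2)[OF p subspace_add[OF S *(1) KS[OF *(2)]] c] by (simp add: algebra_simps)
    also have "\<dots> \<le> c * (r + s)" using *(3) c by (intro mult_left_mono) auto
    finally show ?thesis
      using * subspace_scale[OF S *(1)] scale[OF *(2) c]
      by (auto simp: R_def algebra_simps intro!: bexI[of _ "(c *\<^sub>R v, c * s)"])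
  qed
  have total: "\<exists>r. (k, r) \<in> R" if "k \<in> S" for k
    using that zero by (auto simp: R_def)
  have bound: "0 \<le> r" if "(0, r) \<in> R" for r
    using that le by (fastforce simp: R_def)
  have u: "sublinear_on S u"
    unfolding u_def by (rule lower_envelope(1)[OF S]) (fact addR scaleR total bound)+
  have u_le: "u k \<le> r" if "k \<in> S" "(k, r) \<in> R" for k r
    unfolding u_def by (rule lower_envelope(2)[OF S]) (fact addR scaleR total bound that)+
  obtain l where l: "\<And>a b. a \<in> S \<Longrightarrow> b \<in> S \<Longrightarrow> l (a + b) = l a + l b"
      "\<And>a c. a \<in> S \<Longrightarrow> l (c *\<^sub>R a) = c * l a" "\<And>a. a \<in> S \<Longrightarrow> l a \<le> u a"
    using ex_linear_le_sublinear[OF S u] by blast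
  have "l a \<le> p a" if a: "a \<in> S" for a
  proof -
    have "(a, p a) \<in> R" using a zero by (auto simp: R_def intro!: bexI[of _ "(0, 0)"])
    from u_le[OF a this] l(3)[OF a] show ?thesis by simp
  qed
  moreover have "s \<le> l v" if vs: "(v, s) \<in> K" for v s
  proof -
    have v: "v \<in> S" "- v \<in> S" using KS[OF vs] S by (auto intro: subspace_neg)
    have "(- v, - s) \<in> R"
      using v vs sublinear_on_zero[OF p S] by (auto simp: R_def intro!: bexI[of _ "(v, s)"])
    from u_le[OF v(2) this] l(3)[OF v(2)] l(2)[OF v(1), of "-1"] show ?thesis by simp
  qed
  ultimately show ?thesis using l(1,2) by blast
qed

section \<open>The spaces \<open>L\<^sub>r\<close> and their norms\<close>

text \<open>
  Spaces of processes are sets of functions that are closed under the pointwise operations; with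
  these operations they become subspaces of a real vector space.
\<close>

instantiation "fun" :: (type, real_vector) real_vector
begin

definition "c *\<^sub>R f = (\<lambda>x. c *\<^sub>R f x)"

instance
  by standard (simp_all add: scaleR_fun_def fun_eq_iff algebra_simps)

end

lemma scaleR_fun_apply [simp]: "(c *\<^sub>R f) x = c *\<^sub>R f x"
  by (simp add: scaleR_fun_def)

lemma sum_fun_apply: "(\<Sum>i\<in>I. f i) x = (\<Sum>i\<in>I. f i x)"
  by (induction I rule: infinite_finite_induct) auto

lemma Lspace_ennreal:
  "0 < r \<Longrightarrow> g \<in> Lspace M G (ennreal r) \<longleftrightarrow>
     g \<in> borel_measurable G \<and> integrable M (\<lambda>\<omega>. norm (g \<omega>) powr r)"
  by (simp add: Lspace_def)

lemma Lspace_cases: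
  assumes "0 < r"
  obtains (finite) s where "0 < s" "r = ennreal s" | (top) "r = \<infinity>"
  using assms by (cases r) (auto simp: top_ennreal_def)

lemma subalgebra_refl: "subalgebra M M"
  by (simp add: subalgebra_def)

lemma Lspace_measurable: "g \<in> Lspace M G r \<Longrightarrow> g \<in> borel_measurable G"
  by (simp add: Lspace_def)

lemma Lspace_measurable_space:
  "subalgebra M G \<Longrightarrow> g \<in> Lspace M G r \<Longrightarrow> g \<in> borel_measurable M"
  using Lspace_measurable measurable_from_subalg by blast

lemma Lspace_mono_algebra:
  "subalgebra M G \<Longrightarrow> g \<in> Lspace M G r \<Longrightarrow> g \<in> Lspace M M r"
  using Lspace_measurable_space by (auto simp: Lspace_def)

text \<open>
  The dominating function may be measurable with respect to another algebra: derivatives at time \<open>t\<close>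
  are dominated by the increment of the whole process, which is not adapted to \<open>Filt t\<close>.
\<close>

lemma Lspace_dominated:
  fixes g :: "'a \<Rightarrow> 'b::euclidean_space" and h :: "'a \<Rightarrow> 'c::euclidean_space"
  assumes G: "subalgebra M G" and r: "0 < r" and h: "h \<in> Lspace M H r"
    and g: "g \<in> borel_measurable G"
    and le: "AE \<omega> in M. norm (g \<omega>) \<le> C * norm (h \<omega>)"
  shows "g \<in> Lspace M G r"
proof -
  define D where "D = max C 0"
  have D: "0 \<le> D" by (simp add: D_def)
  have leD: "AE \<omega> in M. norm (g \<omega>) \<le> D * norm (h \<omega>)"
    using le by eventually_elim (auto simp: D_def intro: order_trans[OF _ mult_right_mono])
  have gM: "g \<in> borel_measurable M"
    using measurable_from_subalg[OF G g] .
  from r show ?thesis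
  proof (cases rule: Lspace_cases)
    case (finite s)
    have int: "integrable M (\<lambda>\<omega>. D powr s * norm (h \<omega>) powr s)"
      using h finite by (simp add: Lspace_ennreal)
    have bound: "AE \<omega> in M. norm (norm (g \<omega>) powr s) \<le> norm (D powr s * norm (h \<omega>) powr s)"
      using leD
    proof eventually_elim
      case (elim \<omega>)
      then have "norm (g \<omega>) powr s \<le> (D * norm (h \<omega>)) powr s"
        using finite by (intro powr_mono2) auto
      then show ?case using D by (simp add: powr_mult)
    qed
    have "integrable M (\<lambda>\<omega>. norm (g \<omega>) powr s)"
      by (rule Bochner_Integration.integrable_bound[OF int _ bound]) (use gM in measurable)
    with g finite show ?thesis by (simp add: Lspace_ennreal)
  next
    case top
    then obtain c where "AE \<omega> in M. norm (h \<omega>) \<le> c"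
      using h by (auto simp: Lspace_def)
    with leD have "AE \<omega> in M. norm (g \<omega>) \<le> D * c"
      by eventually_elim (meson D mult_left_mono order_trans)
    then show ?thesis using g top by (auto simp: Lspace_def)
  qed
qed

lemma powr_add_le:
  fixes a b s :: real
  assumes "0 \<le> a" "0 \<le> b" "0 < s"
  shows "(a + b) powr s \<le> 2 powr s * (a powr s + b powr s)"
proof -
  have "(a + b) powr s \<le> (2 * max a b) powr s"
    using assms by (intro powr_mono2) auto
  also have "\<dots> = 2 powr s * max a b powr s"
    using assms by (simp add: powr_mult)
  also have "\<dots> \<le> 2 powr s * (a powr s + b powr s)"
    by (intro mult_left_mono) (auto simp: max_def)
  finally show ?thesis .
qed

lemma Lspace_add:
  assumes G: "subalgebra M G" and r: "0 < r" and g: "g \<in> Lspace M G r" and h: "h \<in> Lspace M G r"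
  shows "(\<lambda>\<omega>. g \<omega> + h \<omega>) \<in> Lspace M G r"
  using r
proof (cases rule: Lspace_cases)
  case (finite s)
  have [measurable]: "g \<in> borel_measurable M" "h \<in> borel_measurable M"
    using Lspace_measurable_space[OF G] g h by auto
  have int: "integrable M (\<lambda>\<omega>. 2 powr s * (norm (g \<omega>) powr s + norm (h \<omega>) powr s))"
    using g h finite by (simp add: Lspace_ennreal)
  have bound: "AE \<omega> in M. norm (norm (g \<omega> + h \<omega>) powr s) \<le>
      norm (2 powr s * (norm (g \<omega>) powr s + norm (h \<omega>) powr s))"
  proof (rule AE_I2)
    fix \<omega>
    have "norm (g \<omega> + h \<omega>) powr s \<le> (norm (g \<omega>) + norm (h \<omega>)) powr s"
      using finite by (intro powr_mono2 norm_triangle_ineq) auto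
    also have "\<dots> \<le> 2 powr s * (norm (g \<omega>) powr s + norm (h \<omega>) powr s)"
      using finite by (intro powr_add_le) auto
    finally show "norm (norm (g \<omega> + h \<omega>) powr s) \<le>
      norm (2 powr s * (norm (g \<omega>) powr s + norm (h \<omega>) powr s))" by simp
  qed
  have "integrable M (\<lambda>\<omega>. norm (g \<omega> + h \<omega>) powr s)"
    by (rule Bochner_Integration.integrable_bound[OF int _ bound]) measurable
  then show ?thesis
    using g h finite by (simp add: Lspace_ennreal borel_measurable_add)
next
  case top
  then obtain c d where "AE \<omega> in M. norm (g \<omega>) \<le> c" "AE \<omega> in M. norm (h \<omega>) \<le> d"
    using g h by (auto simp: Lspace_def)
  then have "AE \<omega> in M. norm (g \<omega> + h \<omega>) \<le> c + d"
    by eventually_elim (metis add_mono norm_triangle_ineq order_trans)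
  then show ?thesis
    using g h top by (auto simp: Lspace_def)
qed

lemma subspace_Lspace:
  assumes G: "subalgebra M G" and r: "0 < r"
  shows "subspace (Lspace M G r)"
proof (rule subspaceI)
  show "0 \<in> Lspace M G r"
    by (auto simp: Lspace_def zero_fun_def)
  show "g + h \<in> Lspace M G r" if "g \<in> Lspace M G r" "h \<in> Lspace M G r" for g h
    using Lspace_add[OF G r that] by (simp add: plus_fun_def)
  show "c *\<^sub>R g \<in> Lspace M G r" if g: "g \<in> Lspace M G r" for c g
    by (rule Lspace_dominated[OF G r g, where C="\<bar>c\<bar>"])
      (use Lspace_measurable[OF g] in \<open>auto simp: scaleR_fun_def\<close>)
qed

lemma Lspace_bounded:
  fixes g :: "'a \<Rightarrow> 'b::euclidean_space"
  assumes "finite_measure M" "subalgebra M G" "0 < r" "g \<in> borel_measurable G" "\<And>\<omega>. \<omega> \<in> space M \<Longrightarrow> norm (g \<omega>) \<le> B"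
  shows "g \<in> Lspace M G r"
proof (rule Lspace_dominated[where h="\<lambda>_. 1::real" and H=M and C=B])
  interpret finite_measure M by fact
  show "(\<lambda>_. 1::real) \<in> Lspace M M r" by (auto simp: Lspace_def)
qed (use assms in auto)

lemma lp_norm_nonneg: "0 \<le> lp_norm M p g"
  by (simp add: lp_norm_def)

lemma lp_norm_powr:
  assumes "0 < p"
  shows "lp_norm M p g powr p = (\<integral>\<omega>. norm (g \<omega>) powr p \<partial>M)"
  using assms by (simp add: lp_norm_def powr_powr integral_nonneg_AE)

lemma lp_norm_zero: "lp_norm M p (\<lambda>\<omega>. 0) = 0"
  by (simp add: lp_norm_def)

lemma lp_norm_minus_commute:
  "lp_norm M p (\<lambda>\<omega>. x \<omega> - y \<omega>) = lp_norm M p (\<lambda>\<omega>. y \<omega> - x \<omega>)"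
  unfolding lp_norm_def by (subst norm_minus_commute) (rule refl)

lemma lp_norm_scaleR:
  assumes "0 < p"
  shows "lp_norm M p (\<lambda>\<omega>. c *\<^sub>R g \<omega>) = \<bar>c\<bar> * lp_norm M p g"
  using assms
  by (simp add: lp_norm_def powr_mult powr_powr integral_nonneg_AE)

lemma lp_norm_mono:
  fixes g :: "'a \<Rightarrow> 'b::euclidean_space" and h :: "'a \<Rightarrow> 'c::euclidean_space"
  assumes p: "0 < p" and h: "h \<in> Lspace M H (ennreal p)" and g: "g \<in> borel_measurable M"
    and le: "AE \<omega> in M. norm (g \<omega>) \<le> norm (h \<omega>)"
  shows "lp_norm M p g \<le> lp_norm M p h"
proof -
  have "(\<integral>\<omega>. norm (g \<omega>) powr p \<partial>M) \<le> (\<integral>\<omega>. norm (h \<omega>) powr p \<partial>M)"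
  proof (rule integral_mono_AE)
    show h': "integrable M (\<lambda>\<omega>. norm (h \<omega>) powr p)"
      using h p by (simp add: Lspace_ennreal)
    show *: "AE \<omega> in M. norm (g \<omega>) powr p \<le> norm (h \<omega>) powr p"
      using le by eventually_elim (use p in \<open>auto intro: powr_mono2\<close>)
    show "integrable M (\<lambda>\<omega>. norm (g \<omega>) powr p)"
      by (rule Bochner_Integration.integrable_bound[OF h']) (use * g in auto)
  qed
  then show ?thesis
    using p by (auto simp: lp_norm_def intro!: powr_mono2 integral_nonneg_AE)
qed

lemma lp_norm_cong:
  fixes g h :: "'a \<Rightarrow> 'b::euclidean_space"
  assumes "g \<in> borel_measurable M" "h \<in> borel_measurable M" "AE \<omega> in M. g \<omega> = h \<omega>"
  shows "lp_norm M p g = lp_norm M p h"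
proof -
  have "(\<integral>\<omega>. norm (g \<omega>) powr p \<partial>M) = (\<integral>\<omega>. norm (h \<omega>) powr p \<partial>M)"
    using assms by (intro integral_cong_AE) auto
  then show ?thesis by (simp add: lp_norm_def)
qed

text \<open>
  The second derivative gives convexity on the open half-line only. At the boundary point \<open>0\<close> it reduces to
  \<open>c\<^sup>p \<le> c\<close> for \<open>0 < c < 1\<close>.
\<close>

lemma convex_on_powr:
  assumes "1 \<le> (p::real)"
  shows "convex_on {0..} (\<lambda>x. x powr p)"
proof (rule convex_onI)
  fix t x y :: real
  assume t: "0 < t" "t < 1" and x: "x \<in> {0..}" and y: "y \<in> {0..}"
  have *: "c powr p \<le> c" if "0 < c" "c < 1" for c
    using powr_mono'[of 1 p c] that assms by simp
  have sc: "(c * z) powr p \<le> c * z powr p" if "0 < c" "c < 1" "0 \<le> z" for c z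
    using *[OF that(1,2)] that by (simp add: powr_mult mult_right_mono)
  show "((1 - t) *\<^sub>R x + t *\<^sub>R y) powr p \<le> (1 - t) * x powr p + t * y powr p"
  proof (cases "x = 0 \<or> y = 0")
    case True
    then show ?thesis using sc[of t y] sc[of "1 - t" x] t x y assms by auto
  next
    case False
    with x y have "x \<in> {0<..}" "y \<in> {0<..}" by auto
    from convex_onD[OF powr_convex[OF assms] _ _ this, of t] t show ?thesis by simp
  qed
qed simp

text \<open>
  With \<open>a\<close> and \<open>b\<close> slightly larger than the two norms, \<open>(norm g + norm h) / (a + b)\<close> is the convex
  combination of \<open>norm g / a\<close> and \<open>norm h / b\<close> with weights \<open>a / (a + b)\<close> and \<open>b / (a + b)\<close>. Convexity
  of \<open>x powr p\<close> bounds the integral of its \<open>p\<close>-th power by \<open>1\<close>. Taking \<open>a\<close> and \<open>b\<close> larger than the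
  norms avoids a separate treatment of functions of norm zero.
\<close>

theorem Minkowski:
  fixes g h :: "'a \<Rightarrow> 'b::euclidean_space"
  assumes p: "1 \<le> p" and g: "g \<in> Lspace M M (ennreal p)" and h: "h \<in> Lspace M M (ennreal p)"
  shows "lp_norm M p (\<lambda>\<omega>. g \<omega> + h \<omega>) \<le> lp_norm M p g + lp_norm M p h"
proof (rule field_le_epsilon)
  fix e :: real assume e: "0 < e"
  define a where "a = lp_norm M p g + e / 2"
  define b where "b = lp_norm M p h + e / 2"
  have ab: "0 < a" "0 < b"
    using e by (auto simp: a_def b_def intro!: add_nonneg_pos lp_norm_nonneg)
  define t where "t = b / (a + b)"
  have t: "0 \<le> t" "t \<le> 1" "1 - t = a / (a + b)"
    using ab by (auto simp: t_def field_simps)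
  have gi: "integrable M (\<lambda>\<omega>. norm (g \<omega>) powr p)" "integrable M (\<lambda>\<omega>. norm (h \<omega>) powr p)"
    and ghi: "integrable M (\<lambda>\<omega>. norm (g \<omega> + h \<omega>) powr p)"
    using g h Lspace_add[OF subalgebra_refl _ g h] p by (auto simp: Lspace_ennreal)
  have gle: "(\<integral>\<omega>. norm (g \<omega>) powr p \<partial>M) \<le> a powr p" "(\<integral>\<omega>. norm (h \<omega>) powr p \<partial>M) \<le> b powr p"
    using lp_norm_powr[of p M g] lp_norm_powr[of p M h] p e lp_norm_nonneg[of M p]
    by (auto simp: a_def b_def intro!: powr_mono2 simp flip: lp_norm_powr)
  have pw: "norm (g \<omega> + h \<omega>) powr p \<le>
      (a + b) powr p * ((1 - t) * (norm (g \<omega>) powr p / a powr p) + t * (norm (h \<omega>) powr p / b powr p))" for \<omega>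
  proof -
    have "norm (g \<omega> + h \<omega>) \<le> norm (g \<omega>) + norm (h \<omega>)" by (rule norm_triangle_ineq)
    also have "\<dots> = (a + b) * ((1 - t) *\<^sub>R (norm (g \<omega>) / a) + t *\<^sub>R (norm (h \<omega>) / b))"
    proof -
      have "(a + b) * t = b"
        using ab by (simp add: t_def)
      moreover have "(a + b) * (1 - t) = a"
        using ab by (simp add: t(3))
      ultimately show ?thesis
        using ab by (simp add: distrib_left flip: mult.assoc)
    qed
    finally have "norm (g \<omega> + h \<omega>) powr p \<le> \<dots> powr p"
      using p by (intro powr_mono2) auto
    also have "\<dots> = (a + b) powr p * ((1 - t) *\<^sub>R (norm (g \<omega>) / a) + t *\<^sub>R (norm (h \<omega>) / b)) powr p"
      by (rule powr_mult)
    also have "\<dots> \<le> (a + b) powr p * ((1 - t) * (norm (g \<omega>) / a) powr p + t * (norm (h \<omega>) / b) powr p)"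
      using ab t by (intro mult_left_mono convex_onD[OF convex_on_powr[OF p]]) auto
    finally show ?thesis using ab by (simp add: powr_divide)
  qed
  have "(\<integral>\<omega>. norm (g \<omega> + h \<omega>) powr p \<partial>M) \<le>
      (\<integral>\<omega>. (a + b) powr p * ((1 - t) * (norm (g \<omega>) powr p / a powr p) + t * (norm (h \<omega>) powr p / b powr p)) \<partial>M)"
    using pw ghi gi by (intro integral_mono) auto
  also have "\<dots> = (a + b) powr p * ((1 - t) * ((\<integral>\<omega>. norm (g \<omega>) powr p \<partial>M) / a powr p) +
      t * ((\<integral>\<omega>. norm (h \<omega>) powr p \<partial>M) / b powr p))"
    using gi by simp
  also have "\<dots> \<le> (a + b) powr p * ((1 - t) * 1 + t * 1)"
    using ab t(1,2) gle by (intro mult_left_mono add_mono) (auto simp: divide_le_eq)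
  finally have "(\<integral>\<omega>. norm (g \<omega> + h \<omega>) powr p \<partial>M) powr (1 / p) \<le> ((a + b) powr p) powr (1 / p)"
    using p by (intro powr_mono2 integral_nonneg_AE) auto
  then show "lp_norm M p (\<lambda>\<omega>. g \<omega> + h \<omega>) \<le> lp_norm M p g + lp_norm M p h + e"
    using ab p by (simp add: lp_norm_def powr_powr a_def b_def)
qed

text \<open>
  All limits in \<open>L\<^sub>p\<close> below come from it: those of truncations in the representation of
  functionals, and those of the difference quotients of \<open>F\<close>.
\<close>

lemma lp_norm_dominated_convergence:
  fixes g :: "nat \<Rightarrow> 'a \<Rightarrow> 'b::euclidean_space" and h :: "'a \<Rightarrow> 'c::euclidean_space"
  assumes p: "0 < p" and h: "h \<in> Lspace M H (ennreal p)"
    and g: "\<And>n. g n \<in> borel_measurable M"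
    and lim: "AE \<omega> in M. (\<lambda>n. g n \<omega>) \<longlonglongrightarrow> 0"
    and le: "\<And>n. AE \<omega> in M. norm (g n \<omega>) \<le> C * norm (h \<omega>)"
  shows "(\<lambda>n. lp_norm M p (g n)) \<longlonglongrightarrow> 0"
proof -
  have "(\<lambda>n. \<integral>\<omega>. norm (g n \<omega>) powr p \<partial>M) \<longlonglongrightarrow> (\<integral>\<omega>. 0 \<partial>M)"
  proof (rule integral_dominated_convergence)
    show "integrable M (\<lambda>\<omega>. \<bar>C\<bar> powr p * norm (h \<omega>) powr p)"
      using h p by (simp add: Lspace_ennreal)
    show "AE \<omega> in M. (\<lambda>n. norm (g n \<omega>) powr p) \<longlonglongrightarrow> 0"
      using lim
    proof eventually_elim
      case (elim \<omega>)
      then have "(\<lambda>n. norm (g n \<omega>)) \<longlonglongrightarrow> 0" by (rule tendsto_norm_zero)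
      then have "(\<lambda>n. norm (g n \<omega>) powr p) \<longlonglongrightarrow> 0 powr p"
        by (intro tendsto_powr2) (use p in auto)
      then show ?case using p by simp
    qed
    show "AE \<omega> in M. norm (norm (g n \<omega>) powr p) \<le> \<bar>C\<bar> powr p * norm (h \<omega>) powr p" for n
      using le[of n]
    proof eventually_elim
      case (elim \<omega>)
      also have "C * norm (h \<omega>) \<le> \<bar>C\<bar> * norm (h \<omega>)" by (intro mult_right_mono) auto
      finally have "norm (g n \<omega>) powr p \<le> (\<bar>C\<bar> * norm (h \<omega>)) powr p"
        using p by (intro powr_mono2) auto
      then show ?case by (simp add: powr_mult)
    qed
  qed (use g in measurable)
  then have "(\<lambda>n. (\<integral>\<omega>. norm (g n \<omega>) powr p \<partial>M) powr (1 / p)) \<longlonglongrightarrow> 0 powr (1 / p)"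
    by (intro tendsto_powr2) (use p in \<open>auto intro!: integral_nonneg_AE\<close>)
  then show ?thesis using p by (simp add: lp_norm_def)
qed

section \<open>Conjugate exponents\<close>

lemma conjugate_cases:
  assumes "1 \<le> p" and "1 / ennreal p + 1 / q = 1"
  obtains (one) "p = 1" "q = \<infinity>"
    | (gt) s where "1 < p" "1 < s" "1 / p + 1 / s = 1" "q = ennreal s"
proof (cases "q = \<infinity>")
  case True
  then have "ennreal (1 / p) = ennreal 1"
    using assms by (simp add: divide_ennreal flip: ennreal_1)
  then have "p = 1" using assms(1) by (subst (asm) ennreal_inj) auto
  then show ?thesis using True one by blast
next
  case False
  then obtain s where s: "0 \<le> s" "q = ennreal s" by (cases q) auto
  have s0: "0 < s"
  proof (rule ccontr)
    assume "\<not> 0 < s"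
    then have "1 / q = \<infinity>" using s by simp
    then show False using assms(2) by simp
  qed
  have "ennreal (1 / p + 1 / s) = ennreal 1"
    using assms s s0 by (simp add: ennreal_plus divide_ennreal flip: ennreal_1)
  then have *: "1 / p + 1 / s = 1"
    using assms(1) s0 by (subst (asm) ennreal_inj) auto
  have "0 < 1 / s" "0 < 1 / p" using s0 assms(1) by auto
  then have "1 / p < 1" "1 / s < 1" using * by linarith+
  then have "1 < p" "1 < s" using assms(1) s0 by (simp_all add: divide_less_eq)
  then show ?thesis using gt * s(2) by blast
qed

lemma conjugate_pos:
  assumes "1 \<le> p" "1 / ennreal p + 1 / q = 1"
  shows "0 < q"
  using assms by (cases rule: conjugate_cases) auto

lemma integrable_inner_conjugate:
  fixes g h :: "'a \<Rightarrow> 'b::euclidean_space"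
  assumes "1 \<le> p" "1 / ennreal p + 1 / q = 1"
    and g: "g \<in> Lspace M M q" and h: "h \<in> Lspace M M (ennreal p)"
  shows "integrable M (\<lambda>\<omega>. g \<omega> \<bullet> h \<omega>)"
proof -
  have [measurable]: "g \<in> borel_measurable M" "h \<in> borel_measurable M"
    using g h by (auto simp: Lspace_def)
  have hp: "integrable M (\<lambda>\<omega>. norm (h \<omega>) powr p)"
    using h assms(1) by (simp add: Lspace_ennreal)
  from assms(1,2) show ?thesis
  proof (cases rule: conjugate_cases)
    case one
    then obtain c where c: "AE \<omega> in M. norm (g \<omega>) \<le> c" using g by (auto simp: Lspace_def)
    have int: "integrable M (\<lambda>\<omega>. c * norm (h \<omega>) powr p)" using hp by simp
    have bound: "AE \<omega> in M. norm (g \<omega> \<bullet> h \<omega>) \<le> norm (c * norm (h \<omega>) powr p)"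
      using c
    proof eventually_elim
      case (elim \<omega>)
      have "norm (g \<omega> \<bullet> h \<omega>) \<le> norm (g \<omega>) * norm (h \<omega>)" by (simp add: Cauchy_Schwarz_ineq2)
      also have "\<dots> \<le> c * norm (h \<omega>)" using elim by (intro mult_right_mono) auto
      finally show ?case using one by simp
    qed
    show ?thesis by (rule Bochner_Integration.integrable_bound[OF int _ bound]) measurable
  next
    case (gt s)
    then have gq: "integrable M (\<lambda>\<omega>. norm (g \<omega>) powr s)"
      using g by (simp add: Lspace_ennreal)
    have int: "integrable M (\<lambda>\<omega>. norm (h \<omega>) powr p / p + norm (g \<omega>) powr s / s)"
      using hp gq by simp
    have bound: "AE \<omega> in M. norm (g \<omega> \<bullet> h \<omega>) \<le> norm (norm (h \<omega>) powr p / p + norm (g \<omega>) powr s / s)"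
    proof (rule AE_I2)
      fix \<omega>
      have "norm (g \<omega> \<bullet> h \<omega>) \<le> norm (h \<omega>) * norm (g \<omega>)"
        using Cauchy_Schwarz_ineq2[of "g \<omega>" "h \<omega>"] by (simp add: mult.commute)
      also have "\<dots> \<le> norm (h \<omega>) powr p / p + norm (g \<omega>) powr s / s"
        using gt by (intro Youngs_inequality) auto
      finally show "norm (g \<omega> \<bullet> h \<omega>) \<le> norm (norm (h \<omega>) powr p / p + norm (g \<omega>) powr s / s)"
        by simp
    qed
    show ?thesis by (rule Bochner_Integration.integrable_bound[OF int _ bound]) measurable
  qed
qed

text \<open>
  The dual norm is a supremum of real numbers, which is meaningful only for sets that are bounded
  above. Young's inequality supplies a bound that is not sharp, but suffices for this purpose.
\<close>

lemma integral_inner_conjugate_bounded: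
  fixes g :: "'a \<Rightarrow> 'b::euclidean_space"
  assumes p: "1 \<le> p" and q: "1 / ennreal p + 1 / q = 1" and g: "g \<in> Lspace M M q"
  shows "\<exists>C. \<forall>h\<in>Lspace M M (ennreal p). lp_norm M p h \<le> 1 \<longrightarrow> (\<integral>\<omega>. g \<omega> \<bullet> h \<omega> \<partial>M) \<le> C"
proof -
  have hp: "integrable M (\<lambda>\<omega>. norm (h \<omega>) powr p)" if "h \<in> Lspace M M (ennreal p)" for h :: "'a \<Rightarrow> 'b"
    using that p by (simp add: Lspace_ennreal)
  have le1: "(\<integral>\<omega>. norm (h \<omega>) powr p \<partial>M) \<le> 1" if "lp_norm M p h \<le> 1" for h :: "'a \<Rightarrow> 'b"
    using powr_mono2[OF _ lp_norm_nonneg that, of p] p by (simp add: lp_norm_powr)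
  from p q show ?thesis
  proof (cases rule: conjugate_cases)
    case one
    then obtain c where c: "AE \<omega> in M. norm (g \<omega>) \<le> c" using g by (auto simp: Lspace_def)
    have "(\<integral>\<omega>. g \<omega> \<bullet> h \<omega> \<partial>M) \<le> \<bar>c\<bar>" if h: "h \<in> Lspace M M (ennreal p)" "lp_norm M p h \<le> 1" for h
    proof -
      have "(\<integral>\<omega>. g \<omega> \<bullet> h \<omega> \<partial>M) \<le> (\<integral>\<omega>. \<bar>c\<bar> * norm (h \<omega>) powr p \<partial>M)"
      proof (rule integral_mono_AE)
        show "AE \<omega> in M. g \<omega> \<bullet> h \<omega> \<le> \<bar>c\<bar> * norm (h \<omega>) powr p"
          using c
        proof eventually_elim
          case (elim \<omega>)
          have "g \<omega> \<bullet> h \<omega> \<le> norm (g \<omega>) * norm (h \<omega>)" by (rule norm_cauchy_schwarz)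
          also have "\<dots> \<le> \<bar>c\<bar> * norm (h \<omega>)" using elim by (intro mult_right_mono) auto
          finally show ?case using one by simp
        qed
      qed (use integrable_inner_conjugate[OF p q g h(1)] hp[OF h(1)] in auto)
      also have "\<dots> \<le> \<bar>c\<bar> * 1" using le1[OF h(2)] by (simp add: mult_left_le)
      finally show ?thesis by simp
    qed
    then show ?thesis by blast
  next
    case (gt s)
    then have gq: "integrable M (\<lambda>\<omega>. norm (g \<omega>) powr s)"
      using g by (simp add: Lspace_ennreal)
    have "(\<integral>\<omega>. g \<omega> \<bullet> h \<omega> \<partial>M) \<le> 1 / p + (\<integral>\<omega>. norm (g \<omega>) powr s \<partial>M) / s"
      if h: "h \<in> Lspace M M (ennreal p)" "lp_norm M p h \<le> 1" for h
    proof -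
      have "(\<integral>\<omega>. g \<omega> \<bullet> h \<omega> \<partial>M) \<le> (\<integral>\<omega>. norm (h \<omega>) powr p / p + norm (g \<omega>) powr s / s \<partial>M)"
      proof (rule integral_mono)
        fix \<omega>
        have "g \<omega> \<bullet> h \<omega> \<le> norm (h \<omega>) * norm (g \<omega>)"
          using norm_cauchy_schwarz[of "g \<omega>" "h \<omega>"] by (simp add: mult.commute)
        also have "\<dots> \<le> norm (h \<omega>) powr p / p + norm (g \<omega>) powr s / s"
          using gt by (intro Youngs_inequality) auto
        finally show "g \<omega> \<bullet> h \<omega> \<le> norm (h \<omega>) powr p / p + norm (g \<omega>) powr s / s" .
      qed (use integrable_inner_conjugate[OF p q g h(1)] hp[OF h(1)] gq in auto)
      also have "\<dots> \<le> 1 / p + (\<integral>\<omega>. norm (g \<omega>) powr s \<partial>M) / s"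
        using hp[OF h(1)] gq le1[OF h(2)] p by (simp add: divide_right_mono)
      finally show ?thesis .
    qed
    then show ?thesis by blast
  qed
qed

section \<open>The dual of a scalar \<open>L\<^sub>p\<close> space\<close>

text \<open>
  The bound by a power of the measure gives continuity at the empty set, hence countable additivity,
  and absolute continuity at the same time.
\<close>

lemma (in finite_measure) Radon_Nikodym_content:
  fixes \<mu> :: "'a set \<Rightarrow> real"
  assumes nonneg: "\<And>A. A \<in> sets M \<Longrightarrow> 0 \<le> \<mu> A"
    and add: "\<And>A B. A \<in> sets M \<Longrightarrow> B \<in> sets M \<Longrightarrow> A \<inter> B = {} \<Longrightarrow> \<mu> (A \<union> B) = \<mu> A + \<mu> B"
    and bound: "\<And>A. A \<in> sets M \<Longrightarrow> \<mu> A \<le> C * measure M A powr r" and r: "0 < r"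
  shows "\<exists>g::'a \<Rightarrow> real. integrable M g \<and> (\<forall>A\<in>sets M. \<mu> A = (\<integral>\<omega>. indicator A \<omega> * g \<omega> \<partial>M))"
proof -
  have empty: "\<mu> {} = 0" using add[of "{}" "{}"] by simp
  define N where "N = measure_of (space M) (sets M) (\<lambda>A. ennreal (\<mu> A))"
  have sets_N: "sets N = sets M" by (simp add: N_def)
  have pos: "positive (sets M) (\<lambda>A. ennreal (\<mu> A))" by (simp add: positive_def empty)
  have "countably_additive (sets M) (\<lambda>A. ennreal (\<mu> A))"
  proof (rule sets.empty_continuous_imp_countably_additive[OF pos])
    show "additive (sets M) (\<lambda>A. ennreal (\<mu> A))"
      by (auto simp: additive_def add nonneg)
    fix A :: "nat \<Rightarrow> 'a set"
    assume A: "range A \<subseteq> sets M" "decseq A" "(\<Inter>i. A i) = {}"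
    have "(\<lambda>i. measure M (A i)) \<longlonglongrightarrow> 0"
      using finite_Lim_measure_decseq[OF A(1,2)] A(3) by simp
    then have "(\<lambda>i. C * measure M (A i) powr r) \<longlonglongrightarrow> C * 0 powr r"
      by (intro tendsto_intros tendsto_powr2) (use r in auto)
    then have "(\<lambda>i. C * measure M (A i) powr r) \<longlonglongrightarrow> 0" using r by simp
    then have "(\<lambda>i. \<mu> (A i)) \<longlonglongrightarrow> 0"
      by (rule tendsto_sandwich[rotated 3]) (use A(1) nonneg bound in auto)
    then show "(\<lambda>i. ennreal (\<mu> (A i))) \<longlonglongrightarrow> 0"
      using tendsto_ennrealI by fastforce
  qed auto
  then have em: "emeasure N A = ennreal (\<mu> A)" if "A \<in> sets M" for A
    unfolding N_def using that pos by (intro emeasure_measure_of_sigma) (auto simp: sets.sigma_algebra_axioms)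
  have "absolutely_continuous M N"
    unfolding absolutely_continuous_def
  proof
    fix A assume "A \<in> null_sets M"
    then have A: "A \<in> sets M" "measure M A = 0" by (auto simp: measure_eq_0_null_sets)
    then show "A \<in> null_sets N"
      using bound[OF A(1)] nonneg[OF A(1)] em[OF A(1)] r by (auto simp: null_sets_def sets_N)
  qed
  from Radon_Nikodym[OF this sets_N] obtain f where
    f[measurable]: "f \<in> borel_measurable M" and fN: "density M f = N" by blast
  have fA: "(\<integral>\<^sup>+\<omega>. f \<omega> * indicator A \<omega> \<partial>M) = ennreal (\<mu> A)" if "A \<in> sets M" for A
    using emeasure_density[OF f that] em[OF that] fN by simp
  have "(\<integral>\<^sup>+\<omega>. f \<omega> \<partial>M) = ennreal (\<mu> (space M))"
    using fA[of "space M"] by (simp cong: nn_integral_cong_simp)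
  then have fin: "AE \<omega> in M. f \<omega> \<noteq> \<infinity>"
    by (intro nn_integral_PInf_AE) auto
  define g where "g \<omega> = enn2real (f \<omega>)" for \<omega>
  have g[measurable]: "g \<in> borel_measurable M" by (simp add: g_def[abs_def])
  have gA: "(\<integral>\<^sup>+\<omega>. ennreal (indicator A \<omega> * g \<omega>) \<partial>M) = ennreal (\<mu> A)" if "A \<in> sets M" for A
  proof -
    have "(\<integral>\<^sup>+\<omega>. ennreal (indicator A \<omega> * g \<omega>) \<partial>M) = (\<integral>\<^sup>+\<omega>. f \<omega> * indicator A \<omega> \<partial>M)"
    proof (rule nn_integral_cong_AE)
      show "AE \<omega> in M. ennreal (indicator A \<omega> * g \<omega>) = f \<omega> * indicator A \<omega>"
        using fin by eventually_elim (auto simp: g_def indicator_def less_top)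
    qed
    then show ?thesis using fA[OF that] by simp
  qed
  have "integrable M (\<lambda>\<omega>. indicator (space M) \<omega> * g \<omega>)"
    by (rule integrableI_nonneg) (use gA[of "space M"] in \<open>auto simp: g_def\<close>)
  then have "integrable M g"
    by (rule Bochner_Integration.integrable_cong[THEN iffD1, rotated 2]) auto
  moreover have "\<mu> A = (\<integral>\<omega>. indicator A \<omega> * g \<omega> \<partial>M)" if "A \<in> sets M" for A
    using gA[OF that] that nonneg[OF that]
    by (subst integral_eq_nn_integral) (auto simp: g_def)
  ultimately show ?thesis by blast
qed

text \<open>
  The Jordan decomposition: the positive variation \<open>\<mu> A\<close>, the supremum of \<open>\<nu>\<close> over the measurable
  subsets of \<open>A\<close>, inherits additivity and the bound from \<open>\<nu>\<close>, and both \<open>\<mu>\<close> and \<open>\<mu> - \<nu>\<close> are nonnegative.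
\<close>

lemma (in finite_measure) Radon_Nikodym_charge:
  fixes \<nu> :: "'a set \<Rightarrow> real"
  assumes add: "\<And>A B. A \<in> sets M \<Longrightarrow> B \<in> sets M \<Longrightarrow> A \<inter> B = {} \<Longrightarrow> \<nu> (A \<union> B) = \<nu> A + \<nu> B"
    and bound: "\<And>A. A \<in> sets M \<Longrightarrow> \<bar>\<nu> A\<bar> \<le> measure M A powr r" and r: "0 < r"
  shows "\<exists>g::'a \<Rightarrow> real. integrable M g \<and> (\<forall>A\<in>sets M. \<nu> A = (\<integral>\<omega>. indicator A \<omega> * g \<omega> \<partial>M))"
proof -
  define \<mu> where "\<mu> A = (SUP B\<in>{B \<in> sets M. B \<subseteq> A}. \<nu> B)" for A
  have le: "\<nu> B \<le> measure M A powr r" if "A \<in> sets M" "B \<in> sets M" "B \<subseteq> A" for A B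
  proof -
    have "\<nu> B \<le> measure M B powr r" using bound[OF that(2)] by simp
    also have "\<dots> \<le> measure M A powr r"
      using that r by (intro powr_mono2 finite_measure_mono) auto
    finally show ?thesis .
  qed
  have upper: "\<nu> B \<le> \<mu> A" if "A \<in> sets M" "B \<in> sets M" "B \<subseteq> A" for A B
    unfolding \<mu>_def using le[OF that(1)] that
    by (intro cSUP_upper bdd_aboveI2[where M="measure M A powr r"]) auto
  have least: "\<mu> A \<le> x" if "\<And>B. B \<in> sets M \<Longrightarrow> B \<subseteq> A \<Longrightarrow> \<nu> B \<le> x" for A x
    unfolding \<mu>_def using that by (intro cSUP_least) auto
  have empty: "\<nu> {} = 0" using add[of "{}" "{}"] by simp
  have \<mu>_nonneg: "0 \<le> \<mu> A" if "A \<in> sets M" for A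
    using upper[OF that, of "{}"] empty by simp
  have \<mu>_add: "\<mu> (A \<union> B) = \<mu> A + \<mu> B" if AB: "A \<in> sets M" "B \<in> sets M" "A \<inter> B = {}" for A B
  proof (rule antisym)
    show "\<mu> (A \<union> B) \<le> \<mu> A + \<mu> B"
    proof (rule least)
      fix D assume D: "D \<in> sets M" "D \<subseteq> A \<union> B"
      then have "\<nu> D = \<nu> (D \<inter> A) + \<nu> (D \<inter> B)"
        using AB add[of "D \<inter> A" "D \<inter> B"] by (auto simp flip: Int_Un_distrib simp: Int_absorb2)
      also have "\<dots> \<le> \<mu> A + \<mu> B"
        using AB D by (intro add_mono upper) auto
      finally show "\<nu> D \<le> \<mu> A + \<mu> B" .
    qed
    have "\<mu> A \<le> \<mu> (A \<union> B) - \<mu> B"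
    proof (rule least)
      fix D assume D: "D \<in> sets M" "D \<subseteq> A"
      have "\<mu> B \<le> \<mu> (A \<union> B) - \<nu> D"
      proof (rule least)
        fix E assume E: "E \<in> sets M" "E \<subseteq> B"
        have "\<nu> (D \<union> E) = \<nu> D + \<nu> E" using AB D E by (intro add) auto
        moreover have "\<nu> (D \<union> E) \<le> \<mu> (A \<union> B)" using AB D E by (intro upper) auto
        ultimately show "\<nu> E \<le> \<mu> (A \<union> B) - \<nu> D" by simp
      qed
      then show "\<nu> D \<le> \<mu> (A \<union> B) - \<mu> B" by simp
    qed
    then show "\<mu> A + \<mu> B \<le> \<mu> (A \<union> B)" by simp
  qed
  have "\<exists>g::'a \<Rightarrow> real. integrable M g \<and> (\<forall>A\<in>sets M. \<mu> A = (\<integral>\<omega>. indicator A \<omega> * g \<omega> \<partial>M))"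
    by (rule Radon_Nikodym_content[where C=1 and r=r])
      (use \<mu>_nonneg \<mu>_add r in \<open>auto intro!: least le\<close>)
  then obtain g where g: "integrable M g" "\<And>A. A \<in> sets M \<Longrightarrow> \<mu> A = (\<integral>\<omega>. indicator A \<omega> * g \<omega> \<partial>M)"
    by blast
  have "\<exists>g::'a \<Rightarrow> real. integrable M g \<and> (\<forall>A\<in>sets M. \<mu> A - \<nu> A = (\<integral>\<omega>. indicator A \<omega> * g \<omega> \<partial>M))"
  proof (rule Radon_Nikodym_content[where C=2 and r=r])
    show "0 \<le> \<mu> A - \<nu> A" if "A \<in> sets M" for A using upper[OF that that] by simp
    show "\<mu> A - \<nu> A \<le> 2 * measure M A powr r" if A: "A \<in> sets M" for A
    proof -
      have "\<mu> A \<le> measure M A powr r" using A by (intro least le)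
      then show ?thesis using bound[OF A] by simp
    qed
  qed (use \<mu>_add add r in auto)
  then obtain h where h: "integrable M h"
      "\<And>A. A \<in> sets M \<Longrightarrow> \<mu> A - \<nu> A = (\<integral>\<omega>. indicator A \<omega> * h \<omega> \<partial>M)"
    by blast
  have "\<nu> A = (\<integral>\<omega>. indicator A \<omega> * (g \<omega> - h \<omega>) \<partial>M)" if A: "A \<in> sets M" for A
  proof -
    have "integrable M (\<lambda>\<omega>. indicator A \<omega> * g \<omega>)" "integrable M (\<lambda>\<omega>. indicator A \<omega> * h \<omega>)"
      using A g(1) h(1) integrable_mult_indicator[of A M g] integrable_mult_indicator[of A M h] by auto
    then show ?thesis
      using g(2)[OF A] h(2)[OF A] by (simp add: right_diff_distrib)
  qed
  then show ?thesis using g(1) h(1) by (intro exI[of _ "\<lambda>\<omega>. g \<omega> - h \<omega>"]) auto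
qed

locale Lp_functional = finite_measure M for M :: "'a measure" +
  fixes p :: real and L :: "('a \<Rightarrow> real) \<Rightarrow> real"
  assumes p: "1 \<le> p"
    and L_add: "u \<in> Lspace M M (ennreal p) \<Longrightarrow> v \<in> Lspace M M (ennreal p) \<Longrightarrow>
        L (\<lambda>\<omega>. u \<omega> + v \<omega>) = L u + L v"
    and L_scale: "u \<in> Lspace M M (ennreal p) \<Longrightarrow> L (\<lambda>\<omega>. c * u \<omega>) = c * L u"
    and le_norm: "u \<in> Lspace M M (ennreal p) \<Longrightarrow> L u \<le> lp_norm M p u"
begin

lemma bounded_mem:
  assumes "v \<in> borel_measurable M" "\<And>\<omega>. \<omega> \<in> space M \<Longrightarrow> \<bar>v \<omega>\<bar> \<le> (K::real)"
  shows "v \<in> Lspace M M (ennreal p)"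
  by (rule Lspace_bounded[where B=K])
    (use assms p subalgebra_refl in \<open>auto simp: finite_measure_axioms\<close>)

lemma diff_mem:
  assumes "u \<in> Lspace M M (ennreal p)" "v \<in> Lspace M M (ennreal p)"
  shows "(\<lambda>\<omega>. u \<omega> - v \<omega>) \<in> Lspace M M (ennreal p)"
  using subspace_diff[OF subspace_Lspace[OF subalgebra_refl, of "ennreal p"] assms] p
  by (simp add: fun_diff_def)

lemma diff:
  assumes "u \<in> Lspace M M (ennreal p)" "v \<in> Lspace M M (ennreal p)"
  shows "L (\<lambda>\<omega>. u \<omega> - v \<omega>) = L u - L v"
  using L_add[OF diff_mem[OF assms] assms(2)] by simp

lemma abs_diff_le:
  assumes "u \<in> Lspace M M (ennreal p)" "v \<in> Lspace M M (ennreal p)"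
  shows "\<bar>L u - L v\<bar> \<le> lp_norm M p (\<lambda>\<omega>. u \<omega> - v \<omega>)"
proof -
  have "lp_norm M p (\<lambda>\<omega>. v \<omega> - u \<omega>) = lp_norm M p (\<lambda>\<omega>. u \<omega> - v \<omega>)"
    by (rule lp_norm_minus_commute)
  then show ?thesis
    using le_norm[OF diff_mem[OF assms]] le_norm[OF diff_mem[OF assms(2,1)]]
      diff[OF assms] diff[OF assms(2,1)] by linarith
qed

lemma continuous:
  assumes "\<And>n. u n \<in> Lspace M M (ennreal p)" "v \<in> Lspace M M (ennreal p)"
    and "(\<lambda>n. lp_norm M p (\<lambda>\<omega>. u n \<omega> - v \<omega>)) \<longlonglongrightarrow> 0"
  shows "(\<lambda>n. L (u n)) \<longlonglongrightarrow> L v"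
proof (rule LIM_zero_cancel, rule Lim_null_comparison[OF always_eventually assms(3)], rule allI)
  show "norm (L (u n) - L v) \<le> lp_norm M p (\<lambda>\<omega>. u n \<omega> - v \<omega>)" for n
    using abs_diff_le[OF assms(1)[of n] assms(2)] by simp
qed

text \<open>
  Induction over nonnegative measurable functions. In the limit step dominated convergence applies on
  both sides, because \<open>L\<close> is continuous in \<open>L\<^sub>p\<close> and the functions have a common bound.
\<close>

lemma eq_integral_if_bounded:
  fixes g u :: "'a \<Rightarrow> real"
  assumes g: "integrable M g"
    and ind: "\<And>A. A \<in> sets M \<Longrightarrow> L (indicator A) = (\<integral>\<omega>. indicator A \<omega> * g \<omega> \<partial>M)"
    and u: "u \<in> borel_measurable M" and B: "\<And>\<omega>. \<omega> \<in> space M \<Longrightarrow> \<bar>u \<omega>\<bar> \<le> B"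
  shows "L u = (\<integral>\<omega>. u \<omega> * g \<omega> \<partial>M)"
proof -
  have gu: "integrable M (\<lambda>\<omega>. v \<omega> * g \<omega>)"
    if v: "v \<in> borel_measurable M" "\<And>\<omega>. \<omega> \<in> space M \<Longrightarrow> \<bar>v \<omega>\<bar> \<le> K" for v :: "'a \<Rightarrow> real" and K
  proof -
    have int: "integrable M (\<lambda>\<omega>. K * g \<omega>)" using g by simp
    have bound: "AE \<omega> in M. norm (v \<omega> * g \<omega>) \<le> norm (K * g \<omega>)"
    proof (rule AE_I2)
      fix \<omega> assume "\<omega> \<in> space M"
      then have "\<bar>v \<omega>\<bar> \<le> \<bar>K\<bar>" using v(2)[of \<omega>] by simp
      then show "norm (v \<omega> * g \<omega>) \<le> norm (K * g \<omega>)" by (simp add: abs_mult mult_right_mono)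
    qed
    show ?thesis
      by (rule Bochner_Integration.integrable_bound[OF int _ bound]) (use v g in measurable)
  qed
  have nonneg: "(\<exists>K. \<forall>\<omega>\<in>space M. v \<omega> \<le> K) \<longrightarrow> L v = (\<integral>\<omega>. v \<omega> * g \<omega> \<partial>M)"
    if "v \<in> borel_measurable M" "\<And>\<omega>. 0 \<le> v \<omega>" for v
    using that
  proof (induction rule: borel_measurable_induct_real)
    case (set A)
    then show ?case using ind by auto
  next
    case (mult v c)
    show ?case
    proof (cases "c = 0")
      case True
      then show ?thesis using L_scale[OF bounded_mem[of "\<lambda>_. 0" 0], of 0] by simp
    next
      case False
      show ?thesis
      proof
        assume "\<exists>K. \<forall>\<omega>\<in>space M. c * v \<omega> \<le> K"
        then obtain K where "\<forall>\<omega>\<in>space M. c * v \<omega> \<le> K" by blast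
        then have K: "\<forall>\<omega>\<in>space M. v \<omega> \<le> K / c" using False mult(1) by (simp add: field_simps)
        have "v \<in> Lspace M M (ennreal p)" by (rule bounded_mem[where K="K / c"]) (use mult K in auto)
        moreover have "L v = (\<integral>\<omega>. v \<omega> * g \<omega> \<partial>M)" using mult K by blast
        ultimately show "L (\<lambda>\<omega>. c * v \<omega>) = (\<integral>\<omega>. c * v \<omega> * g \<omega> \<partial>M)"
          using L_scale by (simp add: mult.assoc)
      qed
    qed
  next
    case (add v w)
    show ?case
    proof
      assume "\<exists>K. \<forall>\<omega>\<in>space M. w \<omega> + v \<omega> \<le> K"
      then obtain K where K0: "\<forall>\<omega>\<in>space M. w \<omega> + v \<omega> \<le> K" by blast
      then have K: "\<forall>\<omega>\<in>space M. w \<omega> \<le> K" "\<forall>\<omega>\<in>space M. v \<omega> \<le> K"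
      proof -
        have "0 \<le> v \<omega>" "0 \<le> w \<omega>" for \<omega> using add by auto
        then show "\<forall>\<omega>\<in>space M. w \<omega> \<le> K" "\<forall>\<omega>\<in>space M. v \<omega> \<le> K"
          using K0 by (meson add_increasing add_increasing2 order.trans le_add_same_cancel1 le_add_same_cancel2)+
      qed
      have "v \<in> Lspace M M (ennreal p)" "w \<in> Lspace M M (ennreal p)"
          "integrable M (\<lambda>\<omega>. v \<omega> * g \<omega>)" "integrable M (\<lambda>\<omega>. w \<omega> * g \<omega>)"
        using add K by (auto intro!: bounded_mem[where K=K] gu[where K=K])
      moreover have "L v = (\<integral>\<omega>. v \<omega> * g \<omega> \<partial>M)" "L w = (\<integral>\<omega>. w \<omega> * g \<omega> \<partial>M)"
        using add K by blast+
      ultimately show "L (\<lambda>\<omega>. w \<omega> + v \<omega>) = (\<integral>\<omega>. (w \<omega> + v \<omega>) * g \<omega> \<partial>M)"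
        using L_add by (simp add: distrib_right)
    qed
  next
    case (seq U)
    show ?case
    proof
      assume "\<exists>K. \<forall>\<omega>\<in>space M. v \<omega> \<le> K"
      then obtain K where K: "\<forall>\<omega>\<in>space M. v \<omega> \<le> K" by blast
      have Uv: "U i \<omega> \<le> v \<omega>" if "\<omega> \<in> space M" for i \<omega>
        using seq(3) seq(4)[OF that] by (intro incseq_le) (auto simp: incseq_def le_fun_def)
      then have UK: "\<forall>\<omega>\<in>space M. U i \<omega> \<le> K" for i using K by (meson order_trans)
      have v_meas: "v \<in> borel_measurable M"
        using seq(1,4) by (rule borel_measurable_LIMSEQ_real[rotated])
      have v_nonneg: "0 \<le> v \<omega>" if "\<omega> \<in> space M" for \<omega>
        using Uv[OF that, of 0] seq(2)[of 0 \<omega>] by simp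
      have v: "v \<in> Lspace M M (ennreal p)" by (rule bounded_mem[where K=K]) (use v_meas v_nonneg K in auto)
      have U: "U i \<in> Lspace M M (ennreal p)" for i by (rule bounded_mem[where K=K]) (use seq UK in auto)
      have "(\<lambda>i. L (U i)) \<longlonglongrightarrow> L v"
      proof (rule continuous[OF U v])
        show "(\<lambda>i. lp_norm M p (\<lambda>\<omega>. U i \<omega> - v \<omega>)) \<longlonglongrightarrow> 0"
        proof (rule lp_norm_dominated_convergence[OF _ v, where C=1])
          show "AE \<omega> in M. (\<lambda>n. U n \<omega> - v \<omega>) \<longlonglongrightarrow> 0"
            using seq(4) by (intro AE_I2 LIM_zero) auto
          show "AE \<omega> in M. norm (U n \<omega> - v \<omega>) \<le> 1 * norm (v \<omega>)" for n
          proof (rule AE_I2)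
            fix \<omega> assume "\<omega> \<in> space M"
            from Uv[OF this, of n] seq(2)[of n \<omega>] v_nonneg[OF this]
            show "norm (U n \<omega> - v \<omega>) \<le> 1 * norm (v \<omega>)" by simp
          qed
        qed (use p seq(1) v_meas in auto)
      qed
      moreover have "(\<lambda>i. \<integral>\<omega>. U i \<omega> * g \<omega> \<partial>M) \<longlonglongrightarrow> (\<integral>\<omega>. v \<omega> * g \<omega> \<partial>M)"
      proof (rule integral_dominated_convergence)
        show "integrable M (\<lambda>\<omega>. K * norm (g \<omega>))" using g by simp
        show "AE \<omega> in M. (\<lambda>i. U i \<omega> * g \<omega>) \<longlonglongrightarrow> v \<omega> * g \<omega>"
          using seq(4) by (intro AE_I2 tendsto_intros) auto
        show "AE \<omega> in M. norm (U i \<omega> * g \<omega>) \<le> K * norm (g \<omega>)" for i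
          using UK[of i] seq(2)[of i] by (intro AE_I2) (auto simp: abs_mult intro!: mult_right_mono)
      qed (use seq(1) v_meas g in measurable)
      moreover have "L (U i) = (\<integral>\<omega>. U i \<omega> * g \<omega> \<partial>M)" for i
        using seq(5)[of i] UK by blast
      ultimately show "L v = (\<integral>\<omega>. v \<omega> * g \<omega> \<partial>M)"
        using LIMSEQ_unique by auto
    qed
  qed
  define v w where "v \<omega> = max (u \<omega>) 0" and "w \<omega> = max (- u \<omega>) 0" for \<omega>
  have vw: "v \<in> borel_measurable M" "w \<in> borel_measurable M"
    using u by (simp_all add: v_def[abs_def] w_def[abs_def])
  have bnd: "\<bar>v \<omega>\<bar> \<le> B" "\<bar>w \<omega>\<bar> \<le> B" "v \<omega> \<le> B" "w \<omega> \<le> B" if "\<omega> \<in> space M" for \<omega>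
    using B[OF that] by (auto simp: v_def w_def)
  have mv: "v \<in> Lspace M M (ennreal p)" "w \<in> Lspace M M (ennreal p)"
    using vw bnd by (auto intro: bounded_mem)
  have u_eq: "u = (\<lambda>\<omega>. v \<omega> - w \<omega>)" by (auto simp: v_def w_def fun_eq_iff)
  have "L u = L v - L w"
    unfolding u_eq using diff[OF mv] .
  moreover have "L v = (\<integral>\<omega>. v \<omega> * g \<omega> \<partial>M)" "L w = (\<integral>\<omega>. w \<omega> * g \<omega> \<partial>M)"
  proof -
    have "0 \<le> v \<omega>" "0 \<le> w \<omega>" for \<omega> by (auto simp: v_def w_def)
    then show "L v = (\<integral>\<omega>. v \<omega> * g \<omega> \<partial>M)" "L w = (\<integral>\<omega>. w \<omega> * g \<omega> \<partial>M)"
      using nonneg[OF vw(1)] nonneg[OF vw(2)] bnd by blast+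
  qed
  moreover have "integrable M (\<lambda>\<omega>. v \<omega> * g \<omega>)" "integrable M (\<lambda>\<omega>. w \<omega> * g \<omega>)"
    using vw bnd by (auto intro: gu[where K=B])
  ultimately show ?thesis
    unfolding u_eq by (simp add: left_diff_distrib)
qed

lemma ex_density:
  "\<exists>g::'a \<Rightarrow> real. integrable M g \<and>
     (\<forall>A\<in>sets M. L (indicator A) = (\<integral>\<omega>. indicator A \<omega> * g \<omega> \<partial>M))"
proof (rule Radon_Nikodym_charge[where r="1 / p"])
  have mem: "(indicator A :: 'a \<Rightarrow> real) \<in> Lspace M M (ennreal p)" if "A \<in> sets M" for A
    by (rule bounded_mem[where K=1]) (use that in \<open>auto simp: indicator_def\<close>)
  show "L (indicator (A \<union> B)) = L (indicator A) + L (indicator B)"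
    if "A \<in> sets M" "B \<in> sets M" "A \<inter> B = {}" for A B
  proof -
    have "(indicator (A \<union> B) :: 'a \<Rightarrow> real) = (\<lambda>\<omega>. indicator A \<omega> + indicator B \<omega>)"
      using that(3) by (auto simp: indicator_def fun_eq_iff)
    then show ?thesis using L_add[OF mem[OF that(1)] mem[OF that(2)]] by simp
  qed
  show "\<bar>L (indicator A)\<bar> \<le> measure M A powr (1 / p)" if A: "A \<in> sets M" for A
  proof -
    have zero: "(\<lambda>_::'a. 0::real) \<in> Lspace M M (ennreal p)" by (rule bounded_mem[where K=0]) auto
    have "L (\<lambda>_. 0) = 0" using L_scale[OF zero, of 0] by simp
    then have "\<bar>L (indicator A)\<bar> \<le> lp_norm M p (indicator A :: 'a \<Rightarrow> real)"
      using abs_diff_le[OF mem[OF A] zero] by simp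
    also have "(\<lambda>\<omega>. norm (indicator A \<omega> :: real) powr p) = indicator A"
      using p by (auto simp: indicator_def fun_eq_iff)
    then have "lp_norm M p (indicator A :: 'a \<Rightarrow> real) = measure M A powr (1 / p)"
      using A by (simp add: lp_norm_def)
    finally show ?thesis .
  qed
qed (use p in auto)

text \<open>
  The functional is tested on bounded functions that nearly attain the norm of \<open>g\<close>: for \<open>p = 1\<close> on
  \<open>sgn g\<close> restricted to \<open>1 < \<bar>g\<bar>\<close>, which must then be a null set; for \<open>p > 1\<close> on
  \<open>sgn g * \<bar>g\<bar> powr (s - 1)\<close> restricted to \<open>\<bar>g\<bar> \<le> n\<close>. As \<open>(s - 1) * p = s\<close>, the integral \<open>I n\<close> of the truncated
  \<open>\<bar>g\<bar> powr s\<close> satisfies \<open>I n \<le> I n powr (1 / p)\<close>, so it is at most \<open>1\<close> for every \<open>n\<close>.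
\<close>

lemma density_in_dual:
  fixes g :: "'a \<Rightarrow> real"
  assumes q: "1 / ennreal p + 1 / q = 1" and g: "integrable M g"
    and eq: "\<And>u B. u \<in> borel_measurable M \<Longrightarrow> (\<And>\<omega>. \<bar>u \<omega>\<bar> \<le> B) \<Longrightarrow> L u = (\<integral>\<omega>. u \<omega> * g \<omega> \<partial>M)"
  shows "g \<in> Lspace M M q"
proof -
  have g_meas[measurable]: "g \<in> borel_measurable M" using g by auto
  have bound: "(\<integral>\<omega>. u \<omega> * g \<omega> \<partial>M) \<le> lp_norm M p u"
    if "u \<in> borel_measurable M" "\<And>\<omega>. \<bar>u \<omega>\<bar> \<le> B" for u B
    using le_norm[OF bounded_mem[of u B]] eq[of u B] that by simp
  from p q show ?thesis
  proof (cases rule: conjugate_cases)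
    case one
    define A where "A = {\<omega> \<in> space M. 1 < \<bar>g \<omega>\<bar>}"
    have A[measurable]: "A \<in> sets M" by (simp add: A_def)
    define u where "u \<omega> = indicator A \<omega> * sgn (g \<omega>)" for \<omega>
    have u_meas: "u \<in> borel_measurable M" by (simp add: u_def[abs_def])
    have u_abs: "\<bar>u \<omega>\<bar> = indicator A \<omega>" for \<omega>
      by (auto simp: u_def A_def indicator_def sgn_if)
    have int1: "integrable M (indicator A :: 'a \<Rightarrow> real)"
      using A by (simp add: emeasure_eq_measure)
    have int2: "integrable M (\<lambda>\<omega>. u \<omega> * g \<omega>)"
      by (rule Bochner_Integration.integrable_bound[OF g])
        (use u_meas u_abs in \<open>auto simp: abs_mult indicator_def\<close>)
    have "lp_norm M p u = (\<integral>\<omega>. indicator A \<omega> \<partial>M)"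
      using one by (simp add: lp_norm_def u_abs)
    moreover have "\<bar>u \<omega>\<bar> \<le> 1" for \<omega> by (simp add: u_abs indicator_def)
    ultimately have "(\<integral>\<omega>. u \<omega> * g \<omega> - indicator A \<omega> \<partial>M) \<le> 0"
      using bound[OF u_meas, of 1] int1 int2 by simp
    moreover have nn: "0 \<le> u \<omega> * g \<omega> - indicator A \<omega>" for \<omega>
      by (auto simp: u_def A_def indicator_def sgn_if)
    moreover have "0 \<le> (\<integral>\<omega>. u \<omega> * g \<omega> - indicator A \<omega> \<partial>M)"
      using nn by (intro integral_nonneg_AE) auto
    ultimately have "(\<integral>\<omega>. u \<omega> * g \<omega> - indicator A \<omega> \<partial>M) = 0" by simp
    then have "AE \<omega> in M. u \<omega> * g \<omega> - indicator A \<omega> = 0"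
      using nn int1 int2 by (subst (asm) integral_nonneg_eq_0_iff_AE) auto
    then have "AE \<omega> in M. norm (g \<omega>) \<le> 1"
      using AE_space
    proof eventually_elim
      case (elim \<omega>)
      then show ?case by (auto simp: u_def A_def indicator_def sgn_if split: if_splits)
    qed
    then show ?thesis using one by (auto simp: Lspace_def)
  next
    case (gt s)
    have ps: "(s - 1) * p = s" using gt by (simp add: field_simps)
    define A where "A n = {\<omega> \<in> space M. \<bar>g \<omega>\<bar> \<le> real n}" for n
    have A[measurable]: "A n \<in> sets M" for n by (simp add: A_def)
    define I where "I n = (\<integral>\<omega>. indicator (A n) \<omega> * \<bar>g \<omega>\<bar> powr s \<partial>M)" for n
    have I_int: "integrable M (\<lambda>\<omega>. indicator (A n) \<omega> * \<bar>g \<omega>\<bar> powr s)" for n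
    proof (rule integrable_const_bound[where B="real n powr s"])
      show "AE \<omega> in M. norm (indicator (A n) \<omega> * \<bar>g \<omega>\<bar> powr s) \<le> real n powr s"
        using gt by (intro AE_I2) (auto simp: A_def indicator_def intro!: powr_mono2)
    qed auto
    have I_le: "I n \<le> 1" for n
    proof -
      define u where "u \<omega> = indicator (A n) \<omega> * (sgn (g \<omega>) * \<bar>g \<omega>\<bar> powr (s - 1))" for \<omega>
      have u_meas: "u \<in> borel_measurable M" by (simp add: u_def[abs_def])
      have u_bnd: "\<bar>u \<omega>\<bar> \<le> real n powr (s - 1)" for \<omega>
        using gt by (auto simp: u_def A_def indicator_def sgn_if abs_mult intro!: powr_mono2)
      have "u \<omega> * g \<omega> = indicator (A n) \<omega> * \<bar>g \<omega>\<bar> powr s" for \<omega>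
      proof -
        have "\<bar>g \<omega>\<bar> powr (s - 1) * \<bar>g \<omega>\<bar> = \<bar>g \<omega>\<bar> powr s"
          using powr_mult_base[of "\<bar>g \<omega>\<bar>" "s - 1"] by (simp add: mult.commute)
        moreover have "sgn (g \<omega>) * g \<omega> = \<bar>g \<omega>\<bar>" by (simp add: sgn_if)
        moreover have "u \<omega> * g \<omega> =
            indicator (A n) \<omega> * (\<bar>g \<omega>\<bar> powr (s - 1) * (sgn (g \<omega>) * g \<omega>))"
          by (simp add: u_def)
        ultimately show ?thesis by simp
      qed
      moreover have "\<bar>u \<omega>\<bar> powr p = indicator (A n) \<omega> * \<bar>g \<omega>\<bar> powr s" for \<omega>
        using ps p by (auto simp: u_def indicator_def abs_mult powr_powr sgn_if)
      ultimately have *: "I n \<le> I n powr (1 / p)"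
        using bound[OF u_meas u_bnd] by (simp add: I_def lp_norm_def)
      show ?thesis
      proof (rule ccontr)
        assume "\<not> I n \<le> 1"
        then have "I n powr (1 / p) < I n powr 1"
          using gt(1) by (intro powr_less_mono) auto
        then show False using * \<open>\<not> I n \<le> 1\<close> by simp
      qed
    qed
    have lim: "(\<lambda>n. \<integral>\<^sup>+\<omega>. ennreal (indicator (A n) \<omega> * \<bar>g \<omega>\<bar> powr s) \<partial>M)
        \<longlonglongrightarrow> (\<integral>\<^sup>+\<omega>. ennreal (indicator (space M) \<omega> * \<bar>g \<omega>\<bar> powr s) \<partial>M)"
    proof (rule nn_integral_LIMSEQ)
      show "incseq (\<lambda>n \<omega>. ennreal (indicator (A n) \<omega> * \<bar>g \<omega>\<bar> powr s))"
        by (auto simp: incseq_def le_fun_def A_def indicator_def)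
      show "(\<lambda>n. ennreal (indicator (A n) \<omega> * \<bar>g \<omega>\<bar> powr s))
          \<longlonglongrightarrow> ennreal (indicator (space M) \<omega> * \<bar>g \<omega>\<bar> powr s)" for \<omega>
      proof (rule tendsto_eventually)
        obtain N where "\<bar>g \<omega>\<bar> \<le> real N" using real_arch_simple by blast
        then show "\<forall>\<^sub>F n in sequentially. ennreal (indicator (A n) \<omega> * \<bar>g \<omega>\<bar> powr s) =
            ennreal (indicator (space M) \<omega> * \<bar>g \<omega>\<bar> powr s)"
          by (intro eventually_sequentiallyI[of N]) (auto simp: A_def indicator_def)
      qed
    qed auto
    have "(\<integral>\<^sup>+\<omega>. ennreal (indicator (A n) \<omega> * \<bar>g \<omega>\<bar> powr s) \<partial>M) \<le> 1" for n
    proof -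
      have "(\<integral>\<^sup>+\<omega>. ennreal (indicator (A n) \<omega> * \<bar>g \<omega>\<bar> powr s) \<partial>M) = ennreal (I n)"
        unfolding I_def using I_int by (intro nn_integral_eq_integral) auto
      then show ?thesis using I_le[of n] by (simp add: ennreal_le_1)
    qed
    then have "(\<integral>\<^sup>+\<omega>. ennreal (indicator (space M) \<omega> * \<bar>g \<omega>\<bar> powr s) \<partial>M) \<le> 1"
      by (intro LIMSEQ_le_const2[OF lim]) auto
    then have "integrable M (\<lambda>\<omega>. indicator (space M) \<omega> * \<bar>g \<omega>\<bar> powr s)"
      by (intro integrableI_nonneg) (auto intro: le_less_trans)
    then have "integrable M (\<lambda>\<omega>. norm (g \<omega>) powr s)"
      by (rule Bochner_Integration.integrable_cong[THEN iffD1, rotated 2]) auto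
    then show ?thesis using gt by (simp add: Lspace_ennreal)
  qed
qed

text \<open>
  The Riesz representation of functionals on \<open>L\<^sub>p\<close>. It extends from bounded functions to all
  of \<open>L\<^sub>p\<close> by truncation, now that the density is known to lie in the dual space.
\<close>

theorem ex_representation:
  assumes q: "1 / ennreal p + 1 / q = 1"
  shows "\<exists>g\<in>Lspace M M q. \<forall>u\<in>Lspace M M (ennreal p). L u = (\<integral>\<omega>. g \<omega> * u \<omega> \<partial>M)"
proof -
  obtain g where g: "integrable M g"
      "\<And>A. A \<in> sets M \<Longrightarrow> L (indicator A) = (\<integral>\<omega>. indicator A \<omega> * g \<omega> \<partial>M)"
    using ex_density by blast
  have eq: "L u = (\<integral>\<omega>. u \<omega> * g \<omega> \<partial>M)"
    if "u \<in> borel_measurable M" "\<And>\<omega>. \<bar>u \<omega>\<bar> \<le> B" for u B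
    using eq_integral_if_bounded[OF g that(1)] that(2) by blast
  have gq: "g \<in> Lspace M M q" by (rule density_in_dual[OF q g(1) eq])
  have "L u = (\<integral>\<omega>. g \<omega> * u \<omega> \<partial>M)" if u: "u \<in> Lspace M M (ennreal p)" for u
  proof -
    have u_meas[measurable]: "u \<in> borel_measurable M" using u by (rule Lspace_measurable)
    have g_meas[measurable]: "g \<in> borel_measurable M" using gq by (rule Lspace_measurable)
    define v where "v n \<omega> = (if \<bar>u \<omega>\<bar> \<le> real n then u \<omega> else 0)" for n \<omega>
    have v_meas[measurable]: "v n \<in> borel_measurable M" for n by (simp add: v_def[abs_def])
    have v_le: "\<bar>v n \<omega>\<bar> \<le> real n" for n \<omega> by (simp add: v_def)
    have v_lim: "(\<lambda>n. v n \<omega>) \<longlonglongrightarrow> u \<omega>" for \<omega>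
    proof (rule tendsto_eventually)
      obtain N where "\<bar>u \<omega>\<bar> \<le> real N" using real_arch_simple by blast
      then show "\<forall>\<^sub>F n in sequentially. v n \<omega> = u \<omega>"
        by (intro eventually_sequentiallyI[of N]) (auto simp: v_def)
    qed
    have "(\<lambda>n. L (v n)) \<longlonglongrightarrow> L u"
    proof (rule continuous[OF _ u])
      show "v n \<in> Lspace M M (ennreal p)" for n by (rule bounded_mem[where K=n]) (use v_le in auto)
      show "(\<lambda>n. lp_norm M p (\<lambda>\<omega>. v n \<omega> - u \<omega>)) \<longlonglongrightarrow> 0"
      proof (rule lp_norm_dominated_convergence[OF _ u, where C=1])
        show "AE \<omega> in M. (\<lambda>n. v n \<omega> - u \<omega>) \<longlonglongrightarrow> 0"
          using v_lim by (intro AE_I2 LIM_zero)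
        show "AE \<omega> in M. norm (v n \<omega> - u \<omega>) \<le> 1 * norm (u \<omega>)" for n
          by (auto simp: v_def)
      qed (use p in auto)
    qed
    moreover have "(\<lambda>n. \<integral>\<omega>. v n \<omega> * g \<omega> \<partial>M) \<longlonglongrightarrow> (\<integral>\<omega>. u \<omega> * g \<omega> \<partial>M)"
    proof (rule integral_dominated_convergence)
      show "integrable M (\<lambda>\<omega>. norm (g \<omega> \<bullet> u \<omega>))"
        using integrable_inner_conjugate[OF p q gq u] by simp
      show "AE \<omega> in M. (\<lambda>n. v n \<omega> * g \<omega>) \<longlonglongrightarrow> u \<omega> * g \<omega>"
        using v_lim by (intro AE_I2 tendsto_intros)
      show "AE \<omega> in M. norm (v n \<omega> * g \<omega>) \<le> norm (g \<omega> \<bullet> u \<omega>)" for n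
        by (auto simp: v_def abs_mult)
    qed measurable
    moreover have "L (v n) = (\<integral>\<omega>. v n \<omega> * g \<omega> \<partial>M)" for n
      by (rule eq[OF v_meas v_le])
    ultimately have "L u = (\<integral>\<omega>. u \<omega> * g \<omega> \<partial>M)" using LIMSEQ_unique by auto
    then show ?thesis by (simp add: mult.commute)
  qed
  then show ?thesis using gq by blast
qed

end

section \<open>Adapted processes\<close>

lemma filtered_subalgebra: "filtered_prob_space M Filt \<Longrightarrow> subalgebra M (Filt t)"
  by (simp add: filtered_prob_space_def)

lemma vec_eq_sum_axis: "(v :: 'b::comm_monoid_add ^ 'n) = (\<Sum>i\<in>UNIV. axis i (v $ i))"
  by (simp add: vec_eq_iff axis_def if_distrib cong: if_cong)

lemma norm_axis: "norm (axis i v :: 'b::real_normed_vector ^ 'n) = norm v"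
  by (simp add: norm_vec_def L2_set_def axis_def if_distrib[of norm] if_distrib[of "\<lambda>z. z\<^sup>2"] cong: if_cong)

lemma bounded_linear_axis: "bounded_linear (axis i :: 'b::real_normed_vector \<Rightarrow> 'b ^ 'n)"
proof (rule bounded_linear_intro[where K=1])
  show "norm (axis i v :: 'b ^ 'n) \<le> norm v * 1" for v :: 'b by (simp add: norm_axis)
qed (auto simp: vec_eq_iff axis_def)

lemma borel_measurable_axis:
  fixes u :: "'a \<Rightarrow> 'b::euclidean_space"
  shows "u \<in> borel_measurable G \<Longrightarrow> (\<lambda>\<omega>. axis i (u \<omega>) :: 'b ^ 'n) \<in> borel_measurable G"
  using bounded_linear_axis borel_measurable_continuous_onI linear_continuous_on measurable_compose
  by blast

lemma borel_measurable_vec_nth: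
  fixes x :: "'a \<Rightarrow> 'b::euclidean_space ^ 'n"
  shows "x \<in> borel_measurable G \<Longrightarrow> (\<lambda>\<omega>. x \<omega> $ i) \<in> borel_measurable G"
  using bounded_linear_vec_nth borel_measurable_continuous_onI linear_continuous_on measurable_compose
  by blast

lemma Lspace_axis:
  fixes u :: "'a \<Rightarrow> 'b::euclidean_space"
  assumes "subalgebra M G" "0 < r" "u \<in> Lspace M G r"
  shows "(\<lambda>\<omega>. axis i (u \<omega>) :: 'b ^ 'n) \<in> Lspace M G r"
  by (rule Lspace_dominated[OF assms, where C=1])
    (use borel_measurable_axis[OF Lspace_measurable[OF assms(3)]] in \<open>auto simp: norm_axis\<close>)

lemma Lspace_vec_nth:
  fixes x :: "'a \<Rightarrow> 'b::euclidean_space ^ 'n"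
  assumes "subalgebra M G" "0 < r" "x \<in> Lspace M G r"
  shows "(\<lambda>\<omega>. x \<omega> $ i) \<in> Lspace M G r"
  by (rule Lspace_dominated[OF assms, where C=1])
    (use borel_measurable_vec_nth[OF Lspace_measurable[OF assms(3)]] in
      \<open>auto simp: Finite_Cartesian_Product.norm_nth_le\<close>)

lemma Lspace_vecI:
  fixes x :: "'a \<Rightarrow> 'b::euclidean_space ^ 'n"
  assumes G: "subalgebra M G" and r: "0 < r" and x: "\<And>i. (\<lambda>\<omega>. x \<omega> $ i) \<in> Lspace M G r"
  shows "x \<in> Lspace M G r"
proof -
  have "(\<Sum>i\<in>UNIV. (\<lambda>\<omega>. axis i (x \<omega> $ i))) \<in> Lspace M G r"
    by (intro subspace_sum[OF subspace_Lspace[OF G r]] Lspace_axis[OF G r] x)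
  also have "(\<Sum>i\<in>UNIV. (\<lambda>\<omega>. axis i (x \<omega> $ i))) = x"
    by (simp add: fun_eq_iff sum_fun_apply flip: vec_eq_sum_axis)
  finally show ?thesis .
qed

locale filtered_space =
  fixes M :: "'a measure" and Filt :: "'t::{finite,linorder} \<Rightarrow> 'a measure"
  assumes filtered: "filtered_prob_space M Filt"
begin

sublocale prob_space M
  using filtered by (simp add: filtered_prob_space_def)

lemma subalg: "subalgebra M (Filt t)"
  using filtered by (rule filtered_subalgebra)

lemma procsD: "x \<in> procs M Filt r \<Longrightarrow> (\<lambda>\<omega>. x \<omega> $ t) \<in> Lspace M (Filt t) r"
  by (simp add: procs_def)

lemma procs_Lspace:
  assumes "0 < r" "x \<in> procs M Filt r"
  shows "x \<in> Lspace M M r"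
  by (rule Lspace_vecI[OF subalgebra_refl assms(1) Lspace_mono_algebra[OF subalg procsD[OF assms(2)]]])

lemma procs_measurable:
  assumes "0 < r" "x \<in> procs M Filt r"
  shows "x \<in> borel_measurable M"
  using procs_Lspace[OF assms] by (rule Lspace_measurable)

lemma subspace_procs:
  assumes "0 < r"
  shows "subspace (procs M Filt r :: ('a \<Rightarrow> (real^'n, 't) vec) set)"
proof (rule subspaceI)
  note S = subspace_Lspace[OF subalg assms]
  show "0 \<in> (procs M Filt r :: ('a \<Rightarrow> (real^'n, 't) vec) set)"
  proof -
    have "(0 :: 'a \<Rightarrow> real^'n) \<in> Lspace M (Filt t) r" for t by (rule subspace_0[OF S])
    then show ?thesis by (simp add: procs_def zero_fun_def)
  qed
  show "x + y \<in> procs M Filt r" if "x \<in> procs M Filt r" "y \<in> procs M Filt r"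
    for x y :: "'a \<Rightarrow> (real^'n, 't) vec"
    using subspace_add[OF S procsD[OF that(1)] procsD[OF that(2)]]
    by (simp add: procs_def plus_fun_def)
  show "c *\<^sub>R x \<in> procs M Filt r" if "x \<in> procs M Filt r"
    for c and x :: "'a \<Rightarrow> (real^'n, 't) vec"
    using subspace_scale[OF S procsD[OF that]]
    by (simp add: procs_def scaleR_fun_def)
qed

lemma procs_add:
  "0 < r \<Longrightarrow> x \<in> procs M Filt r \<Longrightarrow> y \<in> procs M Filt r \<Longrightarrow> (\<lambda>\<omega>. x \<omega> + y \<omega>) \<in> procs M Filt r"
  using subspace_add[OF subspace_procs, of r x y] by (simp add: plus_fun_def)

lemma procs_diff:
  "0 < r \<Longrightarrow> x \<in> procs M Filt r \<Longrightarrow> y \<in> procs M Filt r \<Longrightarrow> (\<lambda>\<omega>. x \<omega> - y \<omega>) \<in> procs M Filt r"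
  using subspace_diff[OF subspace_procs, of r x y] by (simp add: fun_diff_def)

lemma procs_scaleR:
  "0 < r \<Longrightarrow> x \<in> procs M Filt r \<Longrightarrow> (\<lambda>\<omega>. c *\<^sub>R x \<omega>) \<in> procs M Filt r"
  using subspace_scale[OF subspace_procs, of r x c] by (simp add: scaleR_fun_def)

lemma procs_zero: "0 < r \<Longrightarrow> (\<lambda>\<omega>. 0) \<in> procs M Filt r"
  using subspace_0[OF subspace_procs, of r] by (simp add: zero_fun_def)

lemmas procs_closed = procs_add procs_diff procs_scaleR procs_zero

end

text \<open>
  The abbreviations \<open>X\<close> and \<open>X'\<close> do not fix the dimension of the values: \<open>X\<close> stands for the space of
  \<open>L\<^sub>p\<close> processes in which \<open>F\<close> is defined as well as for the one in which it has its values.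
\<close>

locale dual_exponents = filtered_space M Filt
  for M :: "'a measure" and Filt :: "'t::{finite,linorder} \<Rightarrow> 'a measure" +
  fixes p :: real and q :: ennreal
  assumes p1: "1 \<le> p" and conj: "1 / ennreal p + 1 / q = 1"
begin

lemma p0: "0 < p" "0 < ennreal p" and q0: "0 < q"
  using p1 conjugate_pos[OF p1 conj] by auto

abbreviation "X \<equiv> procs M Filt (ennreal p)"
abbreviation "X' \<equiv> procs M Filt q"

lemmas X_closed = procs_closed[OF p0(2)]

lemma lp_norm_triangle:
  assumes "x \<in> X" "y \<in> X"
  shows "lp_norm M p (\<lambda>\<omega>. x \<omega> + y \<omega>) \<le> lp_norm M p x + lp_norm M p y"
  by (intro Minkowski[OF p1] procs_Lspace p0 assms)

lemma lp_norm_sublinear: "sublinear_on X (lp_norm M p)"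
  using lp_norm_triangle
  by (auto simp: sublinear_on_def plus_fun_def scaleR_fun_def lp_norm_scaleR[OF p0(1)])

lemma integrable_pairing:
  assumes "\<psi> \<in> X'" "x \<in> X"
  shows "integrable M (\<lambda>\<omega>. \<psi> \<omega> \<bullet> x \<omega>)"
  by (intro integrable_inner_conjugate[OF p1 conj] procs_Lspace p0 q0 assms)

lemma pairing_eq_integral:
  assumes "\<psi> \<in> X'" "x \<in> X"
  shows "pairing M \<psi> x = (\<integral>\<omega>. \<psi> \<omega> \<bullet> x \<omega> \<partial>M)"
proof -
  have "integrable M (\<lambda>\<omega>. \<psi> \<omega> $ t \<bullet> x \<omega> $ t)" for t
    by (intro integrable_inner_conjugate[OF p1 conj] Lspace_mono_algebra[OF subalg, of _ t] procsD assms)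
  then show ?thesis
    by (simp add: pairing_def inner_vec_def)
qed

lemma pairing_add:
  assumes "\<psi> \<in> X'" "x \<in> X" "y \<in> X"
  shows "pairing M \<psi> (\<lambda>\<omega>. x \<omega> + y \<omega>) = pairing M \<psi> x + pairing M \<psi> y"
  using assms X_closed(1)[OF assms(2,3)] integrable_pairing[OF assms(1,2)]
    integrable_pairing[OF assms(1,3)]
  by (simp add: pairing_eq_integral inner_add_right)

lemma pairing_scaleR:
  "pairing M \<psi> (\<lambda>\<omega>. c *\<^sub>R x \<omega>) = c * pairing M \<psi> x"
  by (simp add: pairing_def sum_distrib_left)

lemma pairing_diff:
  assumes "\<psi> \<in> X'" "x \<in> X" "y \<in> X"
  shows "pairing M \<psi> (\<lambda>\<omega>. x \<omega> - y \<omega>) = pairing M \<psi> x - pairing M \<psi> y"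
  using pairing_add[OF assms(1) X_closed(2)[OF assms(2,3)] assms(3)] by simp

text \<open>
  A scaling argument from the unit ball; the additional \<open>e\<close> covers processes of norm zero.
\<close>

lemma pairing_le_norm:
  fixes \<psi> x :: "'a \<Rightarrow> (real^'n, 't) vec"
  assumes \<psi>: "\<psi> \<in> dual_ball M Filt p q" and x: "x \<in> X"
  shows "pairing M \<psi> x \<le> lp_norm M p x"
proof (rule field_le_epsilon)
  fix e :: real assume e: "0 < e"
  have \<psi>': "\<psi> \<in> X'" "dual_norm M Filt p \<psi> \<le> 1" using \<psi> by (auto simp: dual_ball_def)
  obtain C where C: "\<And>h. h \<in> Lspace M M (ennreal p) \<Longrightarrow> lp_norm M p h \<le> 1 \<Longrightarrow> (\<integral>\<omega>. \<psi> \<omega> \<bullet> h \<omega> \<partial>M) \<le> C"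
    using integral_inner_conjugate_bounded[OF p1 conj procs_Lspace[OF q0 \<psi>'(1)]] by blast
  have unit: "pairing M \<psi> y \<le> 1" if y: "y \<in> X" "lp_norm M p y \<le> 1" for y :: "'a \<Rightarrow> (real^'n, 't) vec"
  proof -
    have "pairing M \<psi> y \<le> dual_norm M Filt p \<psi>"
      unfolding dual_norm_def
    proof (rule cSUP_upper)
      show "bdd_above (pairing M \<psi> ` {y \<in> X. lp_norm M p y \<le> 1})"
        using C procs_Lspace[OF p0(2)] by (auto simp: pairing_eq_integral[OF \<psi>'(1)] intro!: bdd_aboveI[of _ C])
    qed (use y in auto)
    then show ?thesis using \<psi>'(2) by simp
  qed
  define c where "c = lp_norm M p x + e"
  have c: "0 < c" using e by (auto simp: c_def intro!: add_nonneg_pos lp_norm_nonneg)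
  have "pairing M \<psi> (\<lambda>\<omega>. (1 / c) *\<^sub>R x \<omega>) \<le> 1"
  proof (rule unit[OF X_closed(3)[OF x]])
    show "lp_norm M p (\<lambda>\<omega>. (1 / c) *\<^sub>R x \<omega>) \<le> 1"
      using c e by (subst lp_norm_scaleR[OF p0(1)]) (auto simp: c_def)
  qed
  then show "pairing M \<psi> x \<le> lp_norm M p x + e"
    using c by (simp add: pairing_scaleR divide_le_eq flip: c_def)
qed

lemma dual_ballI:
  fixes \<psi> :: "'a \<Rightarrow> (real^'n, 't) vec"
  assumes "\<psi> \<in> X'" "\<And>x. x \<in> X \<Longrightarrow> pairing M \<psi> x \<le> lp_norm M p x"
  shows "\<psi> \<in> dual_ball M Filt p q"
proof -
  have "dual_norm M Filt p \<psi> \<le> 1"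
    unfolding dual_norm_def
  proof (rule cSUP_least)
    have "(\<lambda>\<omega>. 0) \<in> {y \<in> X. lp_norm M p y \<le> 1}" using X_closed(4) by (simp add: lp_norm_zero)
    then show "{y \<in> X. lp_norm M p y \<le> 1} \<noteq> {}" by blast
  qed (use assms(2) in force)
  then show ?thesis using assms(1) by (simp add: dual_ball_def)
qed

lemma
  fixes u :: "'a \<Rightarrow> 'b::euclidean_space"
  assumes G: "subalgebra M G" and N: "N = restr_to_subalg M G"
  shows Lspace_restr_subset: "u \<in> Lspace N N r \<Longrightarrow> 0 < r \<Longrightarrow> u \<in> Lspace M G r"
    and Lspace_restr_finite: "u \<in> Lspace M G (ennreal p) \<Longrightarrow> u \<in> Lspace N N (ennreal p)"
proof -
  have meas: "borel_measurable N = (borel_measurable G :: ('a \<Rightarrow> 'b) set)"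
    unfolding N by (intro measurable_cong_sets sets_restr_to_subalg[OF G] refl)
  show "u \<in> Lspace M G r" if u: "u \<in> Lspace N N r" "0 < r"
    using u(2)
  proof (cases rule: Lspace_cases)
    case (finite s)
    then show ?thesis
      using u integrable_from_subalg[OF G, folded N, of "\<lambda>\<omega>. norm (u \<omega>) powr s"]
      by (simp add: Lspace_ennreal meas)
  next
    case top
    then obtain c where "AE \<omega> in N. norm (u \<omega>) \<le> c" using u by (auto simp: Lspace_def)
    then have "AE \<omega> in M. norm (u \<omega>) \<le> c" unfolding N by (rule AE_restr_to_subalg[OF G])
    then show ?thesis using u top by (auto simp: Lspace_def meas)
  qed
  show "u \<in> Lspace N N (ennreal p)" if u: "u \<in> Lspace M G (ennreal p)"
  proof -
    have u': "u \<in> borel_measurable G" "integrable M (\<lambda>\<omega>. norm (u \<omega>) powr p)"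
      using u p0 by (simp_all add: Lspace_ennreal)
    have "(\<lambda>\<omega>. norm (u \<omega>) powr p) \<in> borel_measurable G"
      using u'(1) by measurable
    then have "integrable N (\<lambda>\<omega>. norm (u \<omega>) powr p)"
      unfolding N by (rule integrable_in_subalg[OF G _ u'(2)])
    then show ?thesis using u'(1) p0 by (simp add: Lspace_ennreal meas)
  qed
qed

text \<open>
  Processes with a single nonzero scalar coordinate \<open>(t, i)\<close> form a copy of the scalar \<open>L\<^sub>p\<close> space over
  \<open>Filt t\<close>. Applying the representation on the measure restricted to \<open>Filt t\<close> makes the density adapted.
\<close>

lemma ex_adapted_density:
  fixes l :: "('a \<Rightarrow> (real^'n, 't) vec) \<Rightarrow> real"
  assumes add: "\<And>x y. x \<in> X \<Longrightarrow> y \<in> X \<Longrightarrow> l (\<lambda>\<omega>. x \<omega> + y \<omega>) = l x + l y"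
    and scale: "\<And>x c. x \<in> X \<Longrightarrow> l (\<lambda>\<omega>. c *\<^sub>R x \<omega>) = c * l x"
    and le: "\<And>x. x \<in> X \<Longrightarrow> l x \<le> lp_norm M p x"
  shows "\<exists>g\<in>Lspace M (Filt t) q. \<forall>u\<in>Lspace M (Filt t) (ennreal p).
    l (\<lambda>\<omega>. axis t (axis i (u \<omega>))) = (\<integral>\<omega>. g \<omega> * u \<omega> \<partial>M)"
proof -
  define N where "N = restr_to_subalg M (Filt t)"
  define E :: "('a \<Rightarrow> real) \<Rightarrow> 'a \<Rightarrow> (real^'n, 't) vec" where "E u \<omega> = axis t (axis i (u \<omega>))" for u \<omega>
  note to_N = Lspace_restr_finite[OF subalg N_def]
  note from_N = Lspace_restr_subset[OF subalg N_def]
  have E_mem: "E u \<in> X" if "u \<in> Lspace M (Filt t) (ennreal p)" for u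
  proof -
    have "(\<lambda>\<omega>. E u \<omega> $ s) \<in> Lspace M (Filt s) (ennreal p)" for s
    proof (cases "s = t")
      case True
      then show ?thesis
        using Lspace_axis[OF subalg p0(2) that] by (simp add: E_def axis_def)
    next
      case False
      then have "(\<lambda>\<omega>. E u \<omega> $ s) = 0" by (simp add: E_def axis_def fun_eq_iff)
      then show ?thesis using subspace_0[OF subspace_Lspace[OF subalg p0(2)]] by simp
    qed
    then show ?thesis by (simp add: procs_def)
  qed
  have E_norm: "lp_norm M p (E u) = lp_norm N p u" if "u \<in> Lspace M (Filt t) (ennreal p)" for u
  proof -
    have "(\<lambda>\<omega>. norm (u \<omega>) powr p) \<in> borel_measurable (Filt t)"
      using Lspace_measurable[OF that] by measurable
    from integral_subalgebra2[OF subalg this] show ?thesis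
      by (simp add: lp_norm_def E_def norm_axis N_def)
  qed
  have "finite_measure N"
    unfolding N_def by (rule finite_measure_restr_to_subalg[OF subalg finite_measure_axioms])
  then interpret N: Lp_functional N p "\<lambda>u. l (E u)"
  proof (intro Lp_functional.intro Lp_functional_axioms.intro p1)
    fix u :: "'a \<Rightarrow> real" assume u: "u \<in> Lspace N N (ennreal p)"
    note u' = from_N[OF u p0(2)]
    show "l (E (\<lambda>\<omega>. u \<omega> + v \<omega>)) = l (E u) + l (E v)" if v: "v \<in> Lspace N N (ennreal p)" for v
    proof -
      have "E (\<lambda>\<omega>. u \<omega> + v \<omega>) = (\<lambda>\<omega>. E u \<omega> + E v \<omega>)"
        by (auto simp: E_def fun_eq_iff vec_eq_iff axis_def)
      then show ?thesis using add E_mem u' from_N[OF v p0(2)] by simp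
    qed
    show "l (E (\<lambda>\<omega>. c * u \<omega>)) = c * l (E u)" for c
    proof -
      have "E (\<lambda>\<omega>. c * u \<omega>) = (\<lambda>\<omega>. c *\<^sub>R E u \<omega>)"
        by (auto simp: E_def fun_eq_iff vec_eq_iff axis_def)
      then show ?thesis using scale E_mem u' by simp
    qed
    show "l (E u) \<le> lp_norm N p u"
      using le[OF E_mem[OF u']] E_norm[OF u'] by simp
  qed
  obtain g where g: "g \<in> Lspace N N q"
      "\<And>u. u \<in> Lspace N N (ennreal p) \<Longrightarrow> l (E u) = (\<integral>\<omega>. g \<omega> * u \<omega> \<partial>N)"
    using N.ex_representation[OF conj] by blast
  have g': "g \<in> Lspace M (Filt t) q" by (rule from_N[OF g(1) q0])
  have "l (E u) = (\<integral>\<omega>. g \<omega> * u \<omega> \<partial>M)" if u: "u \<in> Lspace M (Filt t) (ennreal p)" for u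
  proof -
    have "(\<lambda>\<omega>. g \<omega> * u \<omega>) \<in> borel_measurable (Filt t)"
      using Lspace_measurable[OF u] Lspace_measurable[OF g'] by measurable
    from integral_subalgebra2[OF subalg this] show ?thesis
      using g(2)[OF to_N[OF u]] by (simp add: N_def)
  qed
  then show ?thesis using g' by (auto simp: E_def[abs_def])
qed

text \<open>
  The dual space of the \<open>L\<^sub>p\<close> processes: a functional is determined by its densities in the
  single coordinates, and these are the coordinates of \<open>\<psi>\<close>.
\<close>

theorem ex_process_representation:
  fixes l :: "('a \<Rightarrow> (real^'n, 't) vec) \<Rightarrow> real"
  assumes add: "\<And>x y. x \<in> X \<Longrightarrow> y \<in> X \<Longrightarrow> l (\<lambda>\<omega>. x \<omega> + y \<omega>) = l x + l y"
    and scale: "\<And>x c. x \<in> X \<Longrightarrow> l (\<lambda>\<omega>. c *\<^sub>R x \<omega>) = c * l x"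
    and le: "\<And>x. x \<in> X \<Longrightarrow> l x \<le> lp_norm M p x"
  shows "\<exists>\<psi>\<in>X'. \<forall>x\<in>X. l x = pairing M \<psi> x"
proof -
  have "\<forall>t i. \<exists>g. g \<in> Lspace M (Filt t) q \<and> (\<forall>u\<in>Lspace M (Filt t) (ennreal p).
      l (\<lambda>\<omega>. axis t (axis i (u \<omega>))) = (\<integral>\<omega>. g \<omega> * u \<omega> \<partial>M))"
    using ex_adapted_density[OF assms] by blast
  then obtain g where g: "\<And>t i. g t i \<in> Lspace M (Filt t) q"
      "\<And>t i u. u \<in> Lspace M (Filt t) (ennreal p) \<Longrightarrow>
        l (\<lambda>\<omega>. axis t (axis i (u \<omega>))) = (\<integral>\<omega>. g t i \<omega> * u \<omega> \<partial>M)"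
    by metis
  define \<psi> :: "'a \<Rightarrow> (real^'n, 't) vec" where "\<psi> \<omega> = (\<chi> t i. g t i \<omega>)" for \<omega>
  have "(\<lambda>\<omega>. \<psi> \<omega> $ t) \<in> Lspace M (Filt t) q" for t
    by (rule Lspace_vecI[OF subalg q0]) (simp add: \<psi>_def g(1))
  then have \<psi>: "\<psi> \<in> X'" by (simp add: procs_def)
  have "l x = pairing M \<psi> x" if x: "x \<in> X" for x
  proof -
    define E :: "'t \<Rightarrow> 'n \<Rightarrow> 'a \<Rightarrow> (real^'n, 't) vec"
      where "E t i \<omega> = axis t (axis i (x \<omega> $ t $ i))" for t i \<omega>
    have xti: "(\<lambda>\<omega>. x \<omega> $ t $ i) \<in> Lspace M (Filt t) (ennreal p)" for t i
      by (rule Lspace_vec_nth[OF subalg p0(2) procsD[OF x]])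
    have E_mem: "E t i \<in> X" for t i
    proof -
      have "(\<lambda>\<omega>. E t i \<omega> $ s) \<in> Lspace M (Filt s) (ennreal p)" for s
      proof (cases "s = t")
        case True
        then show ?thesis
          using Lspace_axis[OF subalg p0(2) xti] by (simp add: E_def axis_def)
      next
        case False
        then have "(\<lambda>\<omega>. E t i \<omega> $ s) = 0" by (simp add: E_def axis_def fun_eq_iff)
        then show ?thesis using subspace_0[OF subspace_Lspace[OF subalg p0(2)]] by simp
      qed
      then show ?thesis by (simp add: procs_def)
    qed
    have l_sum: "l (\<Sum>k\<in>I. f k) = (\<Sum>k\<in>I. l (f k))" if "\<And>k. f k \<in> X" for f :: "'t \<times> 'n \<Rightarrow> _" and I
    proof (induction I rule: infinite_finite_induct)
      case (insert k I)
      have "(\<Sum>k\<in>I. f k) \<in> X" by (intro subspace_sum subspace_procs p0 that)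
      then show ?case
        using insert add[OF that[of k], of "\<Sum>k\<in>I. f k"] by (simp add: plus_fun_def)
    qed (use scale[OF X_closed(4), of 0] in \<open>simp_all add: zero_fun_def\<close>)
    have "x = (\<Sum>(t, i)\<in>UNIV. E t i)"
    proof
      fix \<omega>
      have "x \<omega> = (\<Sum>t\<in>UNIV. axis t (\<Sum>i\<in>UNIV. axis i (x \<omega> $ t $ i)))"
        by (simp flip: vec_eq_sum_axis)
      also have "\<dots> = (\<Sum>t\<in>UNIV. \<Sum>i\<in>UNIV. E t i \<omega>)"
        by (simp add: E_def linear_sum[OF bounded_linear.linear[OF bounded_linear_axis]])
      also have "\<dots> = (\<Sum>(t, i)\<in>UNIV. E t i) \<omega>"
        by (simp add: sum_fun_apply sum.cartesian_product case_prod_unfold flip: UNIV_Times_UNIV)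
      finally show "x \<omega> = (\<Sum>(t, i)\<in>UNIV. E t i) \<omega>" .
    qed
    then have "l x = (\<Sum>(t, i)\<in>UNIV. l (E t i))"
      using l_sum[of "\<lambda>(t, i). E t i" UNIV] E_mem by (simp add: case_prod_unfold)
    also have "\<dots> = (\<Sum>t\<in>UNIV. \<Sum>i\<in>UNIV. l (E t i))"
      by (simp add: sum.cartesian_product flip: UNIV_Times_UNIV)
    also have "\<dots> = (\<Sum>t\<in>UNIV. \<Sum>i\<in>UNIV. \<integral>\<omega>. g t i \<omega> * (x \<omega> $ t $ i) \<partial>M)"
      using g(2)[OF xti] by (simp add: E_def[abs_def])
    also have "\<dots> = pairing M \<psi> x"
    proof -
      have "integrable M (\<lambda>\<omega>. g t i \<omega> * (x \<omega> $ t $ i))" for t i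
        using integrable_inner_conjugate[OF p1 conj Lspace_mono_algebra[OF subalg g(1)]
            Lspace_mono_algebra[OF subalg xti]] by simp
      then show ?thesis by (simp add: pairing_def inner_vec_def \<psi>_def)
    qed
    finally show ?thesis .
  qed
  then show ?thesis using \<psi> by blast
qed

end

section \<open>Causal operators\<close>

text \<open>
  A continuously differentiable function is strictly differentiable: the base point of the difference
  quotient may move. Near \<open>\<xi>\<close> the derivative differs from \<open>g' \<xi>\<close> by at most \<open>d\<close>, and the mean value
  inequality transfers this to the increments of \<open>g\<close>.
\<close>

lemma strict_derivative_along_sequences:
  fixes g :: "'v::real_normed_vector \<Rightarrow> 'w::real_normed_vector"
  assumes der: "\<And>\<xi>. (g has_derivative blinfun_apply (g' \<xi>)) (at \<xi>)"
    and cont: "continuous_on UNIV g'"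
    and z: "z \<longlonglongrightarrow> \<xi>" and \<tau>: "\<tau> \<longlonglongrightarrow> (0::real)" "\<And>n. \<tau> n \<noteq> 0"
  shows "(\<lambda>n. (g (z n + \<tau> n *\<^sub>R h) - g (z n)) /\<^sub>R \<tau> n) \<longlonglongrightarrow> blinfun_apply (g' \<xi>) h"
proof (rule LIM_zero_cancel, rule tendstoI)
  fix e :: real assume e: "0 < e"
  \<comment> \<open>The summand 1 covers the case that h vanishes and makes the final estimate strict.\<close>
  define d where "d = e / (norm h + 1)"
  have h1: "0 < norm h + 1" by (simp add: add_nonneg_pos)
  have d: "0 < d" using e h1 by (simp add: d_def)
  have "isCont g' \<xi>" using cont by (simp add: continuous_on_eq_continuous_at)
  then obtain r where r: "0 < r" "\<And>\<zeta>. dist \<zeta> \<xi> < r \<Longrightarrow> dist (g' \<zeta>) (g' \<xi>) < d"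
    using d unfolding continuous_at_eps_delta by blast
  have "(\<lambda>n. z n + \<tau> n *\<^sub>R h) \<longlonglongrightarrow> \<xi> + 0 *\<^sub>R h"
    by (intro tendsto_intros z \<tau>)
  then have "\<forall>\<^sub>F n in sequentially. dist (z n + \<tau> n *\<^sub>R h) \<xi> < r"
    using r(1) by (intro tendstoD) auto
  moreover have "\<forall>\<^sub>F n in sequentially. dist (z n) \<xi> < r"
    using r(1) z by (intro tendstoD)
  ultimately show "\<forall>\<^sub>F n in sequentially.
      dist ((g (z n + \<tau> n *\<^sub>R h) - g (z n)) /\<^sub>R \<tau> n - blinfun_apply (g' \<xi>) h) 0 < e"
  proof eventually_elim
    case (elim n)
    define b where "b = z n + \<tau> n *\<^sub>R h"
    have "norm (g b - g (z n) - blinfun_apply (g' \<xi>) (b - z n)) \<le> norm (b - z n) * d"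
    proof (rule differentiable_bound_linearization[where S="ball \<xi> r"])
      fix t :: real assume "t \<in> {0..1}"
      then have "(1 - t) *\<^sub>R z n + t *\<^sub>R b \<in> ball \<xi> r"
        using elim by (intro convexD_alt) (auto simp: b_def dist_commute)
      then show "z n + t *\<^sub>R (b - z n) \<in> ball \<xi> r" by (simp add: algebra_simps)
    next
      show "(g has_derivative blinfun_apply (g' \<zeta>)) (at \<zeta> within ball \<xi> r)" for \<zeta>
        by (rule has_derivative_at_withinI[OF der])
    next
      fix \<zeta> assume "\<zeta> \<in> ball \<xi> r"
      then have "norm (g' \<zeta> - g' \<xi>) \<le> d"
        using r(2)[of \<zeta>] by (simp add: dist_norm norm_minus_commute less_imp_le)
      then show "onorm (blinfun_apply (g' \<zeta>) - blinfun_apply (g' \<xi>)) \<le> d"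
        by (simp add: norm_blinfun.rep_eq minus_blinfun.rep_eq fun_diff_def)
    qed (use r(1) in simp)
    then have "norm (g b - g (z n) - \<tau> n *\<^sub>R blinfun_apply (g' \<xi>) h) \<le> \<bar>\<tau> n\<bar> * norm h * d"
      by (simp add: b_def blinfun.scaleR_right)
    then have "inverse \<bar>\<tau> n\<bar> * norm (g b - g (z n) - \<tau> n *\<^sub>R blinfun_apply (g' \<xi>) h) \<le> norm h * d"
      using \<tau>(2)[of n] by (simp add: field_simps)
    moreover have "(g b - g (z n)) /\<^sub>R \<tau> n - blinfun_apply (g' \<xi>) h =
        inverse (\<tau> n) *\<^sub>R (g b - g (z n) - \<tau> n *\<^sub>R blinfun_apply (g' \<xi>) h)"
      using \<tau>(2)[of n] by (simp add: scaleR_diff_right)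
    ultimately have "norm ((g b - g (z n)) /\<^sub>R \<tau> n - blinfun_apply (g' \<xi>) h) \<le> norm h * d"
      by simp
    also have "\<dots> < (norm h + 1) * d" using d by simp
    also have "\<dots> = e" using h1 by (simp add: d_def)
    finally show ?case by (simp add: b_def)
  qed
qed

lemma norm_vec_le_card:
  fixes v :: "'b::real_normed_vector ^ 'n"
  assumes "\<And>i. norm (v $ i) \<le> B"
  shows "norm v \<le> real CARD('n) * B"
proof -
  have "norm v \<le> (\<Sum>i\<in>UNIV. norm (v $ i))"
    unfolding norm_vec_def by (rule L2_set_le_sum) simp
  also have "\<dots> \<le> real CARD('n) * B" using assms by (intro sum_bounded_above) auto
  finally show ?thesis .
qed

locale causal_operator = dual_exponents M Filt p q
  for M :: "'a measure" and Filt :: "'t::{finite,linorder} \<Rightarrow> 'a measure"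
    and p :: real and q :: ennreal +
  fixes F :: "('a \<Rightarrow> (real^'n, 't) vec) \<Rightarrow> 'a \<Rightarrow> (real^'m, 't) vec"
    and f :: "'t \<Rightarrow> (real^'n, 't) vec \<Rightarrow> 'a \<Rightarrow> real^'m"
    and f' :: "'t \<Rightarrow> (real^'n, 't) vec \<Rightarrow> 'a \<Rightarrow> (real^'n, 't) vec \<Rightarrow>\<^sub>L (real^'m)"
  assumes causal: "causal_by M Filt p F f" and smooth: "assumption1 M Filt p f f'"
begin

lemma F_mem: "x \<in> X \<Longrightarrow> F x \<in> X"
  using causal by (auto simp: causal_by_def)

lemma F_nth: "x \<in> X \<Longrightarrow> \<omega> \<in> space M \<Longrightarrow> F x \<omega> $ t = f t (x \<omega>) \<omega>"
  using causal by (auto simp: causal_by_def)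

text \<open>
  Collects the almost sure requirements on \<open>f\<close>, so that pointwise arguments can be carried out on one set
  of full measure.
\<close>

definition regular_at :: "real \<Rightarrow> 'a \<Rightarrow> bool" where
  "regular_at C \<omega> \<longleftrightarrow> \<omega> \<in> space M \<and> (\<forall>t.
     (\<forall>\<xi>. ((\<lambda>\<zeta>. f t \<zeta> \<omega>) has_derivative blinfun_apply (f' t \<xi> \<omega>)) (at \<xi>)) \<and>
     continuous_on UNIV (\<lambda>\<xi>. f' t \<xi> \<omega>) \<and> (\<forall>\<xi>. norm (f' t \<xi> \<omega>) \<le> C))"

lemma ex_regular: "\<exists>C\<ge>0. AE \<omega> in M. regular_at C \<omega>"
proof -
  obtain C where C: "\<And>t. AE \<omega> in M. \<forall>\<xi>. norm (f' t \<xi> \<omega>) \<le> C"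
    using smooth by (auto simp: assumption1_def)
  have *: "AE \<omega> in M. (\<forall>\<xi>. ((\<lambda>\<zeta>. f t \<zeta> \<omega>) has_derivative blinfun_apply (f' t \<xi> \<omega>)) (at \<xi>)) \<and>
        continuous_on UNIV (\<lambda>\<xi>. f' t \<xi> \<omega>)" for t
    using smooth by (auto simp: assumption1_def)
  have "AE \<omega> in M. (\<forall>\<xi>. ((\<lambda>\<zeta>. f t \<zeta> \<omega>) has_derivative blinfun_apply (f' t \<xi> \<omega>)) (at \<xi>)) \<and>
      continuous_on UNIV (\<lambda>\<xi>. f' t \<xi> \<omega>) \<and> (\<forall>\<xi>. norm (f' t \<xi> \<omega>) \<le> \<bar>C\<bar>)" for t
    using C[of t] *[of t] by eventually_elim (meson abs_ge_self order_trans)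
  then have "AE \<omega> in M. \<forall>t. (\<forall>\<xi>. ((\<lambda>\<zeta>. f t \<zeta> \<omega>) has_derivative blinfun_apply (f' t \<xi> \<omega>)) (at \<xi>)) \<and>
      continuous_on UNIV (\<lambda>\<xi>. f' t \<xi> \<omega>) \<and> (\<forall>\<xi>. norm (f' t \<xi> \<omega>) \<le> \<bar>C\<bar>)"
    by (rule eventually_all_finite)
  with AE_space have "AE \<omega> in M. regular_at \<bar>C\<bar> \<omega>"
    by eventually_elim (simp add: regular_at_def)
  then show ?thesis by (intro exI[of _ "\<bar>C\<bar>"]) simp
qed

lemma F_pointwise_Lipschitz:
  assumes \<omega>: "regular_at C \<omega>" and x: "x \<in> X" "y \<in> X"
  shows "norm (F x \<omega> - F y \<omega>) \<le> real CARD('t) * C * norm (x \<omega> - y \<omega>)"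
proof -
  have "norm ((F x \<omega> - F y \<omega>) $ t) \<le> C * norm (x \<omega> - y \<omega>)" for t
  proof -
    have "norm (f t (x \<omega>) \<omega> - f t (y \<omega>) \<omega>) \<le> C * norm (x \<omega> - y \<omega>)"
      using \<omega> by (intro differentiable_bound[where S=UNIV and f'="\<lambda>\<xi>. blinfun_apply (f' t \<xi> \<omega>)"])
        (auto simp: regular_at_def norm_blinfun.rep_eq)
    then show ?thesis using F_nth x \<omega> by (simp add: regular_at_def)
  qed
  from norm_vec_le_card[OF this] show ?thesis by (simp add: mult.assoc)
qed

lemma F_Lipschitz: "\<exists>K\<ge>0. \<forall>x\<in>X. \<forall>y\<in>X. lp_norm M p (\<lambda>\<omega>. F x \<omega> - F y \<omega>) \<le> K * lp_norm M p (\<lambda>\<omega>. x \<omega> - y \<omega>)"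
proof -
  obtain C where C: "0 \<le> C" "AE \<omega> in M. regular_at C \<omega>" using ex_regular by blast
  define K where "K = real CARD('t) * C"
  have K: "0 \<le> K" using C(1) by (simp add: K_def)
  have "lp_norm M p (\<lambda>\<omega>. F x \<omega> - F y \<omega>) \<le> K * lp_norm M p (\<lambda>\<omega>. x \<omega> - y \<omega>)"
    if x: "x \<in> X" "y \<in> X" for x y
  proof -
    have "lp_norm M p (\<lambda>\<omega>. F x \<omega> - F y \<omega>) \<le> lp_norm M p (\<lambda>\<omega>. K *\<^sub>R (x \<omega> - y \<omega>))"
    proof (rule lp_norm_mono[OF p0(1) procs_Lspace[OF p0(2)]])
      show "AE \<omega> in M. norm (F x \<omega> - F y \<omega>) \<le> norm (K *\<^sub>R (x \<omega> - y \<omega>))"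
        using C(2) by eventually_elim (use F_pointwise_Lipschitz[OF _ x] K in \<open>simp add: K_def\<close>)
    qed (intro X_closed x procs_measurable[OF p0(2)] F_mem)+
    then show ?thesis using K by (simp add: lp_norm_scaleR[OF p0(1)])
  qed
  then show ?thesis using K by blast
qed

definition diff_quotient :: "('a \<Rightarrow> (real^'n, 't) vec) \<Rightarrow> ('a \<Rightarrow> (real^'n, 't) vec) \<Rightarrow> real \<Rightarrow> 'a \<Rightarrow> (real^'m, 't) vec" where
  "diff_quotient x h \<tau> \<omega> = (F (\<lambda>\<omega>. x \<omega> + \<tau> *\<^sub>R h \<omega>) \<omega> - F x \<omega>) /\<^sub>R \<tau>"

text \<open>
  Almost surely, \<open>dF x h \<omega> $ t\<close> is \<open>f' t (x \<omega>) \<omega> (h \<omega>)\<close>. The latter need not be measurable with respect to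
  \<open>Filt t\<close>, as it is related to \<open>f\<close> only outside a null set, which need not belong to \<open>Filt t\<close>. A pointwise
  limit of adapted difference quotients, with the arbitrary value of \<open>lim\<close> where they diverge,
  is adapted everywhere.
\<close>

definition dF :: "('a \<Rightarrow> (real^'n, 't) vec) \<Rightarrow> ('a \<Rightarrow> (real^'n, 't) vec) \<Rightarrow> 'a \<Rightarrow> (real^'m, 't) vec" where
  "dF x h \<omega> = (\<chi> t. lim (\<lambda>n. diff_quotient x h (inverse (real (Suc n))) \<omega> $ t))"

lemma diff_quotient_mem:
  assumes "x \<in> X" "h \<in> X"
  shows "diff_quotient x h \<tau> \<in> X"
  unfolding diff_quotient_def[abs_def] by (intro X_closed F_mem assms)

lemma diff_quotient_bound:
  assumes \<omega>: "regular_at C \<omega>" and x: "x \<in> X" "h \<in> X"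
  shows "norm (diff_quotient x h \<tau> \<omega>) \<le> real CARD('t) * C * norm (h \<omega>)"
proof (cases "\<tau> = 0")
  case True
  have "0 \<le> C" using \<omega> unfolding regular_at_def by (meson norm_ge_zero order_trans)
  then show ?thesis using True by (simp add: diff_quotient_def)
next
  case False
  have "norm (F (\<lambda>\<omega>. x \<omega> + \<tau> *\<^sub>R h \<omega>) \<omega> - F x \<omega>) \<le> real CARD('t) * C * norm (\<tau> *\<^sub>R h \<omega>)"
    using F_pointwise_Lipschitz[OF \<omega>, of "\<lambda>\<omega>. x \<omega> + \<tau> *\<^sub>R h \<omega>" x] x by (simp add: X_closed)
  then have "inverse \<bar>\<tau>\<bar> * norm (F (\<lambda>\<omega>. x \<omega> + \<tau> *\<^sub>R h \<omega>) \<omega> - F x \<omega>) \<le>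
      inverse \<bar>\<tau>\<bar> * (real CARD('t) * C * norm (\<tau> *\<^sub>R h \<omega>))"
    by (rule mult_left_mono) simp
  also have "\<dots> = real CARD('t) * C * norm (h \<omega>)" using False by simp
  finally show ?thesis by (simp add: diff_quotient_def)
qed

lemma diff_quotient_limit:
  assumes \<omega>: "regular_at C \<omega>" and mem: "\<And>n. z n \<in> X" "h \<in> X"
    and z: "(\<lambda>n. z n \<omega>) \<longlonglongrightarrow> x \<omega>" and \<tau>: "\<tau> \<longlonglongrightarrow> 0" "\<And>n. \<tau> n \<noteq> 0"
  shows "(\<lambda>n. diff_quotient (z n) h (\<tau> n) \<omega> $ t) \<longlonglongrightarrow> f' t (x \<omega>) \<omega> (h \<omega>)"
proof -
  have "diff_quotient (z n) h (\<tau> n) \<omega> $ t = (f t (z n \<omega> + \<tau> n *\<^sub>R h \<omega>) \<omega> - f t (z n \<omega>) \<omega>) /\<^sub>R \<tau> n" for n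
    using \<omega> mem by (simp add: diff_quotient_def regular_at_def F_nth X_closed)
  then show ?thesis
    using strict_derivative_along_sequences[OF _ _ z \<tau>, where g="\<lambda>\<zeta>. f t \<zeta> \<omega>" and g'="\<lambda>\<xi>. f' t \<xi> \<omega>"] \<omega>
    by (simp add: regular_at_def)
qed

lemma dF_nth:
  assumes \<omega>: "regular_at C \<omega>" and x: "x \<in> X" "h \<in> X"
  shows "dF x h \<omega> $ t = f' t (x \<omega>) \<omega> (h \<omega>)"
proof -
  have "(\<lambda>n. diff_quotient x h (inverse (real (Suc n))) \<omega> $ t) \<longlonglongrightarrow> f' t (x \<omega>) \<omega> (h \<omega>)"
    by (rule diff_quotient_limit[OF \<omega>, where z="\<lambda>_. x"])
      (use x LIMSEQ_inverse_real_of_nat in auto)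
  then show ?thesis by (simp add: dF_def limI)
qed

lemma dF_bound:
  assumes \<omega>: "regular_at C \<omega>" and x: "x \<in> X" "h \<in> X"
  shows "norm (dF x h \<omega>) \<le> real CARD('t) * C * norm (h \<omega>)"
proof -
  have "norm (dF x h \<omega> $ t) \<le> C * norm (h \<omega>)" for t
  proof -
    have "norm (f' t (x \<omega>) \<omega> (h \<omega>)) \<le> norm (f' t (x \<omega>) \<omega>) * norm (h \<omega>)" by (rule norm_blinfun)
    also have "\<dots> \<le> C * norm (h \<omega>)" using \<omega> by (intro mult_right_mono) (auto simp: regular_at_def)
    finally show ?thesis by (simp add: dF_nth[OF assms])
  qed
  from norm_vec_le_card[OF this] show ?thesis by (simp add: mult.assoc)
qed

lemma dF_mem:
  assumes x: "x \<in> X" "h \<in> X"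
  shows "dF x h \<in> X"
proof -
  obtain C where C: "0 \<le> C" "AE \<omega> in M. regular_at C \<omega>" using ex_regular by blast
  have "(\<lambda>\<omega>. dF x h \<omega> $ t) \<in> Lspace M (Filt t) (ennreal p)" for t
  proof (rule Lspace_dominated[OF subalg p0(2) procs_Lspace[OF p0(2) x(2)]])
    have "(\<lambda>\<omega>. diff_quotient x h (inverse (real (Suc n))) \<omega> $ t) \<in> borel_measurable (Filt t)" for n
      by (rule Lspace_measurable[OF procsD[OF diff_quotient_mem[OF x]]])
    then show "(\<lambda>\<omega>. dF x h \<omega> $ t) \<in> borel_measurable (Filt t)"
      unfolding dF_def by (simp add: borel_measurable_lim_metric)
    show "AE \<omega> in M. norm (dF x h \<omega> $ t) \<le> real CARD('t) * C * norm (h \<omega>)"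
      using C(2)
      by eventually_elim (rule order_trans[OF Finite_Cartesian_Product.norm_nth_le dF_bound[OF _ x]])
  qed
  then show ?thesis by (simp add: procs_def)
qed

text \<open>
  Nemytskii operators between \<open>L\<^sub>p\<close> spaces are in general not Frechet differentiable. For a
  fixed direction \<open>h\<close>, however, all difference quotients are dominated by a multiple of \<open>norm h\<close>,
  so pointwise strict differentiability passes to \<open>L\<^sub>p\<close> by dominated convergence.
\<close>

lemma strict_derivative_sequentially:
  assumes z: "\<And>n. z n \<in> X" "AE \<omega> in M. (\<lambda>n. z n \<omega>) \<longlonglongrightarrow> x \<omega>"
    and x: "x \<in> X" "h \<in> X" and \<tau>: "\<tau> \<longlonglongrightarrow> 0" "\<And>n. \<tau> n \<noteq> 0"
  shows "(\<lambda>n. lp_norm M p (\<lambda>\<omega>. diff_quotient (z n) h (\<tau> n) \<omega> - dF x h \<omega>)) \<longlonglongrightarrow> 0"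
proof -
  obtain C where C: "0 \<le> C" "AE \<omega> in M. regular_at C \<omega>" using ex_regular by blast
  show ?thesis
  proof (rule lp_norm_dominated_convergence[OF p0(1) procs_Lspace[OF p0(2) x(2)]])
    show "(\<lambda>\<omega>. diff_quotient (z n) h (\<tau> n) \<omega> - dF x h \<omega>) \<in> borel_measurable M" for n
      by (intro procs_measurable[OF p0(2)] X_closed diff_quotient_mem dF_mem x z)
    show "AE \<omega> in M. norm (diff_quotient (z n) h (\<tau> n) \<omega> - dF x h \<omega>) \<le>
        (2 * (real CARD('t) * C)) * norm (h \<omega>)" for n
      using C(2)
    proof eventually_elim
      case (elim \<omega>)
      show ?case
        using norm_triangle_ineq4[of "diff_quotient (z n) h (\<tau> n) \<omega>" "dF x h \<omega>"]
          diff_quotient_bound[OF elim z(1) x(2), of n "\<tau> n"] dF_bound[OF elim x] by simp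
    qed
    show "AE \<omega> in M. (\<lambda>n. diff_quotient (z n) h (\<tau> n) \<omega> - dF x h \<omega>) \<longlonglongrightarrow> 0"
      using C(2) z(2)
    proof eventually_elim
      case (elim \<omega>)
      have "(\<lambda>n. diff_quotient (z n) h (\<tau> n) \<omega>) \<longlonglongrightarrow> dF x h \<omega>"
      proof (rule vec_tendstoI)
        show "(\<lambda>n. diff_quotient (z n) h (\<tau> n) \<omega> $ t) \<longlonglongrightarrow> dF x h \<omega> $ t" for t
          unfolding dF_nth[OF elim(1) x]
          by (rule diff_quotient_limit[where z=z and x=x and \<tau>=\<tau> and h=h,
                OF elim(1) z(1) x(2) elim(2) \<tau>])
      qed
      then show ?case by (rule LIM_zero)
    qed
  qed
qed

lemma dF_is_derivative:
  assumes x: "x \<in> X"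
  shows "has_gateaux_derivative M Filt p F (dF x) x"
proof -
  obtain C where C: "0 \<le> C" "AE \<omega> in M. regular_at C \<omega>" using ex_regular by blast
  have "AE \<omega> in M. dF x (\<lambda>\<omega>. a *\<^sub>R h \<omega> + b *\<^sub>R k \<omega>) \<omega> = a *\<^sub>R dF x h \<omega> + b *\<^sub>R dF x k \<omega>"
    if hk: "h \<in> X" "k \<in> X" for h k a b
    using C(2)
  proof eventually_elim
    case (elim \<omega>)
    have "(\<lambda>\<omega>. a *\<^sub>R h \<omega> + b *\<^sub>R k \<omega>) \<in> X" by (intro X_closed hk)
    then show ?case
      using hk by (simp add: vec_eq_iff dF_nth[OF elim x] blinfun.add_right blinfun.scaleR_right)
  qed
  moreover have "\<exists>K. \<forall>h\<in>X. lp_norm M p (dF x h) \<le> K * lp_norm M p h"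
  proof (intro exI ballI)
    fix h :: "'a \<Rightarrow> (real^'n, 't) vec" assume h: "h \<in> X"
    define K where "K = real CARD('t) * C"
    have K: "0 \<le> K" using C(1) by (simp add: K_def)
    have "lp_norm M p (dF x h) \<le> lp_norm M p (\<lambda>\<omega>. K *\<^sub>R h \<omega>)"
    proof (rule lp_norm_mono[OF p0(1) procs_Lspace[OF p0(2)]])
      show "AE \<omega> in M. norm (dF x h \<omega>) \<le> norm (K *\<^sub>R h \<omega>)"
        using C(2) by eventually_elim (use dF_bound[OF _ x h] K in \<open>simp add: K_def\<close>)
    qed (intro X_closed h x procs_measurable[OF p0(2)] dF_mem)+
    then show "lp_norm M p (dF x h) \<le> (real CARD('t) * C) * lp_norm M p h"
      using K by (simp add: lp_norm_scaleR[OF p0(1)] K_def)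
  qed
  moreover have "((\<lambda>\<tau>. lp_norm M p (\<lambda>\<omega>. diff_quotient x h \<tau> \<omega> - dF x h \<omega>)) \<longlongrightarrow> 0) (at 0)" if h: "h \<in> X" for h
    unfolding tendsto_at_iff_sequentially comp_def
  proof (intro allI impI)
    fix \<tau> :: "nat \<Rightarrow> real" assume "\<forall>n. \<tau> n \<in> UNIV - {0}" "\<tau> \<longlonglongrightarrow> 0"
    then show "(\<lambda>n. lp_norm M p (\<lambda>\<omega>. diff_quotient x h (\<tau> n) \<omega> - dF x h \<omega>)) \<longlonglongrightarrow> 0"
      by (intro strict_derivative_sequentially[where z="\<lambda>_. x"] x h) auto
  qed
  ultimately show ?thesis
    using dF_mem[OF x] by (simp add: has_gateaux_derivative_def diff_quotient_def)
qed

lemma gateaux_derivative_mem: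
  assumes "has_gateaux_derivative M Filt p F A x" "h \<in> X"
  shows "A h \<in> X"
  using assms by (auto simp: has_gateaux_derivative_def)

text \<open>
  An arbitrary version of the derivative may replace \<open>dF x\<close>: both are limits of the same quotients.
\<close>

lemma gateaux_derivative_unique:
  assumes A: "has_gateaux_derivative M Filt p F A x" and x: "x \<in> X" and h: "h \<in> X"
  shows "lp_norm M p (\<lambda>\<omega>. dF x h \<omega> - A h \<omega>) = 0"
proof -
  note dF = dF_is_derivative[OF x]
  have lim: "((\<lambda>\<tau>. lp_norm M p (\<lambda>\<omega>. diff_quotient x h \<tau> \<omega> - B h \<omega>)) \<longlongrightarrow> 0) (at 0)"
    if "has_gateaux_derivative M Filt p F B x" for B
    using that h by (simp add: has_gateaux_derivative_def diff_quotient_def)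
  have "lp_norm M p (\<lambda>\<omega>. dF x h \<omega> - A h \<omega>) \<le>
      lp_norm M p (\<lambda>\<omega>. diff_quotient x h \<tau> \<omega> - A h \<omega>) + lp_norm M p (\<lambda>\<omega>. diff_quotient x h \<tau> \<omega> - dF x h \<omega>)" for \<tau>
  proof -
    have "lp_norm M p (\<lambda>\<omega>. (diff_quotient x h \<tau> \<omega> - A h \<omega>) + (dF x h \<omega> - diff_quotient x h \<tau> \<omega>)) \<le>
        lp_norm M p (\<lambda>\<omega>. diff_quotient x h \<tau> \<omega> - A h \<omega>) +
        lp_norm M p (\<lambda>\<omega>. dF x h \<omega> - diff_quotient x h \<tau> \<omega>)"
      by (intro lp_norm_triangle X_closed diff_quotient_mem gateaux_derivative_mem[OF A] dF_mem x h)
    then show ?thesis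
      using lp_norm_minus_commute[of M p "dF x h" "diff_quotient x h \<tau>"] by simp
  qed
  then have "lp_norm M p (\<lambda>\<omega>. dF x h \<omega> - A h \<omega>) \<le> 0 + 0"
    by (intro tendsto_lowerbound[OF tendsto_add[OF lim[OF A] lim[OF dF]]]) auto
  then show ?thesis using lp_norm_nonneg[of M p "\<lambda>\<omega>. dF x h \<omega> - A h \<omega>"] by simp
qed

lemma eventually_procs_nhds:
  fixes x :: "'a \<Rightarrow> (real^'k, 't) vec"
  shows "eventually P (procs_nhds M Filt p x) \<longleftrightarrow>
    (\<exists>d>0. \<forall>z\<in>X. lp_norm M p (\<lambda>\<omega>. z \<omega> - x \<omega>) < d \<longrightarrow> P z)"
proof
  assume "eventually P (procs_nhds M Filt p x)"
  then obtain Q where Q: "eventually Q (nhds (0::real))"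
      "\<And>z. Q (lp_norm M p (\<lambda>\<omega>. z \<omega> - x \<omega>)) \<Longrightarrow> z \<in> X \<Longrightarrow> P z"
    unfolding procs_nhds_def eventually_inf_principal eventually_filtercomap by blast
  from Q(1) obtain d where "0 < d" "\<And>r. dist r 0 < d \<Longrightarrow> Q r"
    by (auto simp: eventually_nhds_metric)
  then show "\<exists>d>0. \<forall>z\<in>X. lp_norm M p (\<lambda>\<omega>. z \<omega> - x \<omega>) < d \<longrightarrow> P z"
    using Q(2) by (intro exI[of _ d]) (simp add: abs_of_nonneg[OF lp_norm_nonneg])
next
  assume "\<exists>d>0. \<forall>z\<in>X. lp_norm M p (\<lambda>\<omega>. z \<omega> - x \<omega>) < d \<longrightarrow> P z"
  then obtain d where d: "0 < d" "\<And>z. z \<in> X \<Longrightarrow> lp_norm M p (\<lambda>\<omega>. z \<omega> - x \<omega>) < d \<Longrightarrow> P z" by blast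
  have "eventually (\<lambda>r. r < d) (nhds 0)"
    using d(1) by (rule eventually_nhds_in_open[of "{..<d}" 0, simplified])
  then show "eventually P (procs_nhds M Filt p x)"
    unfolding procs_nhds_def eventually_inf_principal eventually_filtercomap using d(2) by blast
qed

text \<open>
  Strict differentiability in \<open>L\<^sub>p\<close>. A violating sequence \<open>z n\<close> converges to \<open>x\<close> in \<open>L\<^sub>p\<close>, so a
  subsequence converges almost surely, and along it the difference quotients converge.
\<close>

theorem strict_derivative:
  assumes A: "has_gateaux_derivative M Filt p F A x" and x: "x \<in> X" and h: "h \<in> X" and e: "0 < e"
  shows "\<exists>d>0. \<forall>z\<in>X. \<forall>\<tau>. lp_norm M p (\<lambda>\<omega>. z \<omega> - x \<omega>) < d \<longrightarrow> 0 < \<tau> \<longrightarrow> \<tau> < d \<longrightarrow>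
    lp_norm M p (\<lambda>\<omega>. diff_quotient z h \<tau> \<omega> - A h \<omega>) < e"
proof (rule ccontr)
  assume neg: "\<not> ?thesis"
  define bad where "bad d w \<longleftrightarrow> fst w \<in> X \<and> lp_norm M p (\<lambda>\<omega>. fst w \<omega> - x \<omega>) < d \<and> 0 < snd w \<and>
      snd w < d \<and> e \<le> lp_norm M p (\<lambda>\<omega>. diff_quotient (fst w) h (snd w) \<omega> - A h \<omega>)" for d w
  have "\<exists>w. bad d w" if "0 < d" for d
  proof -
    from neg that have "\<not> (\<forall>z\<in>X. \<forall>\<tau>. lp_norm M p (\<lambda>\<omega>. z \<omega> - x \<omega>) < d \<longrightarrow> 0 < \<tau> \<longrightarrow> \<tau> < d \<longrightarrow>
        lp_norm M p (\<lambda>\<omega>. diff_quotient z h \<tau> \<omega> - A h \<omega>) < e)"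
      by blast
    then obtain z \<tau> where "bad d (z, \<tau>)" unfolding bad_def by (auto simp: not_less)
    then show ?thesis by blast
  qed
  then have "\<exists>w. bad (inverse (real (Suc n))) w" for n by simp
  then obtain w where w: "\<And>n. bad (inverse (real (Suc n))) (w n)" by metis
  define z \<tau> where "z n = fst (w n)" and "\<tau> n = snd (w n)" for n
  have z: "z n \<in> X" "lp_norm M p (\<lambda>\<omega>. z n \<omega> - x \<omega>) < inverse (real (Suc n))"
    and \<tau>: "0 < \<tau> n" "\<tau> n < inverse (real (Suc n))"
    and big: "e \<le> lp_norm M p (\<lambda>\<omega>. diff_quotient (z n) h (\<tau> n) \<omega> - A h \<omega>)" for n
    using w[of n] by (simp_all add: bad_def z_def \<tau>_def)
  have "(\<lambda>n. lp_norm M p (\<lambda>\<omega>. z n \<omega> - x \<omega>)) \<longlonglongrightarrow> 0"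
    by (rule tendsto_sandwich[OF _ _ tendsto_const LIMSEQ_inverse_real_of_nat])
      (use z(2) in \<open>auto intro!: always_eventually less_imp_le lp_norm_nonneg\<close>)
  then have "(\<lambda>n. lp_norm M p (\<lambda>\<omega>. z n \<omega> - x \<omega>) powr p) \<longlonglongrightarrow> 0 powr p"
    by (intro tendsto_powr2) (use p0 in \<open>auto intro!: always_eventually lp_norm_nonneg\<close>)
  then have L1: "(\<lambda>n. \<integral>\<omega>. norm (norm (z n \<omega> - x \<omega>) powr p) \<partial>M) \<longlonglongrightarrow> 0"
    using p0 by (simp add: lp_norm_powr)
  have int: "integrable M (\<lambda>\<omega>. norm (z n \<omega> - x \<omega>) powr p)" for n
    using procs_Lspace[OF p0(2) X_closed(2)[OF z(1)[of n] x]] p0 by (simp add: Lspace_ennreal)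
  obtain r where r: "strict_mono r" "AE \<omega> in M. (\<lambda>n. norm (z (r n) \<omega> - x \<omega>) powr p) \<longlonglongrightarrow> 0"
    using tendsto_L1_AE_subseq[OF int L1] by blast
  have z_lim: "AE \<omega> in M. (\<lambda>n. z (r n) \<omega>) \<longlonglongrightarrow> x \<omega>"
    using r(2)
  proof eventually_elim
    case (elim \<omega>)
    then have "(\<lambda>n. (norm (z (r n) \<omega> - x \<omega>) powr p) powr (1 / p)) \<longlonglongrightarrow> 0 powr (1 / p)"
      by (intro tendsto_powr2) (use p0 in auto)
    then have "(\<lambda>n. norm (z (r n) \<omega> - x \<omega>)) \<longlonglongrightarrow> 0" using p0 by (simp add: powr_powr)
    then show ?case by (rule LIM_zero_cancel[OF tendsto_norm_zero_cancel])
  qed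
  have "\<tau> \<longlonglongrightarrow> 0"
  proof (rule tendsto_sandwich[OF _ _ tendsto_const LIMSEQ_inverse_real_of_nat])
    show "\<forall>\<^sub>F n in sequentially. 0 \<le> \<tau> n"
      using \<tau>(1) by (intro always_eventually allI less_imp_le)
    show "\<forall>\<^sub>F n in sequentially. \<tau> n \<le> inverse (real (Suc n))"
      using \<tau>(2) by (intro always_eventually allI less_imp_le)
  qed
  then have \<tau>_lim: "(\<lambda>n. \<tau> (r n)) \<longlonglongrightarrow> 0"
    using LIMSEQ_subseq_LIMSEQ[OF _ r(1)] by (simp add: comp_def)
  have \<tau>_nz: "\<tau> (r n) \<noteq> 0" for n using \<tau>(1)[of "r n"] by simp
  have lim: "(\<lambda>n. lp_norm M p (\<lambda>\<omega>. diff_quotient (z (r n)) h (\<tau> (r n)) \<omega> - dF x h \<omega>)) \<longlonglongrightarrow> 0"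
    by (rule strict_derivative_sequentially[OF z(1) z_lim x h \<tau>_lim \<tau>_nz])
  have "e \<le> lp_norm M p (\<lambda>\<omega>. diff_quotient (z (r n)) h (\<tau> (r n)) \<omega> - dF x h \<omega>)" for n
  proof -
    have "lp_norm M p (\<lambda>\<omega>. (diff_quotient (z (r n)) h (\<tau> (r n)) \<omega> - dF x h \<omega>) + (dF x h \<omega> - A h \<omega>)) \<le>
        lp_norm M p (\<lambda>\<omega>. diff_quotient (z (r n)) h (\<tau> (r n)) \<omega> - dF x h \<omega>) +
        lp_norm M p (\<lambda>\<omega>. dF x h \<omega> - A h \<omega>)"
      by (intro lp_norm_triangle X_closed diff_quotient_mem gateaux_derivative_mem[OF A] dF_mem x h z)
    then show ?thesis using big[of "r n"] gateaux_derivative_unique[OF A x h] by simp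
  qed
  then have "e \<le> 0" by (intro LIMSEQ_le_const[OF lim]) auto
  then show False using e by simp
qed

end

section \<open>The distance to a convex set\<close>

context dual_exponents
begin

lemma lp_dist_le:
  assumes "z \<in> Y"
  shows "lp_dist M p y Y \<le> lp_norm M p (\<lambda>\<omega>. y \<omega> - z \<omega>)"
  unfolding lp_dist_def using assms
  by (intro cINF_lower bdd_belowI[of _ 0]) (auto simp: lp_norm_nonneg)

lemma lp_dist_greatest:
  assumes "Y \<noteq> {}" "\<And>z. z \<in> Y \<Longrightarrow> c \<le> lp_norm M p (\<lambda>\<omega>. y \<omega> - z \<omega>)"
  shows "c \<le> lp_dist M p y Y"
  unfolding lp_dist_def using assms by (rule cINF_greatest)

lemma lp_dist_nonneg: "Y \<noteq> {} \<Longrightarrow> 0 \<le> lp_dist M p y Y"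
  by (rule lp_dist_greatest) (auto simp: lp_norm_nonneg)

lemma lp_dist_member:
  assumes "y \<in> Y"
  shows "lp_dist M p y Y = 0"
proof -
  have "lp_dist M p y Y \<le> 0" using lp_dist_le[OF assms, of y] by (simp add: lp_norm_zero)
  moreover have "0 \<le> lp_dist M p y Y" using assms by (intro lp_dist_nonneg) auto
  ultimately show ?thesis by simp
qed

lemma lp_dist_Lipschitz:
  fixes y w :: "'a \<Rightarrow> (real^'m, 't) vec"
  assumes Y: "Y \<subseteq> X" "Y \<noteq> {}" and y: "y \<in> X" "w \<in> X"
  shows "lp_dist M p y Y \<le> lp_dist M p w Y + lp_norm M p (\<lambda>\<omega>. y \<omega> - w \<omega>)"
proof -
  have "lp_dist M p y Y - lp_norm M p (\<lambda>\<omega>. y \<omega> - w \<omega>) \<le> lp_dist M p w Y"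
  proof (rule lp_dist_greatest[OF Y(2)])
    fix z assume z: "z \<in> Y"
    have "lp_norm M p (\<lambda>\<omega>. (y \<omega> - w \<omega>) + (w \<omega> - z \<omega>)) \<le>
        lp_norm M p (\<lambda>\<omega>. y \<omega> - w \<omega>) + lp_norm M p (\<lambda>\<omega>. w \<omega> - z \<omega>)"
      using z Y(1) by (intro lp_norm_triangle X_closed y) auto
    then show "lp_dist M p y Y - lp_norm M p (\<lambda>\<omega>. y \<omega> - w \<omega>) \<le> lp_norm M p (\<lambda>\<omega>. w \<omega> - z \<omega>)"
      using lp_dist_le[OF z, of y] by simp
  qed
  then show ?thesis by simp
qed

text \<open>
  Near-minimisers \<open>a\<close> for \<open>y\<close> and \<open>b\<close> for \<open>y + k\<close> are combined; the bound is passed to the infimum over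
  \<open>a\<close> and over \<open>b\<close> one after the other.
\<close>

lemma lp_dist_convex:
  fixes y k :: "'a \<Rightarrow> (real^'m, 't) vec"
  assumes Y: "Y \<subseteq> X" "Y \<noteq> {}" "convex_procs Y" and y: "y \<in> X" "k \<in> X" and \<tau>: "0 < \<tau>" "\<tau> < 1"
  shows "lp_dist M p (\<lambda>\<omega>. y \<omega> + \<tau> *\<^sub>R k \<omega>) Y \<le>
    (1 - \<tau>) * lp_dist M p y Y + \<tau> * lp_dist M p (\<lambda>\<omega>. y \<omega> + k \<omega>) Y"
proof -
  let ?D = "lp_dist M p (\<lambda>\<omega>. y \<omega> + \<tau> *\<^sub>R k \<omega>) Y"
  have *: "?D \<le> (1 - \<tau>) * lp_norm M p (\<lambda>\<omega>. y \<omega> - a \<omega>) + \<tau> * lp_norm M p (\<lambda>\<omega>. (y \<omega> + k \<omega>) - b \<omega>)"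
    if a: "a \<in> Y" and b: "b \<in> Y" for a b
  proof -
    have mem: "a \<in> X" "b \<in> X" using a b Y(1) by auto
    have "(\<lambda>\<omega>. (1 - \<tau>) *\<^sub>R a \<omega> + \<tau> *\<^sub>R b \<omega>) \<in> Y"
      using Y(3) a b \<tau> by (simp add: convex_procs_def)
    then have "?D \<le> lp_norm M p (\<lambda>\<omega>. (y \<omega> + \<tau> *\<^sub>R k \<omega>) - ((1 - \<tau>) *\<^sub>R a \<omega> + \<tau> *\<^sub>R b \<omega>))"
      by (rule lp_dist_le)
    also have "(\<lambda>\<omega>. (y \<omega> + \<tau> *\<^sub>R k \<omega>) - ((1 - \<tau>) *\<^sub>R a \<omega> + \<tau> *\<^sub>R b \<omega>)) =
        (\<lambda>\<omega>. (1 - \<tau>) *\<^sub>R (y \<omega> - a \<omega>) + \<tau> *\<^sub>R ((y \<omega> + k \<omega>) - b \<omega>))"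
      by (simp add: algebra_simps)
    also have "lp_norm M p \<dots> \<le> lp_norm M p (\<lambda>\<omega>. (1 - \<tau>) *\<^sub>R (y \<omega> - a \<omega>)) +
        lp_norm M p (\<lambda>\<omega>. \<tau> *\<^sub>R ((y \<omega> + k \<omega>) - b \<omega>))"
      by (intro lp_norm_triangle X_closed y mem)
    finally show ?thesis
      using \<tau> by (simp add: lp_norm_scaleR[OF p0(1)])
  qed
  have "(?D - (1 - \<tau>) * lp_dist M p y Y) / \<tau> \<le> lp_dist M p (\<lambda>\<omega>. y \<omega> + k \<omega>) Y"
  proof (rule lp_dist_greatest[OF Y(2)])
    fix b assume b: "b \<in> Y"
    have "(?D - \<tau> * lp_norm M p (\<lambda>\<omega>. (y \<omega> + k \<omega>) - b \<omega>)) / (1 - \<tau>) \<le> lp_dist M p y Y"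
      by (rule lp_dist_greatest[OF Y(2)]) (use *[OF _ b] \<tau> in \<open>simp add: divide_le_eq algebra_simps\<close>)
    then show "(?D - (1 - \<tau>) * lp_dist M p y Y) / \<tau> \<le> lp_norm M p (\<lambda>\<omega>. (y \<omega> + k \<omega>) - b \<omega>)"
      using \<tau> by (simp add: divide_le_eq algebra_simps)
  qed
  then show ?thesis using \<tau> by (simp add: divide_le_eq algebra_simps)
qed

end

section \<open>The Clarke subdifferential of the distance composed with a causal operator\<close>

context causal_operator
begin

lemma F_increment:
  "\<tau> \<noteq> 0 \<Longrightarrow> F (\<lambda>\<omega>. z \<omega> + \<tau> *\<^sub>R h \<omega>) \<omega> = F z \<omega> + \<tau> *\<^sub>R diff_quotient z h \<tau> \<omega>"
  by (simp add: diff_quotient_def)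

text \<open>
  For \<open>z\<close> near \<open>x\<close>, the increment of the distance along \<open>h\<close> is up to an error of order \<open>o(\<tau>)\<close> its increment
  from \<open>F z\<close> along \<open>A h\<close>. By convexity the slope of the latter over a short step is at most the slope
  over the step of length one, which is Lipschitz in the base point. Only steps of length one are
  needed, since the estimate can be applied to all multiples of \<open>h\<close>.
\<close>

lemma clarke_dderiv_le_dist:
  fixes Y :: "('a \<Rightarrow> (real^'m, 't) vec) set"
  assumes A: "has_gateaux_derivative M Filt p F A x" and x: "x \<in> X" and h: "h \<in> X"
    and Y: "Y \<subseteq> X" "Y \<noteq> {}" "convex_procs Y"
  shows "clarke_dderiv M Filt p (\<lambda>z. lp_dist M p (F z) Y) x h \<le>
    ereal (lp_dist M p (\<lambda>\<omega>. F x \<omega> + A h \<omega>) Y)"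
proof (rule ereal_le_epsilon2)
  fix e :: real assume e: "0 < e"
  obtain K where K: "0 \<le> K" "\<And>u v. u \<in> X \<Longrightarrow> v \<in> X \<Longrightarrow>
      lp_norm M p (\<lambda>\<omega>. F u \<omega> - F v \<omega>) \<le> K * lp_norm M p (\<lambda>\<omega>. u \<omega> - v \<omega>)"
    using F_Lipschitz by blast
  have "0 < e / 2" using e by simp
  from strict_derivative[OF A x h this] obtain d0 where d0: "0 < d0"
      "\<And>z \<tau>. z \<in> X \<Longrightarrow> lp_norm M p (\<lambda>\<omega>. z \<omega> - x \<omega>) < d0 \<Longrightarrow> 0 < \<tau> \<Longrightarrow> \<tau> < d0 \<Longrightarrow>
        lp_norm M p (\<lambda>\<omega>. diff_quotient z h \<tau> \<omega> - A h \<omega>) < e / 2"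
    by blast
  \<comment> \<open>The bound 1 is for convexity along the step, the last one for the Lipschitz error of F.\<close>
  define d where "d = min (min d0 1) (e / (2 * (K + 1)))"
  have d: "0 < d" "d \<le> d0" "d \<le> 1" "d \<le> e / (2 * (K + 1))"
    using d0(1) e K(1) by (auto simp: d_def)
  have quot: "(lp_dist M p (F (\<lambda>\<omega>. z \<omega> + \<tau> *\<^sub>R h \<omega>)) Y - lp_dist M p (F z) Y) / \<tau> \<le>
      lp_dist M p (\<lambda>\<omega>. F x \<omega> + A h \<omega>) Y + e"
    if z: "z \<in> X" "lp_norm M p (\<lambda>\<omega>. z \<omega> - x \<omega>) < d" and \<tau>: "0 < \<tau>" "\<tau> < d" for z \<tau>
  proof -
    note mem = F_mem[OF x] F_mem[OF z(1)] gateaux_derivative_mem[OF A h] diff_quotient_mem[OF z(1) h, of \<tau>]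
    have F_eq: "F (\<lambda>\<omega>. z \<omega> + \<tau> *\<^sub>R h \<omega>) = (\<lambda>\<omega>. F z \<omega> + \<tau> *\<^sub>R diff_quotient z h \<tau> \<omega>)"
      using F_increment \<tau>(1) by auto
    have "lp_dist M p (F (\<lambda>\<omega>. z \<omega> + \<tau> *\<^sub>R h \<omega>)) Y \<le>
        lp_dist M p (\<lambda>\<omega>. F z \<omega> + \<tau> *\<^sub>R A h \<omega>) Y +
        lp_norm M p (\<lambda>\<omega>. (F z \<omega> + \<tau> *\<^sub>R diff_quotient z h \<tau> \<omega>) - (F z \<omega> + \<tau> *\<^sub>R A h \<omega>))"
      unfolding F_eq by (intro lp_dist_Lipschitz[OF Y(1,2)] X_closed mem)
    also have "(\<lambda>\<omega>. (F z \<omega> + \<tau> *\<^sub>R diff_quotient z h \<tau> \<omega>) - (F z \<omega> + \<tau> *\<^sub>R A h \<omega>)) =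
        (\<lambda>\<omega>. \<tau> *\<^sub>R (diff_quotient z h \<tau> \<omega> - A h \<omega>))"
      by (simp add: algebra_simps)
    also have "lp_norm M p \<dots> = \<tau> * lp_norm M p (\<lambda>\<omega>. diff_quotient z h \<tau> \<omega> - A h \<omega>)"
      using \<tau> by (simp only: lp_norm_scaleR[OF p0(1)])
    also have "lp_dist M p (\<lambda>\<omega>. F z \<omega> + \<tau> *\<^sub>R A h \<omega>) Y \<le>
        (1 - \<tau>) * lp_dist M p (F z) Y + \<tau> * lp_dist M p (\<lambda>\<omega>. F z \<omega> + A h \<omega>) Y"
      using \<tau> d(3) by (intro lp_dist_convex[OF Y] mem) auto
    finally have "lp_dist M p (F (\<lambda>\<omega>. z \<omega> + \<tau> *\<^sub>R h \<omega>)) Y - lp_dist M p (F z) Y \<le>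
        \<tau> * (lp_dist M p (\<lambda>\<omega>. F z \<omega> + A h \<omega>) Y - lp_dist M p (F z) Y +
          lp_norm M p (\<lambda>\<omega>. diff_quotient z h \<tau> \<omega> - A h \<omega>))"
      by (simp add: algebra_simps)
    then have "(lp_dist M p (F (\<lambda>\<omega>. z \<omega> + \<tau> *\<^sub>R h \<omega>)) Y - lp_dist M p (F z) Y) / \<tau> \<le>
        lp_dist M p (\<lambda>\<omega>. F z \<omega> + A h \<omega>) Y - lp_dist M p (F z) Y +
          lp_norm M p (\<lambda>\<omega>. diff_quotient z h \<tau> \<omega> - A h \<omega>)"
      using \<tau>(1) by (simp add: pos_divide_le_eq mult.commute)
    also have "\<dots> \<le> lp_dist M p (\<lambda>\<omega>. F z \<omega> + A h \<omega>) Y + e / 2"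
      using d0(2)[OF z(1) _ \<tau>(1)] z(2) \<tau>(2) d(2) lp_dist_nonneg[OF Y(2), of "F z"] by simp
    also have "lp_dist M p (\<lambda>\<omega>. F z \<omega> + A h \<omega>) Y \<le> lp_dist M p (\<lambda>\<omega>. F x \<omega> + A h \<omega>) Y +
        lp_norm M p (\<lambda>\<omega>. (F z \<omega> + A h \<omega>) - (F x \<omega> + A h \<omega>))"
      by (intro lp_dist_Lipschitz[OF Y(1,2)] X_closed mem)
    also have "lp_norm M p (\<lambda>\<omega>. (F z \<omega> + A h \<omega>) - (F x \<omega> + A h \<omega>)) \<le> K * lp_norm M p (\<lambda>\<omega>. z \<omega> - x \<omega>)"
      using K(2)[OF z(1) x] by simp
    also have "\<dots> \<le> (K + 1) * (e / (2 * (K + 1)))"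
      using K(1) z(2) d(4) lp_norm_nonneg[of M p "\<lambda>\<omega>. z \<omega> - x \<omega>"] by (intro mult_mono) auto
    also have "\<dots> = e / 2" using K(1) by (simp add: field_simps)
    finally show ?thesis by simp
  qed
  have "\<forall>\<^sub>F w in procs_nhds M Filt p x \<times>\<^sub>F at_right 0.
      (case w of (z, \<tau>) \<Rightarrow> ereal ((lp_dist M p (F (\<lambda>\<omega>. z \<omega> + \<tau> *\<^sub>R h \<omega>)) Y - lp_dist M p (F z) Y) / \<tau>))
      \<le> ereal (lp_dist M p (\<lambda>\<omega>. F x \<omega> + A h \<omega>) Y) + ereal e"
    unfolding eventually_prod_filter
  proof (intro exI conjI allI impI)
    show "eventually (\<lambda>z. z \<in> X \<and> lp_norm M p (\<lambda>\<omega>. z \<omega> - x \<omega>) < d) (procs_nhds M Filt p x)"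
      unfolding eventually_procs_nhds using d(1) by blast
    show "eventually (\<lambda>\<tau>. 0 < \<tau> \<and> \<tau> < d) (at_right 0)"
      using d(1) by (auto simp: eventually_at_right_field)
  qed (use quot in auto)
  then show "clarke_dderiv M Filt p (\<lambda>z. lp_dist M p (F z) Y) x h \<le>
      ereal (lp_dist M p (\<lambda>\<omega>. F x \<omega> + A h \<omega>) Y) + ereal e"
    unfolding clarke_dderiv_def by (rule Limsup_bounded)
qed

text \<open>
  A multiplier \<open>\<psi>\<close> gives an affine minorant of the distance that is exact at \<open>F x\<close>: for \<open>z\<close> in \<open>Y\<close>,
  \<open>norm (w - z) \<ge> \<langle>\<psi>, w - z\<rangle> \<ge> \<langle>\<psi>, w - F x\<rangle>\<close>. Along the constant base point \<open>x\<close> this minorant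
  has the slope \<open>\<langle>\<psi>, A h\<rangle>\<close> in the limit.
\<close>

lemma pairing_le_clarke_dderiv:
  fixes Y :: "('a \<Rightarrow> (real^'m, 't) vec) set"
  assumes A: "has_gateaux_derivative M Filt p F A x" and x: "x \<in> X" and h: "h \<in> X"
    and Y: "Y \<subseteq> X" "F x \<in> Y"
    and \<psi>: "\<psi> \<in> normal_cone M Filt q Y (F x)" "\<psi> \<in> dual_ball M Filt p q"
  shows "ereal (pairing M \<psi> (A h)) \<le> clarke_dderiv M Filt p (\<lambda>z. lp_dist M p (F z) Y) x h"
  unfolding clarke_dderiv_def Limsup_def
proof (rule INF_greatest)
  have \<psi>X: "\<psi> \<in> X'" using \<psi>(1) by (simp add: normal_cone_def)
  have normal: "pairing M \<psi> (\<lambda>\<omega>. z \<omega> - F x \<omega>) \<le> 0" if "z \<in> Y" for z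
    using \<psi>(1) that by (simp add: normal_cone_def)
  have quot: "pairing M \<psi> (A h) - lp_norm M p (\<lambda>\<omega>. diff_quotient x h \<tau> \<omega> - A h \<omega>) \<le>
      (lp_dist M p (F (\<lambda>\<omega>. x \<omega> + \<tau> *\<^sub>R h \<omega>)) Y - lp_dist M p (F x) Y) / \<tau>" if \<tau>: "0 < \<tau>" for \<tau>
  proof -
    note mem = F_mem[OF x] gateaux_derivative_mem[OF A h] diff_quotient_mem[OF x h, of \<tau>]
    have F_eq: "F (\<lambda>\<omega>. x \<omega> + \<tau> *\<^sub>R h \<omega>) = (\<lambda>\<omega>. F x \<omega> + \<tau> *\<^sub>R diff_quotient x h \<tau> \<omega>)"
      using F_increment \<tau> by auto
    have "\<tau> * pairing M \<psi> (diff_quotient x h \<tau>) \<le> lp_dist M p (F (\<lambda>\<omega>. x \<omega> + \<tau> *\<^sub>R h \<omega>)) Y"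
      unfolding F_eq
    proof (rule lp_dist_greatest)
      fix z assume z: "z \<in> Y"
      then have zX: "z \<in> X" using Y(1) by auto
      have "\<tau> * pairing M \<psi> (diff_quotient x h \<tau>) \<le>
          pairing M \<psi> (\<lambda>\<omega>. \<tau> *\<^sub>R diff_quotient x h \<tau> \<omega>) - pairing M \<psi> (\<lambda>\<omega>. z \<omega> - F x \<omega>)"
        using normal[OF z] by (simp add: pairing_scaleR)
      also have "\<dots> = pairing M \<psi> (\<lambda>\<omega>. \<tau> *\<^sub>R diff_quotient x h \<tau> \<omega> - (z \<omega> - F x \<omega>))"
        by (intro pairing_diff[symmetric] X_closed \<psi>X mem zX)
      also have "\<dots> \<le> lp_norm M p (\<lambda>\<omega>. \<tau> *\<^sub>R diff_quotient x h \<tau> \<omega> - (z \<omega> - F x \<omega>))"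
        by (intro pairing_le_norm[OF \<psi>(2)] X_closed mem zX)
      finally show "\<tau> * pairing M \<psi> (diff_quotient x h \<tau>) \<le>
          lp_norm M p (\<lambda>\<omega>. F x \<omega> + \<tau> *\<^sub>R diff_quotient x h \<tau> \<omega> - z \<omega>)"
        by (simp add: algebra_simps)
    qed (use Y(2) in auto)
    then have "pairing M \<psi> (diff_quotient x h \<tau>) \<le>
        (lp_dist M p (F (\<lambda>\<omega>. x \<omega> + \<tau> *\<^sub>R h \<omega>)) Y - lp_dist M p (F x) Y) / \<tau>"
      using \<tau> by (simp add: lp_dist_member[OF Y(2)] le_divide_eq mult.commute)
    moreover have "pairing M \<psi> (A h) - pairing M \<psi> (diff_quotient x h \<tau>) \<le>
        lp_norm M p (\<lambda>\<omega>. diff_quotient x h \<tau> \<omega> - A h \<omega>)"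
      using pairing_le_norm[OF \<psi>(2) X_closed(2)[OF mem(2,3)]] pairing_diff[OF \<psi>X mem(2,3)]
        lp_norm_minus_commute[of M p "A h" "diff_quotient x h \<tau>"] by linarith
    ultimately show ?thesis by linarith
  qed
  fix P assume "P \<in> {P. eventually P (procs_nhds M Filt p x \<times>\<^sub>F at_right (0::real))}"
  then obtain Q R where Q: "eventually Q (procs_nhds M Filt p x)" and R: "eventually R (at_right (0::real))"
    and P: "\<And>z \<tau>. Q z \<Longrightarrow> R \<tau> \<Longrightarrow> P (z, \<tau>)"
    unfolding mem_Collect_eq eventually_prod_filter by blast
  have Qx: "Q x"
    using Q x unfolding eventually_procs_nhds by (auto simp: lp_norm_zero)
  show "ereal (pairing M \<psi> (A h)) \<le> (SUP w\<in>Collect P. case w of (z, \<tau>) \<Rightarrow>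
      ereal ((lp_dist M p (F (\<lambda>\<omega>. z \<omega> + \<tau> *\<^sub>R h \<omega>)) Y - lp_dist M p (F z) Y) / \<tau>))"
    (is "_ \<le> ?S")
  proof (rule ereal_le_epsilon2)
    fix e :: real assume e: "0 < e"
    from strict_derivative[OF A x h this] obtain d where d: "0 < d"
        "\<And>\<tau>. 0 < \<tau> \<Longrightarrow> \<tau> < d \<Longrightarrow> lp_norm M p (\<lambda>\<omega>. diff_quotient x h \<tau> \<omega> - A h \<omega>) < e"
      using x by (force simp: lp_norm_zero)
    from R obtain b where b: "0 < b" "\<And>\<tau>. 0 < \<tau> \<Longrightarrow> \<tau> < b \<Longrightarrow> R \<tau>"
      by (auto simp: eventually_at_right_field)
    define \<tau> where "\<tau> = min b d / 2"
    have \<tau>: "0 < \<tau>" "\<tau> < b" "\<tau> < d" using b(1) d(1) by (auto simp: \<tau>_def)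
    have "ereal ((lp_dist M p (F (\<lambda>\<omega>. x \<omega> + \<tau> *\<^sub>R h \<omega>)) Y - lp_dist M p (F x) Y) / \<tau>) \<le> ?S"
      using P[OF Qx b(2)[OF \<tau>(1,2)]] by (intro SUP_upper2[where i="(x, \<tau>)"]) auto
    moreover have "ereal (pairing M \<psi> (A h)) \<le>
        ereal ((lp_dist M p (F (\<lambda>\<omega>. x \<omega> + \<tau> *\<^sub>R h \<omega>)) Y - lp_dist M p (F x) Y) / \<tau>) + ereal e"
      using quot[OF \<tau>(1)] d(2)[OF \<tau>(1,3)] by simp
    ultimately show "ereal (pairing M \<psi> (A h)) \<le> ?S + ereal e"
      by (meson add_right_mono order_trans)
  qed
qed

text \<open>
  The three conditions on \<open>\<psi>\<close> are bounds for a linear functional: it lies below the norm, it is at most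
  \<open>0\<close> at \<open>z - F x\<close> for \<open>z\<close> in \<open>Y\<close>, and it is \<open>\<langle>\<xi>, h\<rangle>\<close> at \<open>A h\<close>. The last two are encoded in the cone \<open>K\<close>
  generated by the vectors \<open>A h - c (z - F x)\<close> with the lower bounds \<open>\<langle>\<xi>, h\<rangle>\<close>. The hypothesis, applied
  to \<open>h / c\<close>, says that these lower bounds do not exceed the norm, so that the Mazur--Orlicz theorem
  applies, and its functional is represented by a process in the dual space.
\<close>

lemma ex_normal_multiplier:
  fixes Y :: "('a \<Rightarrow> (real^'m, 't) vec) set"
  assumes A: "has_gateaux_derivative M Filt p F A x" and x: "x \<in> X"
    and Y: "Y \<subseteq> X" "F x \<in> Y" "convex_procs Y"
    and \<xi>: "\<xi> \<in> X'"
    and le: "\<And>h. h \<in> X \<Longrightarrow> pairing M \<xi> h \<le> lp_dist M p (\<lambda>\<omega>. F x \<omega> + A h \<omega>) Y"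
  shows "\<exists>\<psi>. \<psi> \<in> normal_cone M Filt q Y (F x) \<and> \<psi> \<in> dual_ball M Filt p q \<and>
    (\<forall>h\<in>X. pairing M \<xi> h = pairing M \<psi> (A h))"
proof -
  define y where "y = F x"
  have y: "y \<in> X" "y \<in> Y" using F_mem[OF x] Y(2) by (auto simp: y_def)
  note A_mem = gateaux_derivative_mem[OF A]
  have zero_X: "(\<lambda>\<omega>. 0 :: (real^'n, 't) vec) \<in> X" and zero_Y: "(\<lambda>\<omega>. 0 :: (real^'m, 't) vec) \<in> X"
    by (rule X_closed)+
  have A_lin: "AE \<omega> in M. A (\<lambda>\<omega>. a *\<^sub>R h \<omega> + b *\<^sub>R k \<omega>) \<omega> = a *\<^sub>R A h \<omega> + b *\<^sub>R A k \<omega>"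
    if "h \<in> X" "k \<in> X" for h k a b
    using A that unfolding has_gateaux_derivative_def by blast
  \<comment> \<open>A is linear only up to null sets, so K has to be saturated with respect to them.\<close>
  define K where "K = {(v, s). v \<in> X \<and> (\<exists>h\<in>X. \<exists>c\<ge>0. \<exists>z\<in>Y.
      (AE \<omega> in M. v \<omega> = A h \<omega> - c *\<^sub>R (z \<omega> - y \<omega>)) \<and> s = pairing M \<xi> h)}"
  have K_add: "(v + w, s + r) \<in> K" if vs: "(v, s) \<in> K" and wr: "(w, r) \<in> K" for v w s r
  proof -
    from vs obtain h c z where v: "v \<in> X" "h \<in> X" "0 \<le> c" "z \<in> Y"
        "AE \<omega> in M. v \<omega> = A h \<omega> - c *\<^sub>R (z \<omega> - y \<omega>)" "s = pairing M \<xi> h"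
      by (auto simp: K_def)
    from wr obtain h' c' z' where w: "w \<in> X" "h' \<in> X" "0 \<le> c'" "z' \<in> Y"
        "AE \<omega> in M. w \<omega> = A h' \<omega> - c' *\<^sub>R (z' \<omega> - y \<omega>)" "r = pairing M \<xi> h'"
      by (auto simp: K_def)
    \<comment> \<open>Convexity of Y makes the multiples of Y - y a convex cone.\<close>
    obtain z'' where z'': "z'' \<in> Y"
      "\<And>\<omega>. c *\<^sub>R (z \<omega> - y \<omega>) + c' *\<^sub>R (z' \<omega> - y \<omega>) = (c + c') *\<^sub>R (z'' \<omega> - y \<omega>)"
    proof (cases "c + c' = 0")
      case True
      then have "c = 0" "c' = 0" using v(3) w(3) by auto
      then show ?thesis using that[OF v(4)] by simp
    next
      case False
      define u where "u = c' / (c + c')"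
      have u: "0 \<le> u" "u \<le> 1" "(c + c') * u = c'" "(c + c') * (1 - u) = c"
        using False v(3) w(3) by (auto simp: u_def field_simps)
      have "(\<lambda>\<omega>. (1 - u) *\<^sub>R z \<omega> + u *\<^sub>R z' \<omega>) \<in> Y"
        using Y(3) v(4) w(4) u(1,2) by (simp add: convex_procs_def)
      moreover have "c *\<^sub>R (z \<omega> - y \<omega>) + c' *\<^sub>R (z' \<omega> - y \<omega>) =
          (c + c') *\<^sub>R (((1 - u) *\<^sub>R z \<omega> + u *\<^sub>R z' \<omega>) - y \<omega>)" for \<omega>
      proof -
        have "(c + c') *\<^sub>R (((1 - u) *\<^sub>R z \<omega> + u *\<^sub>R z' \<omega>) - y \<omega>) =
            ((c + c') * (1 - u)) *\<^sub>R z \<omega> + ((c + c') * u) *\<^sub>R z' \<omega> - (c + c') *\<^sub>R y \<omega>"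
          by (simp add: scaleR_diff_right scaleR_add_right)
        then show ?thesis unfolding u by (simp add: algebra_simps)
      qed
      ultimately show ?thesis by (rule that)
    qed
    have "AE \<omega> in M. (v + w) \<omega> = A (\<lambda>\<omega>. h \<omega> + h' \<omega>) \<omega> - (c + c') *\<^sub>R (z'' \<omega> - y \<omega>)"
      using v(5) w(5) A_lin[OF v(2) w(2), of 1 1]
      by eventually_elim (simp flip: z''(2))
    moreover have "v + w \<in> X" using X_closed(1)[OF v(1) w(1)] by (simp add: plus_fun_def)
    moreover have "s + r = pairing M \<xi> (\<lambda>\<omega>. h \<omega> + h' \<omega>)"
      using pairing_add[OF \<xi> v(2) w(2)] v(6) w(6) by simp
    moreover have "(\<lambda>\<omega>. h \<omega> + h' \<omega>) \<in> X" "0 \<le> c + c'"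
      using X_closed(1)[OF v(2) w(2)] v(3) w(3) by auto
    ultimately show ?thesis using z''(1) unfolding K_def by blast
  qed
  have K_scale: "(a *\<^sub>R v, a * s) \<in> K" if vs: "(v, s) \<in> K" and a: "0 \<le> a" for v s a
  proof -
    from vs obtain h c z where v: "v \<in> X" "h \<in> X" "0 \<le> c" "z \<in> Y"
        "AE \<omega> in M. v \<omega> = A h \<omega> - c *\<^sub>R (z \<omega> - y \<omega>)" "s = pairing M \<xi> h"
      by (auto simp: K_def)
    have "AE \<omega> in M. (a *\<^sub>R v) \<omega> = A (\<lambda>\<omega>. a *\<^sub>R h \<omega>) \<omega> - (a * c) *\<^sub>R (z \<omega> - y \<omega>)"
      using v(5) A_lin[OF v(2) v(2), of a 0]
      by eventually_elim (simp add: scaleR_diff_right)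
    moreover have "a *\<^sub>R v \<in> X" using X_closed(3)[OF v(1)] by (simp add: scaleR_fun_def)
    moreover have "a * s = pairing M \<xi> (\<lambda>\<omega>. a *\<^sub>R h \<omega>)" using v(6) by (simp add: pairing_scaleR)
    moreover have "(\<lambda>\<omega>. a *\<^sub>R h \<omega>) \<in> X" "0 \<le> a * c" using X_closed(3)[OF v(2)] v(3) a by auto
    ultimately show ?thesis using v(4) unfolding K_def by blast
  qed
  have K_le: "s \<le> lp_norm M p v" if vs: "(v, s) \<in> K" for v s
  proof -
    from vs obtain h c z where v: "v \<in> X" "h \<in> X" "0 \<le> c" "z \<in> Y"
        "AE \<omega> in M. v \<omega> = A h \<omega> - c *\<^sub>R (z \<omega> - y \<omega>)" "s = pairing M \<xi> h"
      by (auto simp: K_def)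
    have zX: "z \<in> X" using v(4) Y(1) by auto
    show ?thesis
    proof (cases "c = 0")
      case True
      have "s \<le> lp_norm M p (\<lambda>\<omega>. (F x \<omega> + A h \<omega>) - y \<omega>)"
        using le[OF v(2)] lp_dist_le[OF y(2), of "\<lambda>\<omega>. F x \<omega> + A h \<omega>"] v(6) by linarith
      also have "\<dots> = lp_norm M p v"
      proof (rule lp_norm_cong)
        show "AE \<omega> in M. F x \<omega> + A h \<omega> - y \<omega> = v \<omega>"
          using v(5) by eventually_elim (simp add: True y_def)
      qed (intro procs_measurable[OF p0(2)] X_closed F_mem x A_mem v(1,2) y(1))+
      finally show ?thesis .
    next
      case False
      then have c: "0 < c" using v(3) by simp
      define k where "k \<omega> = (1 / c) *\<^sub>R h \<omega>" for \<omega>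
      have k: "k \<in> X" unfolding k_def[abs_def] by (intro X_closed v(2))
      have "s / c = pairing M \<xi> k"
        using v(6) by (simp add: k_def[abs_def] pairing_scaleR)
      also have "\<dots> \<le> lp_norm M p (\<lambda>\<omega>. (F x \<omega> + A k \<omega>) - z \<omega>)"
        using le[OF k] lp_dist_le[OF v(4), of "\<lambda>\<omega>. F x \<omega> + A k \<omega>"] by linarith
      also have "\<dots> = lp_norm M p (\<lambda>\<omega>. (1 / c) *\<^sub>R v \<omega>)"
      proof (rule lp_norm_cong)
        show "AE \<omega> in M. F x \<omega> + A k \<omega> - z \<omega> = (1 / c) *\<^sub>R v \<omega>"
          using v(5) A_lin[OF v(2) v(2), of "1 / c" 0]
          by eventually_elim (use c in \<open>simp add: k_def[abs_def] y_def scaleR_diff_right\<close>)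
      qed (intro procs_measurable[OF p0(2)] X_closed F_mem x A_mem k v(1) zX)+
      finally show ?thesis
        using c by (simp add: lp_norm_scaleR[OF p0(1)] divide_le_eq)
    qed
  qed
  have zero_in_K: "(0, 0) \<in> K"
  proof -
    have "AE \<omega> in M. 0 = A (\<lambda>\<omega>. 0) \<omega>"
      using A_lin[OF zero_X zero_X, of 0 0] by simp
    then have "AE \<omega> in M. 0 = A (\<lambda>\<omega>. 0) \<omega> - 0 *\<^sub>R (y \<omega> - y \<omega>)" by simp
    moreover have "0 = pairing M \<xi> (\<lambda>\<omega>. 0)" by (simp add: pairing_def)
    ultimately show ?thesis
      using zero_X zero_Y y(2) order_refl[of "0::real"] unfolding K_def zero_fun_def by blast
  qed
  have K_mem: "v \<in> X" if "(v, s) \<in> K" for v s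
    using that by (auto simp: K_def)
  have "\<exists>l. (\<forall>a\<in>X. \<forall>b\<in>X. l (a + b) = l a + l b) \<and> (\<forall>a\<in>X. \<forall>c. l (c *\<^sub>R a) = c * l a) \<and>
      (\<forall>a\<in>X. l a \<le> lp_norm M p a) \<and> (\<forall>(v, s)\<in>K. s \<le> l v)"
    by (rule Mazur_Orlicz[OF subspace_procs[OF p0(2)] lp_norm_sublinear])
      (fact K_mem zero_in_K K_add K_scale K_le)+
  then obtain l where l: "\<And>a b. a \<in> X \<Longrightarrow> b \<in> X \<Longrightarrow> l (a + b) = l a + l b"
      "\<And>a c. a \<in> X \<Longrightarrow> l (c *\<^sub>R a) = c * l a" "\<And>a. a \<in> X \<Longrightarrow> l a \<le> lp_norm M p a"
      "\<And>v s. (v, s) \<in> K \<Longrightarrow> s \<le> l v"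
    by blast
  obtain \<psi> where \<psi>: "\<psi> \<in> X'" and l_eq: "\<And>v. v \<in> X \<Longrightarrow> l v = pairing M \<psi> v"
    using ex_process_representation[of l] l(1,2,3) unfolding plus_fun_def scaleR_fun_def by blast
  have "\<psi> \<in> dual_ball M Filt p q"
    by (rule dual_ballI[OF \<psi>]) (use l(3) l_eq in force)
  moreover have "\<psi> \<in> normal_cone M Filt q Y (F x)"
  proof -
    have "pairing M \<psi> (\<lambda>\<omega>. z \<omega> - y \<omega>) \<le> 0" if z: "z \<in> Y" for z
    proof -
      have zy: "(\<lambda>\<omega>. z \<omega> - y \<omega>) \<in> X" using z Y(1) y(1) by (intro X_closed) auto
      have "AE \<omega> in M. - 1 *\<^sub>R (z \<omega> - y \<omega>) = A (\<lambda>\<omega>. 0) \<omega> - 1 *\<^sub>R (z \<omega> - y \<omega>)"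
        using A_lin[OF zero_X zero_X, of 0 0] by (auto elim: eventually_mono)
      moreover have "(\<lambda>\<omega>. - 1 *\<^sub>R (z \<omega> - y \<omega>)) \<in> X" by (intro X_closed(3) zy)
      moreover have "0 = pairing M \<xi> (\<lambda>\<omega>. 0)" by (simp add: pairing_def)
      ultimately have "(\<lambda>\<omega>. - 1 *\<^sub>R (z \<omega> - y \<omega>), 0) \<in> K"
        unfolding K_def using zero_X z zero_le_one by blast
      then have "0 \<le> pairing M \<psi> (\<lambda>\<omega>. - 1 *\<^sub>R (z \<omega> - y \<omega>))"
        using l(4) l_eq K_mem by force
      then show ?thesis by (simp only: pairing_scaleR)
    qed
    then show ?thesis using \<psi> by (simp add: normal_cone_def y_def)
  qed
  moreover have "pairing M \<xi> h = pairing M \<psi> (A h)" if h: "h \<in> X" for h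
  proof -
    have ge: "c * pairing M \<xi> h \<le> c * pairing M \<psi> (A h)" for c
    proof -
      have "AE \<omega> in M. c *\<^sub>R A h \<omega> = A (\<lambda>\<omega>. c *\<^sub>R h \<omega>) \<omega> - 0 *\<^sub>R (y \<omega> - y \<omega>)"
        using A_lin[OF h h, of c 0] by (auto elim: eventually_mono)
      moreover have "(\<lambda>\<omega>. c *\<^sub>R A h \<omega>) \<in> X" "(\<lambda>\<omega>. c *\<^sub>R h \<omega>) \<in> X"
        by (intro X_closed(3) A_mem h)+
      moreover have "c * pairing M \<xi> h = pairing M \<xi> (\<lambda>\<omega>. c *\<^sub>R h \<omega>)" by (simp add: pairing_scaleR)
      ultimately have "(\<lambda>\<omega>. c *\<^sub>R A h \<omega>, c * pairing M \<xi> h) \<in> K"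
        unfolding K_def using y(2) order_refl[of "0::real"] by blast
      then show ?thesis using l(4) l_eq K_mem by (fastforce simp: pairing_scaleR)
    qed
    \<comment> \<open>The vectors A h form a subspace, so the lower bound at h and at - h is an equality.\<close>
    from ge[of 1] ge[of "-1"] show ?thesis by simp
  qed
  ultimately show ?thesis by blast
qed

end

theorem theorem3p3:
  fixes M :: "'a measure"
    and Filt :: "'t::{finite,linorder} \<Rightarrow> 'a measure"
    and p :: real and q :: ennreal
    and F :: "('a \<Rightarrow> (real^'n, 't) vec) \<Rightarrow> 'a \<Rightarrow> (real^'m, 't) vec"
    and f :: "'t \<Rightarrow> (real^'n, 't) vec \<Rightarrow> 'a \<Rightarrow> real^'m"
    and f' :: "'t \<Rightarrow> (real^'n, 't) vec \<Rightarrow> 'a \<Rightarrow> (real^'n, 't) vec \<Rightarrow>\<^sub>L (real^'m)"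
    and Y :: "('a \<Rightarrow> (real^'m, 't) vec) set"
    and x :: "'a \<Rightarrow> (real^'n, 't) vec"
  assumes "filtered_prob_space M Filt"
    and "1 \<le> p" and "1 / ennreal p + 1 / q = 1"
    and "causal_by M Filt p F f"
    and "assumption1 M Filt p f f'"
    and "Y \<subseteq> procs M Filt (ennreal p)"
    and "convex_procs Y" and "closed_procs M Filt p Y"
    and "x \<in> procs M Filt (ennreal p)" and "F x \<in> Y"
  shows "clarke_subdiff M Filt p q (\<lambda>z. lp_dist M p (F z) Y) x =
    adjoint_rel M Filt p q (gateaux_derivative M Filt p F x) ``
      (normal_cone M Filt q Y (F x) \<inter> dual_ball M Filt p q)"
proof -
  interpret causal_operator M Filt p q F f f'
    using assms(1-5) by unfold_locales
  define A where "A = gateaux_derivative M Filt p F x"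
  have A: "has_gateaux_derivative M Filt p F A x"
    unfolding A_def gateaux_derivative_def using dF_is_derivative[OF assms(9)]
    by (rule someI[where P="\<lambda>A. has_gateaux_derivative M Filt p F A x"])
  have Y_ne: "Y \<noteq> {}" using assms(10) by auto
  have "\<xi> \<in> adjoint_rel M Filt p q A `` (normal_cone M Filt q Y (F x) \<inter> dual_ball M Filt p q)"
    if \<xi>: "\<xi> \<in> clarke_subdiff M Filt p q (\<lambda>z. lp_dist M p (F z) Y) x" for \<xi>
  proof -
    have \<xi>': "\<xi> \<in> X'" using \<xi> by (simp add: clarke_subdiff_def)
    have "pairing M \<xi> h \<le> lp_dist M p (\<lambda>\<omega>. F x \<omega> + A h \<omega>) Y" if h: "h \<in> X" for h
    proof -
      have "ereal (pairing M \<xi> h) \<le> clarke_dderiv M Filt p (\<lambda>z. lp_dist M p (F z) Y) x h"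
        using \<xi> h by (simp add: clarke_subdiff_def)
      also have "\<dots> \<le> ereal (lp_dist M p (\<lambda>\<omega>. F x \<omega> + A h \<omega>) Y)"
        by (rule clarke_dderiv_le_dist[OF A assms(9) h assms(6) Y_ne assms(7)])
      finally show ?thesis by simp
    qed
    from ex_normal_multiplier[OF A assms(9,6,10,7) \<xi>' this] show ?thesis
      using \<xi>' by (auto simp: adjoint_rel_def dual_ball_def)
  qed
  moreover have "\<xi> \<in> clarke_subdiff M Filt p q (\<lambda>z. lp_dist M p (F z) Y) x"
    if "\<xi> \<in> adjoint_rel M Filt p q A `` (normal_cone M Filt q Y (F x) \<inter> dual_ball M Filt p q)" for \<xi>
  proof -
    from that obtain \<psi> where \<psi>: "\<psi> \<in> normal_cone M Filt q Y (F x)" "\<psi> \<in> dual_ball M Filt p q"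
        and adj: "(\<psi>, \<xi>) \<in> adjoint_rel M Filt p q A"
      by auto
    show ?thesis
      using adj pairing_le_clarke_dderiv[OF A assms(9) _ assms(6,10) \<psi>]
      by (auto simp: clarke_subdiff_def adjoint_rel_def)
  qed
  ultimately show ?thesis unfolding A_def[symmetric] by blast
qed

end
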